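(* Let $(A_n)_{n\in\mathbb{N}}$ be a $\delta$-fine family of discretisations of a continuous first-price or all-pay auction with $N$ buyers whose prior is the power law $F(w)=w^\alpha$ on $[0,1]$ with parameter $\alpha>0$, and with canonical equilibrium bidding strategy $\beta$ (in quantile coordinates). Then any Bayesian coarse correlated equilibrium $\sigma^n$ of $A_n$ with symmetric support (i.e. $\sigma^n(\lambda)>0$ implies $\lambda_i=\lambda_j$ for all $i,j$) satisfies $$\sum_{\lambda\in\Lambda_n}\sigma^n(\lambda)\sum_{i\in[N]}\int_0^1 d\theta_i\cdot\theta_i^{N-2}\cdot\frac{(\lambda_i(\theta_i)-\beta(\theta_i))^2}{2}\ \le\ K(\alpha,N)\,N\cdot\begin{cases}4\delta(n)\left(1-\ln(4\delta(n))\right) & \alpha=1,\\ 4\delta(n)\left(\frac{\alpha}{\alpha-1}\right)-\frac{(4\delta(n))^\alpha}{\alpha-1} & \alpha\ne1,\end{cases}$$ where 1. if $A_n$ is an all-pay auction and $\alpha>0$, $K(\alpha,N)=\max\{\max B,\ \alpha(2N-3)\}$; and 2. if $A_n$ is a first-price auction and $\alpha\in(0,1)$, $K(\alpha,N)=\max\left\{\max B,\ \alpha(2N-3),\ \frac{\alpha(N-1)}{1-\alpha}\right\}$. Here $\Lambda_n$ is the set of symmetric profiles of $A_n$, each identified with its induced piecewise constant profile on $[0,1]$.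
   Context: Continuous auction in quantile coordinates. There are $N$ buyers with i.i.d. valuations drawn from the c.d.f. $F(w)=w^\alpha$ on $V=[0,1]$; bids lie in an interval $B=[0,\max B]\supseteq V$. Set $v(\theta)=F^{-1}(\theta)=\theta^{1/\alpha}$ for $\theta\in[0,1]$. Types $\theta_i$ are i.i.d. uniform on $[0,1]$, and a buyer of type $\theta_i$ has valuation $v(\theta_i)$. Allocation (uniform tie-breaking): $x_i(b)=1/|\arg\max_j b_j|$ if $i\in\arg\max_j b_j$, and $x_i(b)=0$ otherwise. First-price utility: $u_i(b|w)=x_i(b)(w-b_i)$; all-pay utility: $u_i(b|w)=x_i(b)w-b_i$, for valuation $w$. Canonical equilibrium: first-price $\beta(0)=0$, $\beta(\theta)=\frac{1}{\theta^{N-1}}\int_0^\theta (N-1)t^{N-2}v(t)\,dt$ for $\theta\in(0,1]$; all-pay $\beta(\theta)=\int_0^\theta (N-1)t^{N-2}v(t)\,dt$. Discretisations. For a decreasing $\delta:\mathbb{N}\to\mathbb{R}_+$ with $\delta(n)\to0$, a $\delta$-fine family of discretisations is a sequence $A_n$ given by finite sets $V_n=\{v^n_0<v^n_1<\dots<v^n_{K_n}\}\subseteq[0,1)$ and $B_n\subseteq B$, with $v^n_0=0$, $0\in B_n$, $\max B\in B_n$, and prior $F_n(v^n_k)=F(v^n_{k+1})-F(v^n_k)$ where $v^n_{K_n+1}:=1$, such that $F_n\to F$ in probability and $\sup_{w\in V}\inf_{w'\in V_n}|w-w'|\le\delta(n)$, $\sup_{b\in B}\inf_{b'\in B_n}|b-b'|\le\delta(n)$.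 In $A_n$ valuations are i.i.d. from $F_n$, bids are in $B_n$, and $u_i$ is as in the continuous auction. A Bayesian coarse correlated equilibrium (BCCE) of $A_n$ is a probability distribution $\sigma$ on pure profiles $\lambda=(\lambda_i:V_n\to B_n)_{i\in[N]}$ such that for all $i\in[N]$, $v_i\in V_n$, $b'_i\in B_n$: $\mathbb{E}_{\lambda\sim\sigma,\,v_{-i}\sim F_n^{N-1}}[u_i(b'_i,\lambda_{-i}(v_{-i})|v_i)-u_i(\lambda(v)|v_i)]\le0$. Induced profile: $\lambda_i:V_n\to B_n$ is extended to $[0,1]$ (same symbol) by $\lambda_i(\theta)=\lambda_i(v^n_k)$ whenever $v(\theta)\in[v^n_k,v^n_{k+1})$, and $\lambda_i(1)=\lambda_i(v^n_{K_n})$.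
   Formalization: The bound is proved for those n with 4δ(n) ≤ 1; without this the claim fails, e.g. for α = 1 and 4δ(n) > e the right-hand side is negative while the left-hand side is nonnegative. *)

theory Defs
  imports "HOL-Probability.Probability"
begin

text \<open>
  Buyers are the indices in \<open>{..<N}\<close>; a bid profile is a function \<open>nat \<Rightarrow> real\<close> of
  which only the values at indices below \<open>N\<close> matter. The set of valuations is
  \<open>{0..1}\<close>, the set of bids is \<open>{0..Bmax}\<close>.
\<close>

datatype auction_format = First_Price | All_Pay

definition highest_bidders :: "nat \<Rightarrow> (nat \<Rightarrow> real) \<Rightarrow> nat set" where
  "highest_bidders N b = {i. is_arg_max b (\<lambda>j. j < N) i}"

definition allocation :: "nat \<Rightarrow> (nat \<Rightarrow> real) \<Rightarrow> nat \<Rightarrow> real" where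
  "allocation N b i =
     (if i \<in> highest_bidders N b then 1 / real (card (highest_bidders N b)) else 0)"

fun utility :: "auction_format \<Rightarrow> nat \<Rightarrow> nat \<Rightarrow> (nat \<Rightarrow> real) \<Rightarrow> real \<Rightarrow> real" where
  "utility First_Price N i b w = allocation N b i * (w - b i)"
| "utility All_Pay N i b w = allocation N b i * w - b i"

text \<open>The c.d.f. \<open>w\<^sup>\<alpha>\<close> on \<open>[0,1]\<close>, extended to the real line by 0 on the left and 1 on the right.\<close>

definition power_cdf :: "real \<Rightarrow> real \<Rightarrow> real" where
  "power_cdf \<alpha> w = (min 1 (max 0 w)) powr \<alpha>"

definition valuation :: "real \<Rightarrow> real \<Rightarrow> real" where
  "valuation \<alpha> \<theta> = \<theta> powr (1 / \<alpha>)"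

text \<open>
  The exponent \<open>N - 2\<close> is taken in the integers, so that it is not truncated for \<open>N = 1\<close>.
\<close>

fun canonical_eq :: "auction_format \<Rightarrow> nat \<Rightarrow> real \<Rightarrow> real \<Rightarrow> real" where
  "canonical_eq First_Price N \<alpha> \<theta> =
     (if \<theta> = 0 then 0
      else 1 / \<theta> ^ (N - 1) *
        integral {0..\<theta>} (\<lambda>t. (real N - 1) * t powi (int N - 2) * valuation \<alpha> t))"
| "canonical_eq All_Pay N \<alpha> \<theta> =
     integral {0..\<theta>} (\<lambda>t. (real N - 1) * t powi (int N - 2) * valuation \<alpha> t)"

text \<open>
  For a finite \<open>V \<subseteq> [0,1)\<close> with elements \<open>v\<^sub>0 < \<dots> < v\<^sub>K\<close>, the successor of \<open>v\<^sub>k\<close> is \<open>v\<^sub>k\<^sub>+\<^sub>1\<close>, where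
  the successor of \<open>v\<^sub>K\<close> is 1.
\<close>

definition succ_val :: "real set \<Rightarrow> real \<Rightarrow> real" where
  "succ_val V v = Min (insert 1 {w \<in> V. v < w})"

text \<open>
  A family of discretisations: \<open>V n\<close> and \<open>B n\<close> are the valuations and bids of the \<open>n\<close>-th auction
  and \<open>F n\<close> is its prior. Convergence of the priors is convergence in distribution.
\<close>

definition delta_fine ::
  "real \<Rightarrow> real \<Rightarrow> (nat \<Rightarrow> real) \<Rightarrow> (nat \<Rightarrow> real set) \<Rightarrow> (nat \<Rightarrow> real set) \<Rightarrow> (nat \<Rightarrow> real pmf) \<Rightarrow> bool"
where
  "delta_fine \<alpha> Bmax \<delta> V B F \<longleftrightarrow>
     antimono \<delta> \<and> (\<forall>n. 0 \<le> \<delta> n) \<and> \<delta> \<longlonglongrightarrow> 0 \<and>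
     (\<forall>n. finite (V n) \<and> V n \<subseteq> {0..<1} \<and> 0 \<in> V n \<and>
          finite (B n) \<and> B n \<subseteq> {0..Bmax} \<and> 0 \<in> B n \<and> Bmax \<in> B n \<and>
          set_pmf (F n) \<subseteq> V n \<and>
          (\<forall>v\<in>V n. pmf (F n) v = power_cdf \<alpha> (succ_val (V n) v) - power_cdf \<alpha> v) \<and>
          (SUP w\<in>{0..1}. INF w'\<in>V n. \<bar>w - w'\<bar>) \<le> \<delta> n \<and>
          (SUP b\<in>{0..Bmax}. INF b'\<in>B n. \<bar>b - b'\<bar>) \<le> \<delta> n) \<and>
     weak_conv (\<lambda>n. cdf (measure_pmf (F n))) (power_cdf \<alpha>)"

definition pure_profiles :: "nat \<Rightarrow> real set \<Rightarrow> real set \<Rightarrow> (nat \<Rightarrow> real \<Rightarrow> real) set" where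
  "pure_profiles N V B = {..<N} \<rightarrow>\<^sub>E (V \<rightarrow>\<^sub>E B)"

definition symmetric_profiles :: "nat \<Rightarrow> real set \<Rightarrow> real set \<Rightarrow> (nat \<Rightarrow> real \<Rightarrow> real) set" where
  "symmetric_profiles N V B = {l \<in> pure_profiles N V B. \<forall>i<N. \<forall>j<N. l i = l j}"

text \<open>
  The valuations of the opponents of \<open>i\<close> are sampled from the \<open>(N-1)\<close>-fold product of \<open>F\<close>,
  independently of the profile \<open>l\<close>; \<open>vo(i := w)\<close> is then the full vector of valuations.
\<close>

definition BCCE ::
  "auction_format \<Rightarrow> nat \<Rightarrow> real set \<Rightarrow> real set \<Rightarrow> real pmf \<Rightarrow> (nat \<Rightarrow> real \<Rightarrow> real) pmf \<Rightarrow> bool"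
where
  "BCCE fmt N V B F \<sigma> \<longleftrightarrow>
     set_pmf \<sigma> \<subseteq> pure_profiles N V B \<and>
     (\<forall>i<N. \<forall>w\<in>V. \<forall>b'\<in>B.
        measure_pmf.expectation (pair_pmf \<sigma> (Pi_pmf ({..<N} - {i}) 0 (\<lambda>_. F)))
          (\<lambda>(l, vo). let bids = (\<lambda>j. l j ((vo(i := w)) j))
                     in utility fmt N i (bids(i := b')) w - utility fmt N i bids w) \<le> 0)"

text \<open>
  The piecewise constant extension of a strategy \<open>V \<rightarrow> B\<close> to quantiles. At \<open>\<theta> = 1\<close> the maximum
  is the largest element of \<open>V\<close>, as required by the convention for that point.
\<close>

definition induced :: "real \<Rightarrow> real set \<Rightarrow> (real \<Rightarrow> real) \<Rightarrow> real \<Rightarrow> real" where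
  "induced \<alpha> V s \<theta> = s (Max {w \<in> V. w \<le> valuation \<alpha> \<theta>})"

fun K_const :: "auction_format \<Rightarrow> real \<Rightarrow> nat \<Rightarrow> real \<Rightarrow> real" where
  "K_const All_Pay \<alpha> N Bmax = Max {Bmax, \<alpha> * (2 * real N - 3)}"
| "K_const First_Price \<alpha> N Bmax =
     Max {Bmax, \<alpha> * (2 * real N - 3), \<alpha> * (real N - 1) / (1 - \<alpha>)}"

end

theory Submission
  imports Defs
begin

text \<open>
  Let \<open>\<beta>\<close> be the canonical equilibrium, \<open>v\<close> the valuation in quantile coordinates and \<open>q\<close> the
  probability that all opponents bid below \<open>\<beta> \<theta>\<close>. Weight the deviation of type \<open>\<theta>\<close> to (a grid
  point just above) \<open>\<beta> \<theta>\<close> by \<open>1 / v \<theta>\<close> and integrate over \<open>\<theta>\<close>. Discretising values and bids costs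
  at most \<open>4 \<delta>\<close> per type, and comparing with the deviation to the bid 0 shows that a type never
  costs more than \<open>v \<theta>\<close>; so the weighted gain is at most the integral of \<open>min 1 (4 \<delta> / v \<theta>)\<close>, which
  is the bound of the theorem. Conversely, for every symmetric profile the weighted gain dominates the
  squared distance to \<open>\<beta>\<close> divided by \<open>K\<close>.

  For the all-pay auction the tangent inequality for \<open>q = H ^ (N - 1)\<close> makes the gain an integral of a
  function of \<open>\<theta>\<close> and of the bid of \<open>\<theta>\<close> alone, which is minimal at \<open>\<beta> \<theta>\<close> and convex enough.
  For the first-price auction the payments \<open>x l / v\<close> depend on the ranks of the bids. Here the bids are
  sliced into levels \<open>b\<close>: let \<open>E\<close> be the set of types bidding at least \<open>b\<close> and let \<open>H\<close> be the mass of its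
  complement. The probability that the winner has a type in \<open>A \<subseteq> E\<close> is at least
  \<open>(H + |A|) ^ N - H ^ N\<close>; with Abel summation and Chebyshev's inequality this reduces the level to
  \<open>E = {H..1}\<close>, and the resulting function of \<open>H\<close> is minimal where \<open>\<beta> H = b\<close>.
\<close>

text \<open>Division by \<open>v \<theta>\<close> turns the allocation term \<open>x * v\<close>
  into \<open>x\<close>, whose integral over types is at most \<open>1 / N\<close> for every profile
  because only one item is sold. So nothing else about the winner's identity matters, apart from the
  payments \<open>x * l / v\<close> of the first-price auction. The price is that
  \<open>1 / v\<close> is not integrable at 0 when \<alpha> \<le> 1. Hence type 0 is shown to bid 0
  in every profile of the support, which removes its cell from the payments. The entries of
  \<open>K\<close> answer two demands. Above the top equilibrium bid \<open>\<kappa>\<close>,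
  \<open>K \<ge> Bmax\<close> keeps the slope of the loss divided by \<open>K\<close> below that of
  the payments. Up to \<open>\<kappa>\<close>, a marginal trade-off must decrease in the type:
  \<open>t powr (-(1/\<alpha>)) + \<kappa> / K * t powr e\<close> for all-pay,
  \<open>t powr (1 - e) + \<kappa> / K * t powr e\<close> with \<open>e = 1/\<alpha>\<close> for
  first-price. The latter can only decrease if \<open>e > 1\<close>, which is where \<alpha> < 1
  enters. The 4 in \<open>4 \<delta>\<close> arises because valuations are rounded down and bids up,
  each by at most a full grid gap \<open>2 \<delta>\<close>.\<close>

section \<open>Types of a discretised prior\<close>

locale type_grid =
  fixes V :: "real set" and \<alpha> :: real
  assumes finite_V: "finite V" and V_sub: "V \<subseteq> {0..<1}" and zero_V: "0 \<in> V" and alpha_pos: "0 < \<alpha>"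
begin

text \<open>The quantiles whose valuation is rounded down to \<open>w\<close> form the interval from
  \<open>lo w\<close> to \<open>hi w\<close>; its length \<open>mass w\<close> is the prior
  probability of \<open>w\<close>.\<close>

definition lo :: "real \<Rightarrow> real" where "lo w = w powr \<alpha>"
definition hi :: "real \<Rightarrow> real" where "hi w = succ_val V w powr \<alpha>"
definition mass :: "real \<Rightarrow> real" where "mass w = hi w - lo w"
text \<open>The grid point used by \<open>induced\<close>, so that
  \<open>induced \<alpha> V s \<theta> = s (cell \<theta>)\<close>.\<close>

definition cell :: "real \<Rightarrow> real" where "cell \<theta> = Max {w \<in> V. w \<le> valuation \<alpha> \<theta>}"

lemma succ_gt: "w \<in> V \<Longrightarrow> w < succ_val V w"
  and succ_le_1: "succ_val V w \<le> 1"
  and succ_in: "succ_val V w \<in> insert 1 V"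
  and succ_le: "w' \<in> V \<Longrightarrow> w < w' \<Longrightarrow> succ_val V w \<le> w'"
proof -
  have fin: "finite (insert 1 {w' \<in> V. w < w'})" for w using finite_V by simp
  show "w \<in> V \<Longrightarrow> w < succ_val V w"
    unfolding succ_val_def using V_sub fin by (subst Min_gr_iff) auto
  show "succ_val V w \<le> 1" unfolding succ_val_def using fin by (intro Min_le) auto
  show "succ_val V w \<in> insert 1 V"
    unfolding succ_val_def using Min_in[OF fin] by blast
  show "w' \<in> V \<Longrightarrow> w < w' \<Longrightarrow> succ_val V w \<le> w'"
    unfolding succ_val_def using fin by (intro Min_le) auto
qed

lemma V_nonneg: "w \<in> V \<Longrightarrow> 0 \<le> w" using V_sub by auto

lemma lo_nonneg: "0 \<le> lo w" by (simp add: lo_def)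

lemma lo_pos: "w \<in> V \<Longrightarrow> w \<noteq> 0 \<Longrightarrow> 0 < lo w"
  using V_nonneg by (simp add: lo_def)

lemma lo_less_hi: "w \<in> V \<Longrightarrow> lo w < hi w"
  unfolding lo_def hi_def using succ_gt V_nonneg alpha_pos by (intro powr_less_mono2) auto

lemma mass_pos: "w \<in> V \<Longrightarrow> 0 < mass w"
  using lo_less_hi by (simp add: mass_def)

lemma hi_le_1: "w \<in> V \<Longrightarrow> hi w \<le> 1"
  unfolding hi_def using succ_le_1[of w] succ_gt[of w] V_nonneg[of w] alpha_pos
  by (intro powr_le1) auto

lemma hi_le_lo: "w \<in> V \<Longrightarrow> w' \<in> V \<Longrightarrow> w < w' \<Longrightarrow> hi w \<le> lo w'"
  unfolding hi_def lo_def using succ_le[of w' w] succ_gt[of w] V_nonneg[of w] alpha_pos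
  by (intro powr_mono2) auto

lemma lo_le_iff: "w \<in> V \<Longrightarrow> w' \<in> V \<Longrightarrow> lo w \<le> lo w' \<longleftrightarrow> w \<le> w'"
  using hi_le_lo[of w w'] hi_le_lo[of w' w] lo_less_hi[of w] lo_less_hi[of w']
  by (cases w w' rule: linorder_cases) auto

lemma valuation_ge_iff: "0 \<le> w \<Longrightarrow> 0 \<le> \<theta> \<Longrightarrow> w \<le> valuation \<alpha> \<theta> \<longleftrightarrow> w powr \<alpha> \<le> \<theta>"
proof -
  assume a: "0 \<le> w" "0 \<le> \<theta>"
  have "valuation \<alpha> \<theta> powr \<alpha> = \<theta>"
    using a alpha_pos by (simp add: valuation_def powr_powr)
  moreover have "0 \<le> valuation \<alpha> \<theta>" by (simp add: valuation_def)
  ultimately show ?thesis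
    using a alpha_pos powr_mono2[of \<alpha> w "valuation \<alpha> \<theta>"] powr_less_mono2[of \<alpha> "valuation \<alpha> \<theta>" w]
    by (cases "w \<le> valuation \<alpha> \<theta>") auto
qed

lemma cell_props:
  assumes "0 \<le> \<theta>"
  shows cell_in: "cell \<theta> \<in> V" and cell_le: "cell \<theta> \<le> valuation \<alpha> \<theta>"
    and cell_ge: "w \<in> V \<Longrightarrow> w \<le> valuation \<alpha> \<theta> \<Longrightarrow> w \<le> cell \<theta>"
proof -
  have fin: "finite {w \<in> V. w \<le> valuation \<alpha> \<theta>}" using finite_V by simp
  have "0 \<in> {w \<in> V. w \<le> valuation \<alpha> \<theta>}" using zero_V by (simp add: valuation_def)
  hence "cell \<theta> \<in> {w \<in> V. w \<le> valuation \<alpha> \<theta>}"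
    unfolding cell_def using fin by (intro Max_in) auto
  thus "cell \<theta> \<in> V" "cell \<theta> \<le> valuation \<alpha> \<theta>" by auto
  show "w \<in> V \<Longrightarrow> w \<le> valuation \<alpha> \<theta> \<Longrightarrow> w \<le> cell \<theta>"
    unfolding cell_def using fin by (intro Max_ge) auto
qed

lemma lo_cell: "0 \<le> \<theta> \<Longrightarrow> lo (cell \<theta>) \<le> \<theta>"
  using cell_in[of \<theta>] cell_le[of \<theta>] valuation_ge_iff[of "cell \<theta>" \<theta>] V_nonneg by (simp add: lo_def)

lemma hi_cell: assumes "0 \<le> \<theta>" "\<theta> \<le> 1" shows "\<theta> \<le> hi (cell \<theta>)"
proof (rule ccontr)
  assume n: "\<not> \<theta> \<le> hi (cell \<theta>)"
  have s: "cell \<theta> < succ_val V (cell \<theta>)" using succ_gt cell_in assms by auto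
  hence s0: "0 \<le> succ_val V (cell \<theta>)" using V_nonneg cell_in[of \<theta>] assms by force
  have "succ_val V (cell \<theta>) \<noteq> 1" using n assms by (auto simp: hi_def)
  hence "succ_val V (cell \<theta>) \<in> V" using succ_in by blast
  moreover have "succ_val V (cell \<theta>) \<le> valuation \<alpha> \<theta>"
    using n s0 assms valuation_ge_iff by (simp add: hi_def)
  ultimately show False using cell_ge[OF assms(1)] s by force
qed

lemma cell_eq: assumes "w \<in> V" "lo w \<le> \<theta>" "\<theta> < hi w" shows "cell \<theta> = w"
proof -
  have t: "0 \<le> \<theta>" using lo_nonneg assms(2) order_trans by blast
  have "w \<le> cell \<theta>" using cell_ge t assms valuation_ge_iff V_nonneg by (simp add: lo_def)
  moreover have "\<not> w < cell \<theta>"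
    using hi_le_lo[OF assms(1) cell_in[OF t]] lo_cell[OF t] assms(3) by linarith
  ultimately show ?thesis by simp
qed

text \<open>Reduces integrals over quantiles to finite sums over grid valuations. The integrand may
  vary inside a cell, as \<beta> and the valuation do.\<close>

lemma has_integral_cells:
  fixes g :: "real \<Rightarrow> real \<Rightarrow> real"
  assumes "\<And>w. w \<in> V \<Longrightarrow> (g w has_integral I w) {lo w..hi w}"
  shows "((\<lambda>\<theta>. g (cell \<theta>) \<theta>) has_integral (\<Sum>w\<in>V. I w)) {0..1}"
proof -
  have "((\<lambda>\<theta>. if cell \<theta> = w then g w \<theta> else 0) has_integral I w) {0..1}" if w: "w \<in> V" for w
  proof -
    have sub: "{lo w..hi w} \<subseteq> {0..1}" using lo_nonneg hi_le_1[OF w] by auto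
    have "((\<lambda>\<theta>. if \<theta> \<in> {lo w..hi w} then g w \<theta> else 0) has_integral I w) {0..1}"
      using has_integral_restrict[OF sub] assms[OF w] by blast
    \<comment> \<open>Adjacent cells share an endpoint, which \<open>cell\<close> gives to the upper
      one; so the two integrands may differ at \<open>hi w\<close>.\<close>
    moreover have "(if cell \<theta> = w then g w \<theta> else 0) = (if \<theta> \<in> {lo w..hi w} then g w \<theta> else 0)"
      if "\<theta> \<in> {0..1} - {hi w}" for \<theta>
      using cell_eq[OF w, of \<theta>] lo_cell[of \<theta>] hi_cell[of \<theta>] that by auto
    ultimately show ?thesis by (rule has_integral_spike_finite[of "{hi w}", OF finite.intros(2)[OF finite.intros(1)], rotated])
  qed
  hence "((\<lambda>\<theta>. \<Sum>w\<in>V. if cell \<theta> = w then g w \<theta> else 0) has_integral (\<Sum>w\<in>V. I w)) {0..1}"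
    using finite_V by (intro has_integral_sum) auto
  moreover have "(\<Sum>w\<in>V. if cell \<theta> = w then g w \<theta> else 0) = g (cell \<theta>) \<theta>" if "\<theta> \<in> {0..1}" for \<theta>
    using cell_in[of \<theta>] finite_V that by simp
  ultimately show ?thesis by (rule has_integral_eq[rotated])
qed

lemma has_integral_cells_const:
  "((\<lambda>\<theta>. g (cell \<theta>)) has_integral (\<Sum>w\<in>V. mass w * g w)) {0..1}" for g :: "real \<Rightarrow> real"
proof (rule has_integral_cells)
  fix w assume "w \<in> V"
  thus "((\<lambda>_. g w) has_integral mass w * g w) {lo w..hi w}"
    using has_integral_const_real[of "g w" "lo w" "hi w"] lo_less_hi[of w] by (simp add: mass_def)
qed

lemma sum_mass: "(\<Sum>w\<in>V. mass w) = 1"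
  using has_integral_unique[OF has_integral_cells_const[of "\<lambda>_. 1"] has_integral_const_real[of 1 0 1]]
  by simp

text \<open>Expresses the position of a cell through masses, the form in which
  \<open>level_sum_ge\<close> compares old and new positions.\<close>

lemma sum_mass_less:
  assumes w: "w \<in> V" shows "(\<Sum>w'\<in>{w'\<in>V. w' < w}. mass w') = lo w"
proof -
  let ?g = "\<lambda>w'. if w' < w then 1 else 0 :: real"
  have "((\<lambda>\<theta>. ?g (cell \<theta>)) has_integral (\<Sum>w'\<in>V. mass w' * ?g w')) {0..1}"
    by (rule has_integral_cells_const)
  moreover have "(\<Sum>w'\<in>V. mass w' * ?g w') = (\<Sum>w'\<in>{w'\<in>V. w' < w}. mass w')"
    using finite_V by (intro sum.mono_neutral_cong_right) auto
  moreover have "((\<lambda>\<theta>. ?g (cell \<theta>)) has_integral lo w) {0..1}"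
  proof -
    have sub: "{0..lo w} \<subseteq> {0..1}" using lo_less_hi[OF w] hi_le_1[OF w] by auto
    have "((\<lambda>\<theta>. if \<theta> \<in> {0..lo w} then 1 else 0) has_integral lo w) {0..1}"
      unfolding has_integral_restrict[OF sub]
      using has_integral_const_real[of "1::real" 0 "lo w"] lo_nonneg[of w] by simp
    moreover have "?g (cell \<theta>) = (if \<theta> \<in> {0..lo w} then 1 else 0)" if "\<theta> \<in> {0..1} - {lo w}" for \<theta>
    proof -
      have t: "0 \<le> \<theta>" "\<theta> \<le> 1" using that by auto
      have "cell \<theta> < w \<longleftrightarrow> \<theta> < lo w"
      proof
        assume "cell \<theta> < w"
        hence "\<theta> \<le> lo w" using hi_cell[OF t] hi_le_lo[OF cell_in[OF t(1)] w] by linarith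
        thus "\<theta> < lo w" using that by auto
      next
        assume "\<theta> < lo w"
        thus "cell \<theta> < w" using lo_cell[OF t(1)] lo_le_iff[OF w cell_in[OF t(1)]] by linarith
      qed
      thus ?thesis using that by auto
    qed
    ultimately show ?thesis by (rule has_integral_spike_finite[of "{lo w}", OF finite.intros(2)[OF finite.intros(1)], rotated])
  qed
  ultimately show ?thesis by (metis has_integral_unique)
qed

end

section \<open>Auxiliary inequalities and integrals\<close>

text \<open>Convexity of the power, from Bernoulli's inequality at \<open>x / y\<close>. It replaces
  \<open>H ^ m\<close> by an affine function of \<open>H\<close>.\<close>

lemma power_tangent_le:
  fixes x y :: real
  assumes "0 \<le> x" "0 \<le> y" "1 \<le> m"
  shows "y ^ m + real m * y ^ (m - 1) * (x - y) \<le> x ^ m"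
proof (cases "y = 0")
  case True
  thus ?thesis using assms by (cases "m = 1") (auto simp: power_0_left)
next
  case False
  hence y: "0 < y" using assms by simp
  have "1 + real m * (x / y - 1) \<le> (1 + (x / y - 1)) ^ m"
    using assms y by (intro Bernoulli_inequality) auto
  hence "y ^ m * (1 + real m * (x / y - 1)) \<le> y ^ m * (x / y) ^ m"
    using y by (intro mult_left_mono) auto
  moreover have "y ^ m * (x / y) ^ m = x ^ m" using y by (simp add: power_divide)
  moreover have "y ^ m * (1 + real m * (x / y - 1)) = y ^ m + real m * y ^ (m - 1) * (x - y)"
    using y assms by (simp add: power_eq_if field_simps)
  ultimately show ?thesis by simp
qed

text \<open>Kept general in \<open>f\<close> because \<open>level_sum_ge\<close> needs it for
  \<open>t ^ Suc m\<close> and for the integral of \<open>level_fun\<close>.\<close>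

lemma sum_telescope_prefix:
  fixes f :: "real \<Rightarrow> real" and p :: "real \<Rightarrow> real"
  assumes "finite E"
  shows "(\<Sum>w\<in>E. f (h + (\<Sum>w'\<in>{w'\<in>E. w' \<le> w}. p w')) - f (h + (\<Sum>w'\<in>{w'\<in>E. w' < w}. p w')))
           = f (h + sum p E) - f h"
  using assms
proof (induction E rule: finite_linorder_max_induct)
  case empty
  thus ?case by simp
next
  case (insert b A)
  have "{w'\<in>insert b A. w' \<le> b} = insert b A" "{w'\<in>insert b A. w' < b} = A"
    using insert.hyps by auto
  moreover have "{w'\<in>insert b A. w' \<le> w} = {w'\<in>A. w' \<le> w}"
      "{w'\<in>insert b A. w' < w} = {w'\<in>A. w' < w}" if "w \<in> A" for w
    using insert.hyps that by auto
  moreover have "b \<notin> A" using insert.hyps by auto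
  ultimately show ?case using insert by simp
qed

text \<open>Abel summation. The free bound \<open>c\<close> carries the induction: the elements
  before the largest one, \<open>b\<close>, satisfy the claim with \<open>\<omega> b\<close> in
  place of \<open>c\<close>, and then \<open>\<omega> b\<close> can be lowered to \<open>c\<close>
  because the total of \<open>y\<close> is itself a prefix sum.\<close>

lemma sum_mult_ge_of_prefix_sums:
  fixes y \<omega> :: "real \<Rightarrow> real"
  assumes "finite E"
    and "\<And>w. w \<in> E \<Longrightarrow> 0 \<le> (\<Sum>w'\<in>{w'\<in>E. w' \<le> w}. y w')"
    and "\<And>w w'. w \<in> E \<Longrightarrow> w' \<in> E \<Longrightarrow> w < w' \<Longrightarrow> \<omega> w' \<le> \<omega> w"
    and "\<And>w. w \<in> E \<Longrightarrow> c \<le> \<omega> w" and "0 \<le> c"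
  shows "c * sum y E \<le> (\<Sum>w\<in>E. \<omega> w * y w)"
  using assms
proof (induction E arbitrary: c rule: finite_linorder_max_induct)
  case empty
  thus ?case by simp
next
  case (insert b A)
  have b: "b \<notin> A" using insert.hyps by auto
  have sub: "{w'\<in>insert b A. w' \<le> w} = {w'\<in>A. w' \<le> w}" if "w \<in> A" for w
    using insert.hyps that by auto
  have "{w'\<in>insert b A. w' \<le> b} = insert b A" using insert.hyps by auto
  hence tot: "0 \<le> y b + sum y A" using insert.prems(1)[of b] insert.hyps b by simp
  have "\<omega> b * sum y A \<le> (\<Sum>w\<in>A. \<omega> w * y w)"
  proof (rule insert.IH)
    show "0 \<le> (\<Sum>w'\<in>{w'\<in>A. w' \<le> w}. y w')" if "w \<in> A" for w
      using insert.prems(1)[of w] sub[OF that] that by simp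
    show "\<omega> b \<le> \<omega> w" if "w \<in> A" for w using insert.prems(2)[of w b] insert.hyps that by auto
    show "0 \<le> \<omega> b" using insert.prems(3)[of b] insert.prems(4) by simp
  qed (use insert.prems in auto)
  moreover have "c * (y b + sum y A) \<le> \<omega> b * (y b + sum y A)"
    using insert.prems(3)[of b] tot by (intro mult_right_mono) auto
  ultimately show ?case using insert.hyps b by (simp add: algebra_simps)
qed

lemma continuous_powr_nonneg:
  assumes "0 < c" "0 \<le> a" shows "continuous_on {a..b} (\<lambda>s::real. s powr c)"
  using assms by (intro continuous_on_powr' continuous_on_id continuous_on_const) auto

lemma continuous_powr_pos:
  assumes "0 < a" shows "continuous_on {a..b} (\<lambda>s::real. s powr c)"
  using assms by (intro continuous_on_powr continuous_on_id continuous_on_const) auto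

lemma has_integral_power:
  assumes "0 \<le> a" "a \<le> b"
  shows "((\<lambda>t::real. t ^ k) has_integral (b ^ Suc k - a ^ Suc k) / real (Suc k)) {a..b}"
proof -
  have "((\<lambda>t::real. t ^ k) has_integral b ^ Suc k / real (Suc k) - a ^ Suc k / real (Suc k)) {a..b}"
  proof (rule fundamental_theorem_of_calculus[OF assms(2)])
    fix t assume "t \<in> {a..b}"
    have "((\<lambda>t. t ^ Suc k / real (Suc k)) has_real_derivative t ^ k) (at t within {a..b})"
      by (auto intro!: derivative_eq_intros simp del: power_Suc of_nat_Suc)
    thus "((\<lambda>t. t ^ Suc k / real (Suc k)) has_vector_derivative t ^ k) (at t within {a..b})"
      by (simp add: has_real_derivative_iff_has_vector_derivative)
  qed
  thus ?thesis by (simp add: diff_divide_distrib)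
qed

text \<open>Inverse of the equilibrium bid function \<open>\<kappa> * z powr e\<close>, capped at
  type 1 for bids above \<open>\<kappa>\<close>.\<close>

definition bid_type :: "real \<Rightarrow> real \<Rightarrow> real \<Rightarrow> real" where
  "bid_type \<kappa> e b = min 1 ((b / \<kappa>) powr (1 / e))"

lemma bid_type_bounds: "0 \<le> bid_type \<kappa> e b" "bid_type \<kappa> e b \<le> 1"
  by (auto simp: bid_type_def)

lemma bid_le_iff:
  assumes "0 < \<kappa>" "0 < e" "0 \<le> z" "z \<le> 1" "0 \<le> b"
  shows "\<kappa> * z powr e \<le> b \<longleftrightarrow> z \<le> bid_type \<kappa> e b"
proof -
  have "((b / \<kappa>) powr (1 / e)) powr e = b / \<kappa>" using assms by (simp add: powr_powr)
  moreover have "z \<le> y \<longleftrightarrow> z powr e \<le> y powr e" if "0 \<le> y" for y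
    using assms that powr_mono2[of e z y] powr_less_mono2[of e y z] by (cases "z \<le> y") auto
  ultimately have "z \<le> (b / \<kappa>) powr (1 / e) \<longleftrightarrow> z powr e \<le> b / \<kappa>" by simp
  thus ?thesis using assms by (simp add: bid_type_def field_simps)
qed

lemma bid_of_bid_type:
  assumes "0 < \<kappa>" "0 < e" "0 \<le> b"
  shows "\<kappa> * bid_type \<kappa> e b powr e = min \<kappa> b"
proof (cases "b \<le> \<kappa>")
  case True
  hence "(b / \<kappa>) powr (1 / e) \<le> 1" using assms by (intro powr_le1) auto
  thus ?thesis using True assms by (simp add: bid_type_def powr_powr)
next
  case False
  hence "1 \<le> (b / \<kappa>) powr (1 / e)" using assms by (intro ge_one_powr_ge_zero) auto
  thus ?thesis using False assms by (simp add: bid_type_def)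
qed

lemma canonical_integral:
  assumes "2 \<le> N" "0 < \<alpha>" "0 \<le> \<theta>"
  shows "((\<lambda>t. (real N - 1) * t powi (int N - 2) * valuation \<alpha> t) has_integral
           (real (N-1) / (real (N-1) + 1/\<alpha>) * \<theta> powr (real (N-1) + 1/\<alpha>))) {0..\<theta>}"
proof -
  define e where "e = real (N-1) + 1/\<alpha>"
  have e: "0 < e" unfolding e_def using assms by (intro add_nonneg_pos) auto
  let ?f = "\<lambda>t. real (N-1) / e * t powr e"
  have "((\<lambda>t. (real N - 1) * t powi (int N - 2) * valuation \<alpha> t) has_integral (?f \<theta> - ?f 0)) {0..\<theta>}"
  proof (rule fundamental_theorem_of_calculus_interior[OF assms(3)])
    show "continuous_on {0..\<theta>} ?f" using e by (intro continuous_intros continuous_on_powr') auto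
    fix t assume "t \<in> {0<..<\<theta>}"
    hence t: "0 < t" by simp
    have i: "int N - 2 = int (N - 2)" using assms by simp
    have "(?f has_real_derivative real (N-1) / e * (e * t powr (e - 1))) (at t)"
      using t by (auto intro!: derivative_eq_intros)
    moreover have "real (N-1) / e * (e * t powr (e - 1)) = (real N - 1) * t powi (int N - 2) * valuation \<alpha> t"
    proof -
      have "e - 1 = real (N - 2) + 1/\<alpha>" using assms(1) by (simp add: e_def of_nat_diff)
      hence "t powr (e - 1) = t ^ (N - 2) * t powr (1/\<alpha>)" using t by (simp add: powr_add powr_realpow)
      moreover have "t powi (int N - 2) = t ^ (N - 2)" unfolding i by simp
      moreover have "real (N-1) / e * (e * y) = (real N - 1) * y" for y
        using e assms(1) by (simp add: of_nat_diff)
      ultimately show ?thesis by (simp add: valuation_def)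
    qed
    ultimately show "(?f has_vector_derivative (real N - 1) * t powi (int N - 2) * valuation \<alpha> t) (at t)"
      by (simp add: has_real_derivative_iff_has_vector_derivative)
  qed
  thus ?thesis by (simp add: e_def)
qed

text \<open>The first-price bid is the all-pay bid divided by \<open>\<theta> ^ (N - 1)\<close>.
  Thus both are powers with the same factor and differ in the exponent only.\<close>

definition bid_exp :: "auction_format \<Rightarrow> nat \<Rightarrow> real \<Rightarrow> real" where
  "bid_exp fmt N \<alpha> = (case fmt of First_Price \<Rightarrow> 1/\<alpha> | All_Pay \<Rightarrow> real (N-1) + 1/\<alpha>)"

lemma canonical_eq_powr:
  assumes "2 \<le> N" "0 < \<alpha>" "0 \<le> \<theta>"
  shows "canonical_eq fmt N \<alpha> \<theta> = real (N-1) / (real (N-1) + 1/\<alpha>) * \<theta> powr bid_exp fmt N \<alpha>"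
proof -
  note I = integral_unique[OF canonical_integral[OF assms]]
  show ?thesis
  proof (cases fmt)
    case First_Price
    show ?thesis
    proof (cases "\<theta> = 0")
      case False
      hence t: "0 < \<theta>" using assms by simp
      have "\<theta> powr (real (N-1) + 1/\<alpha>) = \<theta> ^ (N-1) * \<theta> powr (1/\<alpha>)"
        using t by (simp add: powr_add powr_realpow)
      thus ?thesis using First_Price False by (simp add: I bid_exp_def)
    qed (simp add: First_Price)
  next
    case All_Pay
    thus ?thesis by (simp add: I bid_exp_def)
  qed
qed

text \<open>The minimum switches at the type \<open>x powr \<alpha>\<close>, whose valuation is
  \<open>x\<close>; \<open>x \<le> 1\<close> keeps it in the unit interval.\<close>

lemma has_integral_budget:
  assumes "0 < \<alpha>" "0 < x" "x \<le> 1"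
  shows "((\<lambda>\<theta>. min 1 (x / valuation \<alpha> \<theta>)) has_integral
     (if \<alpha> = 1 then x * (1 - ln x) else x * (\<alpha> / (\<alpha> - 1)) - x powr \<alpha> / (\<alpha> - 1))) {0..1}"
proof -
  define a where "a = x powr \<alpha>"
  have a: "0 < a" "a \<le> 1" using assms by (auto simp: a_def powr_le1)
  have va: "valuation \<alpha> a = x" using assms by (simp add: a_def valuation_def powr_powr)
  have mono: "valuation \<alpha> s \<le> valuation \<alpha> t" if "0 \<le> s" "s \<le> t" for s t
    using that assms by (simp add: valuation_def powr_mono2)
  have pos: "0 < valuation \<alpha> t" if "0 < t" for t using that by (simp add: valuation_def)
  have "((\<lambda>_. 1::real) has_integral a) {0..a}"
    using has_integral_const_real[of "1::real" 0 a] a by simp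
  hence 1: "((\<lambda>\<theta>. min 1 (x / valuation \<alpha> \<theta>)) has_integral a) {0..a}"
  proof (rule has_integral_spike_finite[of "{0}", rotated 2])
    fix t assume "t \<in> {0..a} - {0}"
    thus "min 1 (x / valuation \<alpha> t) = 1" using mono[of t a] pos[of t] va by simp
  qed simp
  let ?F = "\<lambda>t. if \<alpha> = 1 then x * ln t else x * (\<alpha> / (\<alpha> - 1)) * t powr (1 - 1/\<alpha>)"
  have "((\<lambda>t. x / valuation \<alpha> t) has_integral (?F 1 - ?F a)) {a..1}"
  proof (rule fundamental_theorem_of_calculus[OF a(2)])
    fix t assume "t \<in> {a..1}"
    hence t: "0 < t" using a by simp
    have "(?F has_real_derivative x / valuation \<alpha> t) (at t)"
    proof (cases "\<alpha> = 1")
      case True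
      thus ?thesis using t by (auto intro!: derivative_eq_intros simp: valuation_def)
    next
      case False
      have "((\<lambda>t. x * (\<alpha> / (\<alpha> - 1)) * t powr (1 - 1/\<alpha>)) has_real_derivative
               x * (\<alpha> / (\<alpha> - 1)) * ((1 - 1/\<alpha>) * t powr (1 - 1/\<alpha> - 1))) (at t)"
        using t False by (auto intro!: derivative_eq_intros)
      moreover have "\<alpha> / (\<alpha> - 1) * (1 - 1/\<alpha>) = 1" using False assms by (simp add: field_simps)
      hence "x * (\<alpha> / (\<alpha> - 1)) * ((1 - 1/\<alpha>) * t powr (1 - 1/\<alpha> - 1)) = x * t powr (1 - 1/\<alpha> - 1)"
        by (metis mult.assoc mult_1)
      moreover have "\<dots> = x / valuation \<alpha> t" by (simp add: valuation_def powr_minus divide_inverse)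
      ultimately show ?thesis using False by simp
    qed
    thus "(?F has_vector_derivative x / valuation \<alpha> t) (at t within {a..1})"
      by (simp add: has_real_derivative_iff_has_vector_derivative has_vector_derivative_at_within)
  qed
  hence 2: "((\<lambda>\<theta>. min 1 (x / valuation \<alpha> \<theta>)) has_integral (?F 1 - ?F a)) {a..1}"
  proof (rule has_integral_eq[rotated])
    fix t assume "t \<in> {a..1}"
    thus "x / valuation \<alpha> t = min 1 (x / valuation \<alpha> t)" using mono[of a t] pos[of t] va a by simp
  qed
  have "a + (?F 1 - ?F a) = (if \<alpha> = 1 then x * (1 - ln x) else x * (\<alpha> / (\<alpha> - 1)) - x powr \<alpha> / (\<alpha> - 1))"
  proof (cases "\<alpha> = 1")
    case True
    thus ?thesis using assms by (simp add: a_def algebra_simps)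
  next
    case False
    have "x * a powr (1 - 1/\<alpha>) = a"
    proof -
      have "a powr (1 - 1/\<alpha>) = x powr (\<alpha> - 1)" using assms by (simp add: a_def powr_powr algebra_simps)
      thus ?thesis using assms by (simp add: a_def powr_diff)
    qed
    hence Fa: "?F a = \<alpha> / (\<alpha> - 1) * a" using False by (simp add: mult.assoc mult.left_commute)
    have F1: "?F 1 = x * (\<alpha> / (\<alpha> - 1))" using False by simp
    have c: "1 - \<alpha> / (\<alpha> - 1) = - (1 / (\<alpha> - 1))" using False by (simp add: field_simps)
    have "a + (?F 1 - ?F a) = x * (\<alpha> / (\<alpha> - 1)) + (1 - \<alpha> / (\<alpha> - 1)) * a"
      unfolding Fa F1 by algebra
    thus ?thesis unfolding c using False by (simp add: a_def)
  qed
  thus ?thesis using has_integral_combine[OF _ a(2) 1 2] a by simp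
qed

text \<open>Here \<open>s\<close> is the type whose equilibrium bid is the bid made by \<theta>, and
  \<open>p = 1/\<alpha>\<close>. The right side as a function of \<open>s\<close> has derivative
  \<open>m * s powr (e-1) * (r \<theta> - r s)\<close> with \<open>r\<close> below, and
  \<open>m \<le> K * p\<close> makes \<open>r\<close> decreasing. So the minimum is at
  \<open>s = \<theta>\<close>, where the square vanishes.\<close>

lemma allpay_kernel:
  fixes m p K \<theta> s :: real
  assumes m: "1 \<le> m" and p: "0 < p" and K: "0 < K" "m \<le> K * p"
    and \<theta>: "0 < \<theta>" "\<theta> \<le> 1" and s: "0 \<le> s" "s \<le> 1"
  defines "\<kappa> \<equiv> m / (m + p)"
  shows "\<kappa> * \<theta> powr (m+p) * \<theta> powr (-p) - \<theta> powr m
           \<le> \<kappa> * s powr (m+p) * \<theta> powr (-p) - s powr m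
              - \<kappa>\<^sup>2 / (2*K) * (s powr (m+p) - \<theta> powr (m+p))\<^sup>2"
proof -
  define e where "e = m + p"
  have e: "0 < e" "p \<le> e - 1" and \<kappa>e: "\<kappa> * e = m" and \<kappa>: "0 < \<kappa>"
    using m p by (auto simp: e_def \<kappa>_def)
  define r where "r t = t powr (-p) + \<kappa> / K * t powr e" for t
  have r_anti: "r b \<le> r a" if ab: "0 < a" "a \<le> b" "b \<le> 1" for a b
  proof (rule DERIV_nonpos_imp_nonincreasing[OF ab(2)])
    fix t assume t: "a \<le> t" "t \<le> b"
    hence t0: "0 < t" "t \<le> 1" using ab by auto
    have "(r has_real_derivative (-p * t powr (-p-1) + \<kappa> / K * (e * t powr (e-1)))) (at t)"
      unfolding r_def using t0 K by (auto intro!: derivative_eq_intros)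
    moreover have "\<kappa> / K * (e * t powr (e-1)) \<le> p * t powr (-p-1)"
    proof -
      have "\<kappa> / K * (e * t powr (e-1)) = m / K * t powr (e-1)" unfolding \<kappa>e[symmetric] by (simp only: times_divide_eq_left times_divide_eq_right mult.assoc)
      also have "\<dots> \<le> p * t powr (-p-1)"
      proof (rule mult_mono)
        show "m / K \<le> p" using K by (simp add: field_simps)
        show "t powr (e-1) \<le> t powr (-p-1)" using t0 e p by (intro powr_mono') auto
      qed (use p in auto)
      finally show ?thesis .
    qed
    ultimately show "\<exists>y. (r has_real_derivative y) (at t) \<and> y \<le> 0" by (intro exI conjI) auto
  qed
  define g where "g s = \<kappa> * s powr e * \<theta> powr (-p) - s powr m - \<kappa>\<^sup>2 / (2*K) * (s powr e - \<theta> powr e)\<^sup>2" for s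
  have dg: "(g has_real_derivative m * t powr (e-1) * (r \<theta> - r t)) (at t)" if t: "0 < t" for t
  proof -
    have "((\<lambda>s. \<kappa> * s powr e * \<theta> powr (-p) - s powr m - c * (s powr e - \<theta> powr e)\<^sup>2)
        has_real_derivative \<kappa> * (e * t powr (e-1)) * \<theta> powr (-p) - m * t powr (m-1)
            - c * (2 * (t powr e - \<theta> powr e) * (e * t powr (e-1)))) (at t)" for c
      using t by (auto intro!: derivative_eq_intros)
    hence "(g has_real_derivative \<kappa> * (e * t powr (e-1)) * \<theta> powr (-p) - m * t powr (m-1)
            - \<kappa>\<^sup>2 / (2*K) * (2 * (t powr e - \<theta> powr e) * (e * t powr (e-1)))) (at t)"
      unfolding g_def .
    moreover have "t powr (m-1) = t powr (e-1) * t powr (-p)"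
      unfolding powr_add[symmetric] by (simp add: e_def)
    moreover have "\<kappa> * (e * t powr (e-1)) * \<theta> powr (-p) - m * (t powr (e-1) * t powr (-p))
            - \<kappa>\<^sup>2 / (2*K) * (2 * (t powr e - \<theta> powr e) * (e * t powr (e-1)))
          = (\<kappa>*e) * t powr (e-1) * (r \<theta> - r t)"
      unfolding r_def \<kappa>e using K \<kappa>e[symmetric] by (simp add: field_simps power2_eq_square)
    ultimately show ?thesis by (simp add: \<kappa>e)
  qed
  have cont: "continuous_on {a..b} g" if "0 \<le> a" for a b
  proof -
    have "continuous_on {a..b} (\<lambda>s. s powr c)" if "0 < c" for c :: real
      using that \<open>0 \<le> a\<close> by (intro continuous_on_powr' continuous_on_id continuous_on_const) auto
    hence "continuous_on {a..b} (\<lambda>s. s powr e)" "continuous_on {a..b} (\<lambda>s. s powr m)" using e m by simp_all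
    thus ?thesis unfolding g_def
      by (intro continuous_on_diff continuous_on_mult continuous_on_power continuous_on_const)
  qed
  have "g \<theta> \<le> g s"
  proof (cases "s \<le> \<theta>")
    case True
    show ?thesis
    proof (rule DERIV_nonpos_imp_decreasing_open[OF True])
      fix t assume t: "s < t" "t < \<theta>"
      hence "m * t powr (e-1) * (r \<theta> - r t) \<le> 0"
        using r_anti[of t \<theta>] s \<theta> m by (intro mult_nonneg_nonpos) auto
      thus "\<exists>y. (g has_real_derivative y) (at t) \<and> y \<le> 0" using dg[of t] t s by auto
    qed (use cont s in auto)
  next
    case False
    show ?thesis
    proof (rule DERIV_nonneg_imp_increasing_open[of \<theta> s])
      fix t assume t: "\<theta> < t" "t < s"
      hence "m * t powr (e-1) * (r \<theta> - r t) \<ge> 0"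
        using r_anti[of \<theta> t] s \<theta> m by (intro mult_nonneg_nonneg) auto
      thus "\<exists>y. (g has_real_derivative y) (at t) \<and> y \<ge> 0" using dg[of t] t \<theta> by auto
    qed (use cont \<theta> False in auto)
  qed
  thus ?thesis by (simp add: g_def e_def)
qed

section \<open>All-pay auctions\<close>

text \<open>\<open>l\<close> is the strategy common to all buyers, \<open>m\<close> the number of
  opponents and \<open>e\<close> the exponent of the equilibrium bid; both formats share this
  setting.\<close>

locale bid_grid = type_grid +
  fixes l :: "real \<Rightarrow> real" and m :: nat and Bmax K e :: real
  assumes l_nonneg: "w \<in> V \<Longrightarrow> 0 \<le> l w" and l_le: "w \<in> V \<Longrightarrow> l w \<le> Bmax" and l_0: "l 0 = 0"
    and m_ge_1: "1 \<le> m" and Bmax_ge_1: "1 \<le> Bmax" and Bmax_le: "Bmax \<le> K" and e_pos: "0 < e"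
begin

definition \<kappa> :: real where "\<kappa> = real m / (real m + 1/\<alpha>)"
definition \<beta> :: "real \<Rightarrow> real" where "\<beta> \<theta> = \<kappa> * \<theta> powr e"
text \<open>The mass \<open>H\<close> of the overview. Strictness matters: a bid of \<open>b\<close>
  beats these types without ties.\<close>

definition below :: "real \<Rightarrow> real" where "below b = (\<Sum>w\<in>{w\<in>V. l w < b}. mass w)"
text \<open>The integral of \<open>1 / v\<close> over a cell. It is meaningful for
  \<open>w \<noteq> 0\<close>; on the cell of 0 the integrand need not be integrable.\<close>

definition inv_int :: "real \<Rightarrow> real" where "inv_int w = integral {lo w..hi w} (\<lambda>\<theta>. \<theta> powr (-(1/\<alpha>)))"

lemma K_pos: "0 < K" using Bmax_ge_1 Bmax_le by simp

lemma kappa: "0 < \<kappa>" "\<kappa> < 1" "\<kappa> * (real m + 1/\<alpha>) = real m"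
proof -
  have "0 < 1/\<alpha>" using alpha_pos by simp
  moreover have "0 < real m" using m_ge_1 by simp
  ultimately have "0 < real m + 1/\<alpha>" by linarith
  thus "0 < \<kappa>" unfolding \<kappa>_def using \<open>0 < real m\<close> by (intro divide_pos_pos)
  show "\<kappa> < 1" unfolding \<kappa>_def using \<open>0 < 1/\<alpha>\<close> \<open>0 < real m + 1/\<alpha>\<close> by (subst divide_less_eq_1_pos) auto
  show "\<kappa> * (real m + 1/\<alpha>) = real m"
    unfolding \<kappa>_def using \<open>0 < real m + 1/\<alpha>\<close> by (subst times_divide_eq_left, subst nonzero_mult_div_cancel_right) auto
qed

lemma beta_nonneg: "0 \<le> \<beta> \<theta>" using kappa by (simp add: \<beta>_def)

lemma beta_mono: "0 \<le> s \<Longrightarrow> s \<le> t \<Longrightarrow> \<beta> s \<le> \<beta> t"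
  using kappa e_pos by (simp add: \<beta>_def powr_mono2)

lemma continuous_beta: "0 \<le> a \<Longrightarrow> continuous_on {a..b} \<beta>"
  unfolding \<beta>_def using e_pos by (intro continuous_on_mult continuous_on_const continuous_powr_nonneg)

lemma below_nonneg: "0 \<le> below b"
  unfolding below_def using mass_pos by (intro sum_nonneg) (auto intro: less_imp_le)

lemma below_mono: "a \<le> b \<Longrightarrow> below a \<le> below b"
  unfolding below_def using mass_pos finite_V by (intro sum_mono2) (auto intro: less_imp_le)

lemma below_le_1: "below b \<le> 1"
  unfolding below_def sum_mass[symmetric] using mass_pos finite_V
  by (intro sum_mono2) (auto intro: less_imp_le)

lemma below_beta_integrable: "(\<lambda>\<theta>. below (\<beta> \<theta>) ^ k) integrable_on {0..1}"
proof (rule integrable_on_mono_on, rule mono_onI)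
  fix r s :: real assume "r \<in> {0..1}" "s \<in> {0..1}" "r \<le> s"
  thus "below (\<beta> r) ^ k \<le> below (\<beta> s) ^ k"
    using below_nonneg by (intro power_mono below_mono beta_mono) auto
qed

text \<open>Holds at \<theta> = 0 too, where both sides are 0 by the conventions for division and
  \<open>powr\<close>.\<close>

lemma inverse_valuation: "1 / valuation \<alpha> \<theta> = \<theta> powr (-(1/\<alpha>))"
  by (simp add: valuation_def powr_minus divide_inverse)

lemma inv_int:
  assumes "w \<in> V" "w \<noteq> 0"
  shows "((\<lambda>\<theta>. \<theta> powr (-(1/\<alpha>))) has_integral inv_int w) {lo w..hi w}"
  unfolding inv_int_def
  using integrable_continuous_real[OF continuous_powr_pos[OF lo_pos[OF assms]]] by (rule integrable_integral)

text \<open>\<open>g 0 = 0\<close> removes the cell that contains the singularity of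
  \<open>1 / v\<close>.\<close>

lemma has_integral_ratio:
  assumes "g 0 = 0"
  shows "((\<lambda>\<theta>. g (cell \<theta>) / valuation \<alpha> \<theta>) has_integral (\<Sum>w\<in>V. g w * inv_int w)) {0..1}"
proof (rule has_integral_cells)
  fix w assume w: "w \<in> V"
  show "((\<lambda>\<theta>. g w / valuation \<alpha> \<theta>) has_integral g w * inv_int w) {lo w..hi w}"
  proof (cases "w = 0")
    case True thus ?thesis using assms by simp
  next
    case False
    have "((\<lambda>\<theta>. g w * \<theta> powr (-(1/\<alpha>))) has_integral g w * inv_int w) {lo w..hi w}"
      using inv_int[OF w False] by (rule has_integral_mult_right)
    moreover have "g w / valuation \<alpha> \<theta> = g w * \<theta> powr (-(1/\<alpha>))" for \<theta>
      using inverse_valuation[of \<theta>] by (metis times_divide_eq_right mult.right_neutral)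
    ultimately show ?thesis by simp
  qed
qed

lemma loss_integrable:
  "(\<lambda>\<theta>. \<theta> ^ k * ((l (cell \<theta>) - \<beta> \<theta>)\<^sup>2 / 2)) integrable_on {0..1}"
proof -
  have "((\<lambda>\<theta>. \<theta> ^ k * ((l w - \<beta> \<theta>)\<^sup>2 / 2)) has_integral
          integral {lo w..hi w} (\<lambda>\<theta>. \<theta> ^ k * ((l w - \<beta> \<theta>)\<^sup>2 / 2))) {lo w..hi w}" for w
    using lo_nonneg
    by (intro integrable_integral integrable_continuous_real continuous_intros continuous_beta) auto
  from has_integral_cells[OF this] show ?thesis by (rule has_integral_integrable)
qed

end

locale allpay_grid = bid_grid +
  assumes e_allpay: "e = real m + 1/\<alpha>" and K_allpay: "real m \<le> K * (1/\<alpha>)"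
begin

text \<open>Up to \<open>\<kappa>\<close> this is \<open>allpay_kernel\<close> at the type bidding
  \<open>b\<close>. Beyond \<open>\<kappa>\<close> that type stays 1, but the payment term has slope
  \<open>1 / v \<ge> 1\<close> in \<open>b\<close>, while the loss term has slope at most 1 because
  \<open>b \<le> Bmax \<le> K\<close>.\<close>

lemma allpay_pointwise:
  assumes \<theta>: "0 < \<theta>" "\<theta> \<le> 1" and b: "0 \<le> b" "b \<le> Bmax"
  shows "(b - \<beta> \<theta>)\<^sup>2 / (2*K) + 1 - \<theta> ^ m
           \<le> 1 - bid_type \<kappa> e b ^ m + (b - \<beta> \<theta>) / valuation \<alpha> \<theta>"
proof -
  define s where "s = bid_type \<kappa> e b"
  define r where "r = \<theta> powr (-(1/\<alpha>))"
  have s: "0 \<le> s" "s \<le> 1" by (simp_all add: s_def bid_type_bounds)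
  have sb: "\<kappa> * s powr e = min \<kappa> b" unfolding s_def by (rule bid_of_bid_type[OF kappa(1) e_pos b(1)])
  have m: "1 \<le> real m" using m_ge_1 by simp
  have p: "0 < 1/\<alpha>" using alpha_pos by simp
  have r1: "1 \<le> r" unfolding r_def using \<theta> p powr_mono'[of "-(1/\<alpha>)" 0 \<theta>] by simp
  note k = allpay_kernel[OF m p K_pos K_allpay \<theta> s, folded \<kappa>_def e_allpay]
  have pm: "\<theta> powr real m = \<theta> ^ m" "s powr real m = s ^ m"
    using \<theta> s m_ge_1 by (auto simp: powr_realpow' simp del: of_nat_eq_0_iff)
  have eq: "\<kappa>\<^sup>2 / (2*K) * (s powr e - \<theta> powr e)\<^sup>2 = (min \<kappa> b - \<kappa> * \<theta> powr e)\<^sup>2 / (2*K)"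
    unfolding sb[symmetric] by (simp add: power_mult_distrib right_diff_distrib[symmetric])
  have k1: "\<beta> \<theta> * r - \<theta> ^ m \<le> min \<kappa> b * r - s ^ m - (min \<kappa> b - \<beta> \<theta>)\<^sup>2 / (2*K)"
    using k unfolding pm sb eq \<beta>_def r_def .
  have "(b - \<beta> \<theta>)\<^sup>2 / (2*K) - (min \<kappa> b - \<beta> \<theta>)\<^sup>2 / (2*K) \<le> (b - min \<kappa> b) * r"
  proof -
    define c where "c = min \<kappa> b"
    have c: "0 \<le> c" "c \<le> b" using b kappa by (auto simp: c_def)
    have "(b - \<beta> \<theta>)\<^sup>2 - (c - \<beta> \<theta>)\<^sup>2 = (b - c) * (b + c - 2 * \<beta> \<theta>)"
      by (simp add: power2_eq_square algebra_simps)
    also have "\<dots> \<le> (b - c) * (2 * K)"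
      using c b Bmax_le beta_nonneg[of \<theta>] by (intro mult_left_mono) auto
    finally have "((b - \<beta> \<theta>)\<^sup>2 - (c - \<beta> \<theta>)\<^sup>2) / (2*K) \<le> b - c"
      using K_pos by (simp add: divide_le_eq mult.commute)
    also have "\<dots> \<le> (b - c) * r" using c r1 by (simp add: mult_le_cancel_left1)
    finally show ?thesis by (simp add: c_def diff_divide_distrib)
  qed
  with k1 have "\<beta> \<theta> * r - \<theta> ^ m + (b - \<beta> \<theta>)\<^sup>2 / (2*K) \<le> b * r - s ^ m" by (simp add: algebra_simps)
  moreover have "(b - \<beta> \<theta>) / valuation \<alpha> \<theta> = (b - \<beta> \<theta>) * r"
    using inverse_valuation[of \<theta>] unfolding r_def by (metis times_divide_eq_right mult.right_neutral)
  ultimately show ?thesis by (simp add: s_def algebra_simps)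
qed

text \<open>Sum and integral are exchanged: \<open>w\<close> counts in
  \<open>below (\<beta> \<theta>)\<close> exactly when \<theta> exceeds the type whose equilibrium
  bid is \<open>l w\<close>.\<close>

lemma has_integral_below_allpay:
  "((\<lambda>\<theta>. real m * \<theta> ^ (m-1) * below (\<beta> \<theta>)) has_integral
      (\<Sum>w\<in>V. mass w * (1 - bid_type \<kappa> e (l w) ^ m))) {0..1}"
proof -
  have "((\<lambda>\<theta>. mass w * (if l w < \<beta> \<theta> then real m * \<theta> ^ (m-1) else 0)) has_integral
           mass w * (1 - bid_type \<kappa> e (l w) ^ m)) {0..1}" if w: "w \<in> V" for w
  proof (rule has_integral_mult_right)
    define s where "s = bid_type \<kappa> e (l w)"
    have s: "0 \<le> s" "s \<le> 1" by (simp_all add: s_def bid_type_bounds)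
    have "((\<lambda>\<theta>. real m * \<theta> ^ (m-1)) has_integral real m * ((1 ^ Suc (m-1) - s ^ Suc (m-1)) / real (Suc (m-1)))) {s..1}"
      by (intro has_integral_mult_right has_integral_power s)
    hence "((\<lambda>\<theta>. real m * \<theta> ^ (m-1)) has_integral (1 - s ^ m)) {s..1}"
      using m_ge_1 by simp
    hence "((\<lambda>\<theta>. if \<theta> \<in> {s..1} then real m * \<theta> ^ (m-1) else 0) has_integral (1 - s ^ m)) {0..1}"
      using s by (subst has_integral_restrict) auto
    moreover have "(if l w < \<beta> \<theta> then real m * \<theta> ^ (m-1) else 0)
        = (if \<theta> \<in> {s..1} then real m * \<theta> ^ (m-1) else 0)" if "\<theta> \<in> {0..1} - {s}" for \<theta>
      using bid_le_iff[OF kappa(1) e_pos, of \<theta> "l w"] l_nonneg[OF w] that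
      by (auto simp: \<beta>_def s_def[symmetric] not_le)
    ultimately show "((\<lambda>\<theta>. if l w < \<beta> \<theta> then real m * \<theta> ^ (m-1) else 0) has_integral
        1 - bid_type \<kappa> e (l w) ^ m) {0..1}"
      unfolding s_def[symmetric]
      by (rule has_integral_spike_finite[of "{s}", OF finite.intros(2)[OF finite.intros(1)], rotated])
  qed
  hence "((\<lambda>\<theta>. \<Sum>w\<in>V. mass w * (if l w < \<beta> \<theta> then real m * \<theta> ^ (m-1) else 0)) has_integral
      (\<Sum>w\<in>V. mass w * (1 - bid_type \<kappa> e (l w) ^ m))) {0..1}"
    by (rule has_integral_sum[OF finite_V])
  moreover have "(\<Sum>w\<in>V. mass w * (if l w < \<beta> \<theta> then real m * \<theta> ^ (m-1) else 0))
      = real m * \<theta> ^ (m-1) * below (\<beta> \<theta>)" for \<theta>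
  proof -
    have "real m * \<theta> ^ (m-1) * below (\<beta> \<theta>)
        = (\<Sum>w\<in>{w\<in>V. l w < \<beta> \<theta>}. mass w * (if l w < \<beta> \<theta> then real m * \<theta> ^ (m-1) else 0))"
      unfolding below_def sum_distrib_left by (intro sum.cong) auto
    also have "\<dots> = (\<Sum>w\<in>V. mass w * (if l w < \<beta> \<theta> then real m * \<theta> ^ (m-1) else 0))"
      using finite_V by (intro sum.mono_neutral_left) auto
    finally show ?thesis by simp
  qed
  ultimately show ?thesis by simp
qed

text \<open>The gain of \<theta> from bidding \<open>\<beta> \<theta>\<close>, divided by its
  valuation, where \<open>x\<close> gives the interim winning probabilities.\<close>

definition allpay_rate :: "(real \<Rightarrow> real) \<Rightarrow> real \<Rightarrow> real" where
  "allpay_rate x \<theta> = below (\<beta> \<theta>) ^ m - x (cell \<theta>) + (l (cell \<theta>) - \<beta> \<theta>) / valuation \<alpha> \<theta>"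

lemma beta_ratio: "\<theta> \<in> {0..1} \<Longrightarrow> \<beta> \<theta> / valuation \<alpha> \<theta> = \<kappa> * \<theta> ^ m"
proof (cases "\<theta> = 0")
  case False
  moreover assume "\<theta> \<in> {0..1}"
  ultimately have t: "0 < \<theta>" by simp
  hence "\<theta> powr e = \<theta> ^ m * \<theta> powr (1/\<alpha>)" by (subst e_allpay) (simp add: powr_add powr_realpow)
  thus ?thesis using t by (simp add: \<beta>_def valuation_def)
qed (use m_ge_1 in \<open>simp add: valuation_def\<close>)

lemma beta_ratio_integrable: "(\<lambda>\<theta>. \<beta> \<theta> / valuation \<alpha> \<theta>) integrable_on {0..1}"
proof -
  have "(\<lambda>\<theta>. \<kappa> * \<theta> ^ m) integrable_on {0..1::real}"
    by (intro integrable_continuous_real continuous_intros)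
  thus ?thesis by (rule integrable_eq) (simp add: beta_ratio)
qed

lemma allpay_rate_integrable: "allpay_rate x integrable_on {0..1}"
proof -
  have "(\<lambda>\<theta>. below (\<beta> \<theta>) ^ m - x (cell \<theta>) + (l (cell \<theta>) / valuation \<alpha> \<theta> - \<beta> \<theta> / valuation \<alpha> \<theta>)) integrable_on {0..1}"
    by (intro integrable_add integrable_diff below_beta_integrable beta_ratio_integrable
        has_integral_integrable[OF has_integral_cells_const] has_integral_integrable[OF has_integral_ratio] l_0)
  thus ?thesis unfolding allpay_rate_def by (simp add: diff_divide_distrib)
qed

text \<open>The constants balance: \<open>1 / (m + 1)\<close> from the integral of
  \<open>\<theta> ^ m\<close>, \<open>(m - 1) / (m + 1)\<close> from the tangent and at most
  \<open>1 / (m + 1)\<close> from the total winning probability add up to at most 1. The loss is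
  bounded without its weight first, which is at most 1.\<close>

lemma loss_le_allpay_rate:
  assumes x: "(\<Sum>w\<in>V. mass w * x w) \<le> 1 / (real m + 1)"
  shows "integral {0..1} (\<lambda>\<theta>. \<theta> ^ (m-1) * ((l (cell \<theta>) - \<beta> \<theta>)\<^sup>2 / 2)) \<le> K * integral {0..1} (allpay_rate x)"
proof -
  let ?S = "\<lambda>w. bid_type \<kappa> e (l w)"
  let ?lv = "\<lambda>\<theta>. (l (cell \<theta>) - \<beta> \<theta>) / valuation \<alpha> \<theta>"
  let ?loss = "\<lambda>\<theta>. (l (cell \<theta>) - \<beta> \<theta>)\<^sup>2 / 2"
  have lv: "?lv integrable_on {0..1}"
    using integrable_diff[OF has_integral_integrable[OF has_integral_ratio[of l, OF l_0]] beta_ratio_integrable]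
    by (simp add: diff_divide_distrib)
  have loss: "?loss integrable_on {0..1}" using loss_integrable[of 0] by simp
  have pw: "((\<lambda>\<theta>::real. \<theta> ^ k) has_integral 1 / (real k + 1)) {0..1}" for k
    using has_integral_power[of 0 1 k] by (simp add: add.commute)
  define X where "X = (\<Sum>w\<in>V. mass w * x w)"
  define S where "S = (\<Sum>w\<in>V. mass w * (1 - ?S w ^ m))"
  have hS: "((\<lambda>\<theta>. 1 - ?S (cell \<theta>) ^ m) has_integral S) {0..1}"
    unfolding S_def by (rule has_integral_cells_const)
  have hX: "((\<lambda>\<theta>. x (cell \<theta>)) has_integral X) {0..1}"
    unfolding X_def by (rule has_integral_cells_const)
  have one: "((\<lambda>\<theta>::real. 1) has_integral (1::real)) {0..1}"
    using has_integral_const_real[of "1::real" 0 1] by simp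
  have "((\<lambda>\<theta>. ?loss \<theta> / K + 1 - \<theta> ^ m) has_integral
           integral {0..1} ?loss / K + 1 - 1 / (real m + 1)) {0..1}"
    by (intro has_integral_add has_integral_diff has_integral_divide integrable_integral loss pw one)
  hence L: "((\<lambda>\<theta>. if \<theta> = 0 then 0 else ?loss \<theta> / K + 1 - \<theta> ^ m) has_integral
           integral {0..1} ?loss / K + 1 - 1 / (real m + 1)) {0..1}"
    by (rule has_integral_spike_finite[of "{0}", rotated 2]) auto
  have "((\<lambda>\<theta>. 1 - ?S (cell \<theta>) ^ m + ?lv \<theta>) has_integral (S + integral {0..1} ?lv)) {0..1}"
    by (intro has_integral_add hS integrable_integral lv)
  hence "((\<lambda>\<theta>. if \<theta> = 0 then 0 else 1 - ?S (cell \<theta>) ^ m + ?lv \<theta>) has_integral (S + integral {0..1} ?lv)) {0..1}"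
    by (rule has_integral_spike_finite[of "{0}", rotated 2]) auto
  with L have 1: "integral {0..1} ?loss / K + 1 - 1 / (real m + 1) \<le> S + integral {0..1} ?lv"
  proof (rule has_integral_le)
    fix \<theta> :: real assume t: "\<theta> \<in> {0..1}"
    show "(if \<theta> = 0 then 0 else ?loss \<theta> / K + 1 - \<theta> ^ m) \<le> (if \<theta> = 0 then 0 else 1 - ?S (cell \<theta>) ^ m + ?lv \<theta>)"
    proof (cases "\<theta> = 0")
      case False
      thus ?thesis using allpay_pointwise[of \<theta> "l (cell \<theta>)"] l_nonneg l_le cell_in[of \<theta>] t by auto
    qed simp
  qed
  have "((\<lambda>\<theta>. real m * \<theta> ^ (m-1) * below (\<beta> \<theta>) - (real m - 1) * \<theta> ^ m - x (cell \<theta>) + ?lv \<theta>) has_integral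
      (S - (real m - 1) * (1 / (real m + 1)) - X + integral {0..1} ?lv)) {0..1}"
    using has_integral_below_allpay[folded S_def]
    by (intro has_integral_add has_integral_diff has_integral_mult_right pw hX integrable_integral lv)
  moreover have "(allpay_rate x has_integral integral {0..1} (allpay_rate x)) {0..1}"
    using allpay_rate_integrable by (rule integrable_integral)
  ultimately have 2: "S - (real m - 1) * (1 / (real m + 1)) - X + integral {0..1} ?lv \<le> integral {0..1} (allpay_rate x)"
  proof (rule has_integral_le)
    fix \<theta> :: real assume t: "\<theta> \<in> {0..1}"
    \<comment> \<open>The tangent point \<theta> is the mass that bids below
      \<open>\<beta> \<theta>\<close> when all types bid by \<beta>.\<close>
    have "\<theta> ^ m + real m * \<theta> ^ (m - 1) * (below (\<beta> \<theta>) - \<theta>) \<le> below (\<beta> \<theta>) ^ m"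
      using t below_nonneg m_ge_1 by (intro power_tangent_le) auto
    moreover have "\<theta> ^ (m-1) * \<theta> = \<theta> ^ m" using m_ge_1 by (simp add: power_eq_if mult.commute)
    hence "real m * \<theta> ^ (m - 1) * (below (\<beta> \<theta>) - \<theta>)
        = real m * \<theta> ^ (m - 1) * below (\<beta> \<theta>) - real m * \<theta> ^ m"
      by (simp only: right_diff_distrib mult.assoc)
    ultimately have "real m * \<theta> ^ (m-1) * below (\<beta> \<theta>) - (real m - 1) * \<theta> ^ m \<le> below (\<beta> \<theta>) ^ m"
      by (simp add: left_diff_distrib)
    thus "real m * \<theta> ^ (m-1) * below (\<beta> \<theta>) - (real m - 1) * \<theta> ^ m - x (cell \<theta>) + ?lv \<theta> \<le> allpay_rate x \<theta>"
      by (simp add: allpay_rate_def)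
  qed
  have "1 / (real m + 1) + (real m - 1) * (1 / (real m + 1)) + 1 / (real m + 1) = 1"
    by (simp add: add_divide_distrib[symmetric])
  hence "integral {0..1} ?loss / K \<le> integral {0..1} (allpay_rate x)"
    using 1 2 x[folded X_def] by linarith
  hence "integral {0..1} ?loss \<le> K * integral {0..1} (allpay_rate x)"
    using K_pos by (simp add: divide_le_eq mult.commute)
  moreover have "integral {0..1} (\<lambda>\<theta>. \<theta> ^ (m-1) * ?loss \<theta>) \<le> integral {0..1} ?loss"
    using loss_integrable loss by (intro integral_le) (auto intro: mult_left_le_one_le power_le_one)
  ultimately show ?thesis by linarith
qed

end

section \<open>First-price auctions\<close>

text \<open>\<open>x_prefix\<close> is the winning bound of the overview for \<open>A\<close>
  consisting of the types up to \<open>w\<close> that bid at least \<open>b\<close>; the division by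
  \<open>Suc m\<close>, which is \<open>N\<close>, passes from the winner to a single buyer.\<close>

locale first_price_grid = bid_grid +
  fixes x :: "real \<Rightarrow> real"
  assumes e_fp: "e = 1/\<alpha>" and alpha_less_1: "\<alpha> < 1" and K_fp: "real m \<le> K * (1/\<alpha> - 1)"
    and x_prefix: "\<And>b w. 0 < b \<Longrightarrow> w \<in> V \<Longrightarrow> b \<le> l w \<Longrightarrow>
        ((below b + (\<Sum>w'\<in>{w'\<in>V. b \<le> l w' \<and> w' \<le> w}. mass w')) ^ Suc m - below b ^ Suc m) / real (Suc m)
          \<le> (\<Sum>w'\<in>{w'\<in>V. b \<le> l w' \<and> w' \<le> w}. mass w' * x w')"
begin

lemma e_gt_1: "1 < e" using alpha_pos alpha_less_1 by (simp add: e_fp)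

lemma K_e: "real m \<le> K * (e - 1)" using K_fp by (simp add: e_fp)

lemma kappa_e: "\<kappa> * e = real m * (1 - \<kappa>)"
  using kappa(3) by (simp add: e_fp algebra_simps)

text \<open>Derivative with respect to the bid, at bid \<open>b\<close>, of payment divided by
  valuation minus loss divided by \<open>K\<close>, for a type \<open>t\<close> that wins with
  probability \<open>t ^ m\<close>, as it does when bids increase in the type.\<close>

definition level_fun :: "real \<Rightarrow> real \<Rightarrow> real" where
  "level_fun b t = t ^ m * t powr (-e) + t ^ (m-1) * (\<beta> t - b) / K"

lemma continuous_level_fun: "0 < a \<Longrightarrow> continuous_on {a..c} (level_fun b)"
  unfolding level_fun_def using continuous_beta[of a c] continuous_powr_pos[of a c "-e"] K_pos
  by (intro continuous_on_add continuous_on_mult continuous_on_divide continuous_on_diff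
      continuous_on_power continuous_on_id continuous_on_const) auto

lemma level_fun_integrable: "0 < a \<Longrightarrow> level_fun b integrable_on {a..c}"
  by (intro integrable_continuous_real continuous_level_fun)

text \<open>Moves type \<theta> up to position \<open>u\<close>. The winning probability
  \<open>u ^ m\<close> already belongs to the new position, so only the inverse valuation and the
  loss change: \<open>u ^ m * t powr (-e) + \<kappa> / K * t powr q\<close> decreases on the way,
  and so does \<open>- b * t ^ (m-1)\<close>.\<close>

lemma level_fun_shift:
  assumes \<theta>: "0 < \<theta>" "\<theta> \<le> u" "u \<le> 1" and b: "0 \<le> b"
  shows "level_fun b u \<le> u ^ m * \<theta> powr (-e) + \<theta> ^ (m-1) * (\<beta> \<theta> - b) / K"
proof -
  define q where "q = real (m - 1) + e"
  have q0: "0 < q" unfolding q_def using e_pos by (intro add_nonneg_pos) auto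
  have u: "0 < u" using \<theta> by simp
  have \<kappa>q: "\<kappa> / K * q \<le> e"
  proof -
    have "\<kappa> * q = \<kappa> * (real m + 1/\<alpha>) - \<kappa>" using m_ge_1 by (simp add: q_def e_fp of_nat_diff algebra_simps)
    hence "\<kappa> * q \<le> real m" using kappa by simp
    also have "\<dots> \<le> K * (e - 1)" by (rule K_e)
    also have "\<dots> \<le> K * e" using K_pos by (intro mult_left_mono) auto
    finally show ?thesis using K_pos by (simp add: divide_le_eq mult.commute)
  qed
  define f where "f t = u powr m * t powr (-e) + \<kappa> / K * t powr q" for t
  have "f u \<le> f \<theta>"
  proof (rule DERIV_nonpos_imp_nonincreasing[OF \<theta>(2)])
    fix t assume t: "\<theta> \<le> t" "t \<le> u"
    hence t0: "0 < t" "t \<le> 1" using \<theta> by auto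
    have "((\<lambda>t. u powr m * t powr (-e) + c * t powr q) has_real_derivative
            (- e * (u powr m * t powr (-e-1)) + c * (q * t powr (q-1)))) (at t)" for c
      using t0 by (auto intro!: derivative_eq_intros)
    hence "(f has_real_derivative (- e * (u powr m * t powr (-e-1)) + \<kappa> / K * (q * t powr (q-1)))) (at t)"
      unfolding f_def .
    moreover have "\<kappa> / K * (q * t powr (q-1)) \<le> e * (u powr m * t powr (-e-1))"
    proof -
      have "\<kappa> / K * (q * t powr (q-1)) = (\<kappa> / K * q) * t powr (q-1)" by (simp only: mult.assoc)
      also have "\<dots> \<le> e * (u powr m * t powr (-e-1))"
      proof (rule mult_mono[OF \<kappa>q])
        have "t powr (q-1) \<le> t powr (real m + (-e-1))"
          using t0 e_gt_1 m_ge_1 by (intro powr_mono') (auto simp: q_def of_nat_diff)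
        also have "\<dots> = t powr m * t powr (-e-1)" by (rule powr_add)
        also have "\<dots> \<le> u powr m * t powr (-e-1)"
          using t t0 by (intro mult_right_mono powr_mono2) auto
        finally show "t powr (q-1) \<le> u powr m * t powr (-e-1)" .
      qed (use e_pos in auto)
      finally show ?thesis .
    qed
    ultimately show "\<exists>y. (f has_real_derivative y) (at t) \<and> y \<le> 0" by (intro exI conjI) auto
  qed
  moreover have "\<kappa> / K * t powr q = t ^ (m-1) * \<beta> t / K" if "0 < t" for t
    using that by (simp add: q_def powr_add powr_realpow \<beta>_def)
  ultimately have "u ^ m * u powr (-e) + u ^ (m-1) * \<beta> u / K \<le> u ^ m * \<theta> powr (-e) + \<theta> ^ (m-1) * \<beta> \<theta> / K"
    using \<theta> u unfolding f_def by (simp only: powr_realpow)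
  moreover have "\<theta> ^ (m-1) * b / K \<le> u ^ (m-1) * b / K"
    using \<theta> b K_pos by (intro divide_right_mono mult_right_mono power_mono) auto
  ultimately show ?thesis
    by (simp add: level_fun_def right_diff_distrib diff_divide_distrib)
qed

definition avg_inv :: "real \<Rightarrow> real" where "avg_inv w = inv_int w / mass w"

lemma has_integral_const_mass: "w \<in> V \<Longrightarrow> ((\<lambda>_. c) has_integral mass w * c) {lo w..hi w}" for c :: real
  using has_integral_const_real[of c "lo w" "hi w"] lo_less_hi[of w] by (simp add: mass_def)

lemma avg_inv_bounds:
  assumes "w \<in> V" "w \<noteq> 0"
  shows "avg_inv w \<le> lo w powr (-(1/\<alpha>))" "hi w powr (-(1/\<alpha>)) \<le> avg_inv w" "0 \<le> avg_inv w"
proof -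
  note pos = lo_pos[OF assms] and less = lo_less_hi[OF assms(1)] and ms = mass_pos[OF assms(1)]
  have anti: "t powr (-(1/\<alpha>)) \<le> s powr (-(1/\<alpha>))" if "0 < s" "s \<le> t" for s t :: real
    using that alpha_pos by (intro powr_mono2') auto
  have "inv_int w \<le> mass w * lo w powr (-(1/\<alpha>))"
    by (rule has_integral_le[OF inv_int[OF assms] has_integral_const_mass[OF assms(1)]])
      (use anti pos in auto)
  thus "avg_inv w \<le> lo w powr (-(1/\<alpha>))" using ms by (simp add: avg_inv_def divide_le_eq mult.commute)
  have "mass w * hi w powr (-(1/\<alpha>)) \<le> inv_int w"
    by (rule has_integral_le[OF has_integral_const_mass[OF assms(1)] inv_int[OF assms]])
      (use anti pos in auto)
  thus "hi w powr (-(1/\<alpha>)) \<le> avg_inv w" using ms by (simp add: avg_inv_def le_divide_eq mult.commute)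
  thus "0 \<le> avg_inv w" by (meson order_trans powr_ge_zero)
qed

lemma avg_inv_antimono:
  assumes "w \<in> V" "w \<noteq> 0" "w' \<in> V" "w < w'"
  shows "avg_inv w' \<le> avg_inv w"
proof -
  have "w' \<noteq> 0" using assms V_nonneg by force
  have "avg_inv w' \<le> lo w' powr (-(1/\<alpha>))" using avg_inv_bounds assms \<open>w' \<noteq> 0\<close> by blast
  also have "\<dots> \<le> hi w powr (-(1/\<alpha>))"
    using hi_le_lo[OF assms(1,3,4)] lo_pos[OF assms(1,2)] lo_less_hi[OF assms(1)] alpha_pos
    by (intro powr_mono2') auto
  also have "\<dots> \<le> avg_inv w" using avg_inv_bounds assms by blast
  finally show ?thesis .
qed

text \<open>Chebyshev's inequality on one cell, moved up by \<open>sh\<close>: the winning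
  probability increases in the type while the inverse valuation decreases.\<close>

lemma chebyshev_cell:
  assumes w: "w \<in> V" "w \<noteq> 0" and sh: "0 \<le> sh"
    and A: "((\<lambda>\<theta>. (\<theta> + sh) ^ m) has_integral A) {lo w..hi w}"
    and I: "((\<lambda>\<theta>. (\<theta> + sh) ^ m * \<theta> powr (-e)) has_integral I) {lo w..hi w}"
  shows "I \<le> avg_inv w * A"
proof -
  define a where "a = avg_inv w"
  \<comment> \<open>\<open>s\<close> is the type at which the inverse valuation equals its mean
    \<open>a\<close> over the cell. Both factors change sign there, and the constant
    \<open>(s + sh) ^ m\<close> costs nothing since \<open>a - \<theta> powr (-e)\<close> integrates
    to 0.\<close>
  define s where "s = a powr (-\<alpha>)"
  note pos = lo_pos[OF w]
  have a0: "0 < a"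
    using avg_inv_bounds(2)[OF w] pos lo_less_hi[OF w(1)] powr_gt_zero[of "hi w" "-(1/\<alpha>)"] unfolding a_def
    by linarith
  have s: "0 < s" "s powr (-e) = a" using a0 alpha_pos by (simp_all add: s_def powr_powr e_fp)
  have inv: "((\<lambda>\<theta>. \<theta> powr (-e)) has_integral inv_int w) {lo w..hi w}"
    using inv_int[OF w] by (simp add: e_fp)
  have "((\<lambda>\<theta>. (a - \<theta> powr (-e)) * (s + sh) ^ m) has_integral (mass w * a - inv_int w) * (s + sh) ^ m) {lo w..hi w}"
    by (intro has_integral_mult_left has_integral_diff has_integral_const_mass w inv)
  moreover have "mass w * a - inv_int w = 0" using mass_pos[OF w(1)] by (simp add: a_def avg_inv_def)
  ultimately have z: "((\<lambda>\<theta>. (a - \<theta> powr (-e)) * (s + sh) ^ m) has_integral 0) {lo w..hi w}" by simp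
  have "((\<lambda>\<theta>. a * (\<theta> + sh) ^ m - (\<theta> + sh) ^ m * \<theta> powr (-e)) has_integral (a * A - I)) {lo w..hi w}"
    by (intro has_integral_diff has_integral_mult_right A I)
  with z have "0 \<le> a * A - I"
  proof (rule has_integral_le)
    fix \<theta> assume "\<theta> \<in> {lo w..hi w}"
    hence t: "0 < \<theta>" using pos by auto
    have "0 \<le> (a - \<theta> powr (-e)) * ((\<theta> + sh) ^ m - (s + sh) ^ m)"
    proof (cases "s \<le> \<theta>")
      case True
      hence "\<theta> powr (-e) \<le> a" unfolding s(2)[symmetric] using s e_pos by (intro powr_mono2') auto
      moreover have "(s + sh) ^ m \<le> (\<theta> + sh) ^ m" using True s sh by (intro power_mono) auto
      ultimately show ?thesis by (intro mult_nonneg_nonneg) auto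
    next
      case False
      hence "a \<le> \<theta> powr (-e)" unfolding s(2)[symmetric] using t e_pos by (intro powr_mono2') auto
      moreover have "(\<theta> + sh) ^ m \<le> (s + sh) ^ m" using False t sh by (intro power_mono) auto
      ultimately show ?thesis by (intro mult_nonpos_nonpos) auto
    qed
    thus "(a - \<theta> powr (-e)) * (s + sh) ^ m \<le> a * (\<theta> + sh) ^ m - (\<theta> + sh) ^ m * \<theta> powr (-e)"
      by (simp add: algebra_simps)
  qed
  thus ?thesis by (simp add: a_def)
qed

definition cell_wt :: "real \<Rightarrow> real" where "cell_wt w = integral {lo w..hi w} (\<lambda>\<theta>. \<theta> ^ (m-1))"
definition cell_beta :: "real \<Rightarrow> real" where "cell_beta w = integral {lo w..hi w} (\<lambda>\<theta>. \<theta> ^ (m-1) * \<beta> \<theta>)"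

lemma cell_wt: "((\<lambda>\<theta>. \<theta> ^ (m-1)) has_integral cell_wt w) {lo w..hi w}"
  unfolding cell_wt_def by (intro integrable_integral integrable_continuous_real continuous_intros)

lemma cell_beta: "((\<lambda>\<theta>. \<theta> ^ (m-1) * \<beta> \<theta>) has_integral cell_beta w) {lo w..hi w}"
  unfolding cell_beta_def using lo_nonneg
  by (intro integrable_integral integrable_continuous_real continuous_intros continuous_beta)

text \<open>The cells of \<open>E\<close> are pushed up in order until they fill the interval from
  \<open>below b\<close> to 1; cell \<open>w\<close> lands between \<open>c w\<close> and
  \<open>d w\<close>. Winning probabilities are compared by Abel summation, averages on a cell by
  \<open>chebyshev_cell\<close>, and the move itself by \<open>level_fun_shift\<close>.\<close>

lemma level_sum_ge:
  assumes b: "0 < b"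
  shows "integral {below b..1} (level_fun b)
           \<le> (\<Sum>w\<in>{w\<in>V. b \<le> l w}. x w * inv_int w + (cell_beta w - b * cell_wt w) / K)"
    and "0 < below b"
proof -
  define E where "E = {w\<in>V. b \<le> l w}"
  define h where "h = below b"
  have E: "finite E" "\<And>w. w \<in> E \<Longrightarrow> w \<in> V" "\<And>w. w \<in> E \<Longrightarrow> w \<noteq> 0"
    using finite_V b l_0 by (auto simp: E_def)
  have h_compl: "h + sum mass E = 1"
  proof -
    have "h + sum mass E = sum mass ({w\<in>V. l w < b} \<union> E)"
      unfolding h_def below_def E_def using finite_V by (subst sum.union_disjoint) auto
    also have "{w\<in>V. l w < b} \<union> E = V" by (auto simp: E_def)
    finally show ?thesis using sum_mass by simp
  qed
  \<comment> \<open>Type 0 bids 0 and so stays below every positive level. This keeps the lower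
    limit away from 0, where \<open>level_fun\<close> may be singular.\<close>
  have "mass 0 \<le> h" unfolding h_def below_def using finite_V zero_V l_0 b mass_pos
    by (intro member_le_sum) (auto intro: less_imp_le)
  with mass_pos[OF zero_V] have h0: "0 < h" by simp
  thus "0 < below b" by (simp add: h_def)
  define c where "c w = h + (\<Sum>w'\<in>{w'\<in>E. w' < w}. mass w')" for w
  define d where "d w = h + (\<Sum>w'\<in>{w'\<in>E. w' \<le> w}. mass w')" for w
  have dc: "d w = c w + mass w" if "w \<in> E" for w
  proof -
    have "{w'\<in>E. w' \<le> w} = insert w {w'\<in>E. w' < w}" using that by auto
    thus ?thesis using E(1) by (simp add: c_def d_def)
  qed
  have ch: "h \<le> c w" for w
    unfolding c_def using E mass_pos by (simp, intro sum_nonneg) (auto intro: less_imp_le)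
  have d1: "d w \<le> 1" for w
    unfolding d_def h_compl[symmetric] using E mass_pos
    by (intro add_left_mono sum_mono2) (auto intro: less_imp_le)
  \<comment> \<open>Every type below \<open>w\<close> either bids below \<open>b\<close>, and is
    counted in \<open>h\<close>, or precedes \<open>w\<close> in \<open>E\<close>; so cells only
    move up.\<close>
  have lo_c: "lo w \<le> c w" if "w \<in> E" for w
  proof -
    have "lo w = (\<Sum>w'\<in>{w'\<in>V. w' < w}. mass w')" using sum_mass_less E that by simp
    also have "\<dots> \<le> sum mass ({w\<in>V. l w < b} \<union> {w'\<in>E. w' < w})"
    proof (rule sum_mono2)
      show "{w'\<in>V. w' < w} \<subseteq> {w\<in>V. l w < b} \<union> {w'\<in>E. w' < w}" unfolding E_def by force
      show "0 \<le> mass v" if "v \<in> {w\<in>V. l w < b} \<union> {w'\<in>E. w' < w} - {w'\<in>V. w' < w}" for v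
        using that E(2) mass_pos[of v] by force
    qed (use finite_V E(1) in simp)
    also have "\<dots> = c w"
      unfolding c_def h_def below_def
    proof (rule sum.union_disjoint)
      show "{w\<in>V. l w < b} \<inter> {w'\<in>E. w' < w} = {}" unfolding E_def by force
    qed (use finite_V E(1) in simp_all)
    finally show ?thesis .
  qed
  \<comment> \<open>Surplus of the actual winning probability over the one obtained in the pushed-up
    position. Its prefix sums are nonnegative by \<open>x_prefix\<close>.\<close>
  define y where "y w = mass w * x w - (d w ^ Suc m - c w ^ Suc m) / real (Suc m)" for w
  have tele: "(\<Sum>w\<in>E'. d w ^ Suc m - c w ^ Suc m) = (h + sum mass E') ^ Suc m - h ^ Suc m"
    if "E' = {w'\<in>E. w' \<le> w}" for E' w
  proof -
    have fin: "finite E'" using that E by simp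
    have "{w''\<in>E'. w'' \<le> w'} = {w''\<in>E. w'' \<le> w'}" "{w''\<in>E'. w'' < w'} = {w''\<in>E. w'' < w'}"
      if "w' \<in> E'" for w' using that \<open>E' = _\<close> by auto
    thus ?thesis
      using sum_telescope_prefix[OF fin, of "\<lambda>t. t ^ Suc m" h mass] by (simp add: c_def d_def)
  qed
  have abel: "0 * sum y E \<le> (\<Sum>w\<in>E. avg_inv w * y w)"
  proof (rule sum_mult_ge_of_prefix_sums[OF E(1)])
    fix w assume w: "w \<in> E"
    have eq: "{w'\<in>E. w' \<le> w} = {w'\<in>V. b \<le> l w' \<and> w' \<le> w}" by (auto simp: E_def)
    have "(\<Sum>w'\<in>{w'\<in>E. w' \<le> w}. y w') = (\<Sum>w'\<in>{w'\<in>E. w' \<le> w}. mass w' * x w')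
        - ((h + sum mass {w'\<in>E. w' \<le> w}) ^ Suc m - h ^ Suc m) / real (Suc m)"
      unfolding y_def by (subst sum_subtractf) (simp only: sum_divide_distrib[symmetric] tele[OF refl, of w])
    thus "0 \<le> (\<Sum>w'\<in>{w'\<in>E. w' \<le> w}. y w')"
      using x_prefix[OF b, of w] w unfolding eq by (simp add: E_def h_def)
  qed (use E avg_inv_antimono avg_inv_bounds in auto)
  define f where "f t = integral {h..t} (level_fun b)" for t
  have cellwise: "f (d w) - f (c w)
      \<le> avg_inv w * ((d w ^ Suc m - c w ^ Suc m) / real (Suc m)) + (cell_beta w - b * cell_wt w) / K"
    if w: "w \<in> E" for w
  proof -
    define sh where "sh = c w - lo w"
    have sh: "0 \<le> sh" "c w - sh = lo w" "d w - sh = hi w"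
      using lo_c[OF w] dc[OF w] by (auto simp: sh_def mass_def)
    note wV = E(2)[OF w] and w0 = E(3)[OF w]
    have cd: "c w \<le> d w" using dc[OF w] mass_pos[OF wV] by simp
    have "f (d w) = f (c w) + integral {c w..d w} (level_fun b)"
      unfolding f_def using Henstock_Kurzweil_Integration.integral_combine[OF ch[of w] cd level_fun_integrable[OF h0], of b] by simp
    moreover have "integral {c w..d w} (level_fun b)
        \<le> avg_inv w * ((d w ^ Suc m - c w ^ Suc m) / real (Suc m)) + (cell_beta w - b * cell_wt w) / K"
    proof -
      have A: "((\<lambda>\<theta>. (\<theta> + sh) ^ m) has_integral (d w ^ Suc m - c w ^ Suc m) / real (Suc m)) {lo w..hi w}"
        using has_integral_shift_real_ivl[OF has_integral_power[of "c w" "d w" m], of sh] cd ch[of w] h0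
        unfolding sh by simp
      define I where "I = integral {lo w..hi w} (\<lambda>\<theta>. (\<theta> + sh) ^ m * \<theta> powr (-e))"
      have I: "((\<lambda>\<theta>. (\<theta> + sh) ^ m * \<theta> powr (-e)) has_integral I) {lo w..hi w}"
        unfolding I_def using continuous_powr_pos[OF lo_pos[OF wV w0], of "hi w" "-e"]
        by (intro integrable_integral integrable_continuous_real continuous_on_mult continuous_on_power
            continuous_on_add continuous_on_id continuous_on_const)
      have L: "((\<lambda>\<theta>. level_fun b (\<theta> + sh)) has_integral integral {c w..d w} (level_fun b)) {lo w..hi w}"
        using has_integral_shift_real_ivl[OF integrable_integral[OF level_fun_integrable[of "c w" b "d w"]], of sh]
          ch[of w] h0 unfolding sh by simp
      have "((\<lambda>\<theta>. (\<theta> + sh) ^ m * \<theta> powr (-e) + (\<theta> ^ (m-1) * \<beta> \<theta> - b * \<theta> ^ (m-1)) / K)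
          has_integral I + (cell_beta w - b * cell_wt w) / K) {lo w..hi w}"
        by (intro has_integral_add has_integral_divide has_integral_diff has_integral_mult_right I cell_beta cell_wt)
      with L have "integral {c w..d w} (level_fun b) \<le> I + (cell_beta w - b * cell_wt w) / K"
      proof (rule has_integral_le)
        fix \<theta> assume "\<theta> \<in> {lo w..hi w}"
        hence "0 < \<theta>" "\<theta> + sh \<le> 1" using lo_pos[OF wV w0] sh d1[of w] by auto
        thus "level_fun b (\<theta> + sh) \<le> (\<theta> + sh) ^ m * \<theta> powr (-e) + (\<theta> ^ (m-1) * \<beta> \<theta> - b * \<theta> ^ (m-1)) / K"
          using level_fun_shift[of \<theta> "\<theta> + sh" b] sh b by (simp add: right_diff_distrib mult.commute)
      qed
      with chebyshev_cell[OF wV w0 sh(1) A I] show ?thesis by linarith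
    qed
    ultimately show ?thesis by simp
  qed
  have "integral {h..1} (level_fun b) = f 1 - f h" by (simp add: f_def)
  also have "\<dots> = (\<Sum>w\<in>E. f (d w) - f (c w))"
    using sum_telescope_prefix[OF E(1), of f h mass] by (simp add: h_compl c_def d_def)
  also have "\<dots> \<le> (\<Sum>w\<in>E. avg_inv w * ((d w ^ Suc m - c w ^ Suc m) / real (Suc m)) + (cell_beta w - b * cell_wt w) / K)"
    by (intro sum_mono cellwise)
  also have "\<dots> \<le> (\<Sum>w\<in>E. avg_inv w * ((d w ^ Suc m - c w ^ Suc m) / real (Suc m)) + (cell_beta w - b * cell_wt w) / K)
      + (\<Sum>w\<in>E. avg_inv w * y w)" using abel by simp
  also have "\<dots> = (\<Sum>w\<in>E. x w * inv_int w + (cell_beta w - b * cell_wt w) / K)"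
    unfolding sum.distrib[symmetric]
  proof (rule sum.cong[OF refl])
    fix w assume "w \<in> E"
    hence "avg_inv w * (mass w * x w) = x w * inv_int w"
      using mass_pos[of w] E by (simp add: avg_inv_def)
    thus "avg_inv w * ((d w ^ Suc m - c w ^ Suc m) / real (Suc m)) + (cell_beta w - b * cell_wt w) / K
        + avg_inv w * y w = x w * inv_int w + (cell_beta w - b * cell_wt w) / K"
      unfolding y_def right_diff_distrib by linarith
  qed
  finally show "integral {below b..1} (level_fun b)
           \<le> (\<Sum>w\<in>{w\<in>V. b \<le> l w}. x w * inv_int w + (cell_beta w - b * cell_wt w) / K)"
    by (simp add: h_def E_def)
qed

end

section \<open>Minimising each bid level and integrating over the levels\<close>

context first_price_grid
begin

definition beta' :: "real \<Rightarrow> real" where "beta' z = \<kappa> * e * z powr (e - 1)"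

lemma beta_deriv: "0 < z \<Longrightarrow> (\<beta> has_real_derivative beta' z) (at z)"
  unfolding \<beta>_def beta'_def by (auto intro!: derivative_eq_intros)

lemma beta'_nonneg: "0 \<le> beta' z" using kappa e_pos by (simp add: beta'_def)

lemma beta'_0: "beta' 0 = 0" by (simp add: beta'_def)

text \<open>The derivative is nonpositive once \<open>\<kappa> * e \<le> K * (e - 1)\<close>. As
  \<open>\<kappa> * e \<le> m\<close>, this follows from the entry
  \<open>\<alpha> * (N - 1) / (1 - \<alpha>)\<close> of \<open>K\<close>.\<close>

lemma level_weight_antimono:
  assumes "0 < s" "s \<le> t" "t \<le> 1"
  shows "t powr (1 - e) + \<kappa> / K * t powr e \<le> s powr (1 - e) + \<kappa> / K * s powr e"
proof (rule DERIV_nonpos_imp_nonincreasing[OF assms(2)])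
  fix u assume "s \<le> u" "u \<le> t"
  hence u: "0 < u" "u \<le> 1" using assms by auto
  have "((\<lambda>t. t powr (1 - e) + c * t powr e) has_real_derivative
            (1 - e) * u powr (1 - e - 1) + c * (e * u powr (e - 1))) (at u)" for c
    using u by (auto intro!: derivative_eq_intros)
  hence "((\<lambda>t. t powr (1 - e) + \<kappa> / K * t powr e) has_real_derivative
            (1 - e) * u powr (1 - e - 1) + \<kappa> / K * (e * u powr (e - 1))) (at u)" .
  moreover have "\<kappa> / K * (e * u powr (e - 1)) \<le> (e - 1) * u powr (1 - e - 1)"
  proof -
    have "\<kappa> * e \<le> real m" using kappa m_ge_1 kappa_e by (simp add: mult_le_cancel_left1)
    also have "\<dots> \<le> K * (e - 1)" by (rule K_e)
    finally have "\<kappa> / K * e \<le> e - 1" using K_pos by (simp add: divide_le_eq mult.commute)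
    moreover have "u powr (e - 1) \<le> u powr (1 - e - 1)" using u e_gt_1 by (intro powr_mono') auto
    ultimately have "\<kappa> / K * e * u powr (e - 1) \<le> (e - 1) * u powr (1 - e - 1)"
      using e_gt_1 by (intro mult_mono) auto
    thus ?thesis by (simp only: mult.assoc)
  qed
  ultimately show "\<exists>y. ((\<lambda>t. t powr (1 - e) + \<kappa> / K * t powr e) has_real_derivative y) (at u) \<and> y \<le> 0"
    by (intro exI conjI) (auto simp: algebra_simps)
qed

text \<open>The first summand is the derivative of \<open>(1 - \<kappa>) * t ^ m\<close>; the sign
  of the second is governed by \<open>level_weight_antimono\<close>.\<close>

lemma level_fun_weight:
  assumes "0 < t" "0 < z"
  shows "beta' z * level_fun (\<beta> z) t = real m * (1 - \<kappa>) * t ^ (m-1)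
    + beta' z * t ^ (m-1) * ((t powr (1 - e) + \<kappa> / K * t powr e) - (z powr (1 - e) + \<kappa> / K * z powr e))"
proof -
  have "t ^ m * t powr (-e) = t ^ (m-1) * t powr (1 - e)"
    using assms m_ge_1 by (simp add: power_eq_if powr_diff powr_minus divide_inverse)
  hence "level_fun (\<beta> z) t = t ^ (m-1) * (t powr (1 - e) + \<kappa> / K * t powr e - \<kappa> / K * z powr e)"
    by (simp add: level_fun_def \<beta>_def algebra_simps diff_divide_distrib)
  moreover have "beta' z * z powr (1 - e) = real m * (1 - \<kappa>)"
  proof -
    have "z powr (e - 1) * z powr (1 - e) = 1" using assms by (simp add: powr_add[symmetric])
    thus ?thesis unfolding kappa_e[symmetric] beta'_def by (metis mult.assoc mult.right_neutral)
  qed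
  moreover have "b * L = q * c + b * c * ((x + k) - (y + k'))"
    if "L = c * (x + k - k')" "b * y = q" for b L q c x k y k' :: real
    using that by algebra
  ultimately show ?thesis by blast
qed

lemma has_integral_weight:
  assumes "0 \<le> a" "a \<le> b"
  shows "((\<lambda>t. real m * (1 - \<kappa>) * t ^ (m-1)) has_integral (1 - \<kappa>) * b ^ m - (1 - \<kappa>) * a ^ m) {a..b}"
proof -
  define I where "I = (b ^ Suc (m-1) - a ^ Suc (m-1)) / real (Suc (m-1))"
  have 1: "((\<lambda>t. real m * (1 - \<kappa>) * t ^ (m-1)) has_integral real m * (1 - \<kappa>) * I) {a..b}"
    unfolding I_def by (intro has_integral_mult_right has_integral_power assms)
  have "real m * I = b ^ m - a ^ m" unfolding I_def using m_ge_1 by simp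
  moreover have "r * k * i = k * y - k * x" if "r * i = y - x" for r k i x y :: real
    using that by algebra
  ultimately have "real m * (1 - \<kappa>) * I = (1 - \<kappa>) * b ^ m - (1 - \<kappa>) * a ^ m" by blast
  with 1 show ?thesis by simp
qed

text \<open>\<open>(1 - \<kappa>) * h ^ m\<close> is the deviation term: equilibrium bids are
  \<open>\<kappa> * v\<close>, so winning leaves the share \<open>1 - \<kappa>\<close> of
  \<open>v\<close>. By \<open>level_fun_weight\<close> the derivative in \<open>h\<close> is
  nonpositive before \<open>z\<close> and nonnegative after it.\<close>

lemma level_min:
  assumes z: "0 < z" "z \<le> 1" and h: "0 < h" "h \<le> 1"
  shows "beta' z * integral {z..1} (level_fun (\<beta> z)) + (1 - \<kappa>) * z ^ m
           \<le> beta' z * integral {h..1} (level_fun (\<beta> z)) + (1 - \<kappa>) * h ^ m"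
proof -
  have I: "((\<lambda>t. beta' z * level_fun (\<beta> z) t) has_integral beta' z * integral {a..b} (level_fun (\<beta> z))) {a..b}"
    if "0 < a" for a b
    using that by (intro has_integral_mult_right integrable_integral level_fun_integrable)
  have split: "integral {a..1} (level_fun b) = integral {a..c} (level_fun b) + integral {c..1} (level_fun b)"
    if "0 < a" "a \<le> c" "c \<le> 1" for a b c
    using Henstock_Kurzweil_Integration.integral_combine[OF that(2,3) level_fun_integrable[OF that(1)], of b] by simp
  show ?thesis
  proof (cases "z \<le> h")
    case True
    have "beta' z * integral {z..h} (level_fun (\<beta> z)) \<le> (1 - \<kappa>) * h ^ m - (1 - \<kappa>) * z ^ m"
    proof (rule has_integral_le[OF I[OF z(1)] has_integral_weight])
      fix t assume "t \<in> {z..h}"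
      hence t: "0 < t" "z \<le> t" "t \<le> 1" using z h by auto
      have "beta' z * t ^ (m-1) * ((t powr (1 - e) + \<kappa> / K * t powr e) - (z powr (1 - e) + \<kappa> / K * z powr e)) \<le> 0"
        using level_weight_antimono[OF z(1) t(2,3)] beta'_nonneg[of z] t(1) by (intro mult_nonneg_nonpos) auto
      thus "beta' z * level_fun (\<beta> z) t \<le> real m * (1 - \<kappa>) * t ^ (m-1)"
        unfolding level_fun_weight[OF t(1) z(1)] by linarith
    qed (use True z in auto)
    thus ?thesis using split[OF z(1) True h(2), of "\<beta> z"] by (simp add: distrib_left)
  next
    case False
    have "(1 - \<kappa>) * z ^ m - (1 - \<kappa>) * h ^ m \<le> beta' z * integral {h..z} (level_fun (\<beta> z))"
    proof (rule has_integral_le[OF has_integral_weight I[OF h(1)]])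
      fix t assume "t \<in> {h..z}"
      hence t: "0 < t" "t \<le> z" using h by auto
      have "0 \<le> beta' z * t ^ (m-1) * ((t powr (1 - e) + \<kappa> / K * t powr e) - (z powr (1 - e) + \<kappa> / K * z powr e))"
        using level_weight_antimono[OF t z(2)] beta'_nonneg[of z] t(1) by (intro mult_nonneg_nonneg) auto
      thus "real m * (1 - \<kappa>) * t ^ (m-1) \<le> beta' z * level_fun (\<beta> z) t"
        unfolding level_fun_weight[OF t(1) z(1)] by linarith
    qed (use False h in auto)
    thus ?thesis using split[OF h(1) _ z(2), of "\<beta> z"] False by (simp add: distrib_left)
  qed
qed

text \<open>Serves the levels above \<open>\<kappa>\<close>, which no deviation targets. Payments
  contribute \<open>t powr (1 - e) \<ge> 1\<close>, the loss at least -1 because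
  \<open>b \<le> Bmax \<le> K\<close>.\<close>

lemma level_nonneg:
  assumes b: "b \<le> Bmax" and h: "0 < h"
  shows "0 \<le> integral {h..1} (level_fun b)"
proof (rule integral_nonneg[OF level_fun_integrable[OF h]])
  fix t assume "t \<in> {h..1}"
  hence t: "0 < t" "t \<le> 1" using h by auto
  have "1 \<le> t powr (1 - e)" using t e_gt_1 powr_mono'[of "1 - e" 0 t] by simp
  moreover have "t ^ m * t powr (-e) = t ^ (m-1) * t powr (1 - e)"
    using t m_ge_1 by (simp add: power_eq_if powr_diff powr_minus divide_inverse)
  moreover have "-1 \<le> (\<beta> t - b) / K"
    using b Bmax_le beta_nonneg[of t] K_pos by (simp add: le_divide_eq)
  ultimately have "0 \<le> t ^ (m-1) * (t powr (1 - e) + (\<beta> t - b) / K)" using t by (intro mult_nonneg_nonneg) auto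
  thus "0 \<le> level_fun b t"
    using \<open>t ^ m * _ = _\<close> by (simp add: level_fun_def distrib_left)
qed

text \<open>Antiderivative of \<open>u ^ m * u powr (-e)\<close>, logarithmic in the exceptional
  case.\<close>

definition prim :: "real \<Rightarrow> real" where
  "prim u = (if real m - e = -1 then ln u else u powr (real m - e + 1) / (real m - e + 1))"

lemma prim_deriv:
  assumes "0 < u" shows "(prim has_real_derivative u ^ m * u powr (-e)) (at u)"
proof -
  have eq: "u ^ m * u powr (-e) = u powr (real m - e)"
    using assms by (simp add: powr_diff powr_realpow powr_minus divide_inverse)
  show ?thesis
  proof (cases "real m - e = -1")
    case True
    thus ?thesis unfolding eq using assms
      by (auto simp: prim_def[abs_def] powr_minus divide_inverse intro!: derivative_eq_intros)
  next
    case False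
    hence "real m - e + 1 \<noteq> 0" by linarith
    hence "((\<lambda>u. u powr (real m - e + 1) / (real m - e + 1)) has_real_derivative u powr (real m - e)) (at u)"
      using assms by (auto intro!: derivative_eq_intros)
    thus ?thesis unfolding eq using False by (simp add: prim_def[abs_def])
  qed
qed

lemma has_integral_prim:
  assumes "0 < a" "a \<le> b"
  shows "((\<lambda>t. t ^ m * t powr (-e)) has_integral prim b - prim a) {a..b}"
proof (rule fundamental_theorem_of_calculus[OF assms(2)])
  fix t assume "t \<in> {a..b}"
  thus "(prim has_vector_derivative t ^ m * t powr (-e)) (at t within {a..b})"
    using prim_deriv[of t] assms
    by (simp add: has_real_derivative_iff_has_vector_derivative has_vector_derivative_at_within)
qed

text \<open>Gives \<open>\<beta> z * (prim 1 - prim z) \<le> \<kappa> * z\<close>, hence continuity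
  of this product at 0 even if \<open>prim\<close> is unbounded there.\<close>

lemma prim_diff_bounds:
  assumes "0 < z" "z \<le> 1"
  shows "0 \<le> prim 1 - prim z" "prim 1 - prim z \<le> z powr (1 - e)"
proof -
  note I = has_integral_prim[OF assms]
  show "0 \<le> prim 1 - prim z" by (rule has_integral_nonneg[OF I]) (use assms in auto)
  have "prim 1 - prim z \<le> (1 - z) * z powr (1 - e)"
  proof (rule has_integral_le[OF I])
    show "((\<lambda>_. z powr (1 - e)) has_integral (1 - z) * z powr (1 - e)) {z..1}"
      using has_integral_const_real[of "z powr (1 - e)" z 1] assms by simp
    fix t assume "t \<in> {z..1}"
    hence t: "0 < t" "z \<le> t" "t \<le> 1" using assms by auto
    have "t ^ m * t powr (-e) \<le> t * t powr (-e)"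
      using t m_ge_1 power_decreasing[of 1 m t] by (intro mult_right_mono) auto
    also have "\<dots> = t powr (1 - e)" using t by (simp add: powr_diff powr_minus divide_inverse)
    also have "\<dots> \<le> z powr (1 - e)" using t assms e_gt_1 by (intro powr_mono2') auto
    finally show "t ^ m * t powr (-e) \<le> z powr (1 - e)" .
  qed
  also have "\<dots> \<le> z powr (1 - e)" using assms by (intro mult_left_le_one_le) auto
  finally show "prim 1 - prim z \<le> z powr (1 - e)" .
qed

lemma integral_level_fun:
  assumes "0 < z" "z \<le> 1"
  shows "integral {z..1} (level_fun b) = (prim 1 - prim z)
    + (\<kappa> * (1 - z powr (real m + e)) / (real m + e) - b * (1 - z ^ m) / real m) / K"
proof (rule integral_unique)
  have m0: "0 < real m" using m_ge_1 by simp
  hence me: "0 < real m + e" using e_pos by simp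
  have "((\<lambda>t. t ^ (m-1) * \<beta> t) has_integral
      \<kappa> * 1 powr (real m + e) / (real m + e) - \<kappa> * z powr (real m + e) / (real m + e)) {z..1}"
  proof (rule fundamental_theorem_of_calculus[OF assms(2)])
    fix t assume "t \<in> {z..1}"
    hence t: "0 < t" using assms by auto
    have "((\<lambda>t. \<kappa> * t powr (real m + e) / (real m + e)) has_real_derivative \<kappa> * t powr (real m + e - 1)) (at t)"
      using t me by (auto intro!: derivative_eq_intros)
    moreover have "real m + e - 1 = real (m-1) + e" using m_ge_1 by (simp add: of_nat_diff)
    hence "t powr (real m + e - 1) = t ^ (m-1) * t powr e"
      using t by (simp only: powr_add powr_realpow)
    hence "\<kappa> * t powr (real m + e - 1) = t ^ (m-1) * \<beta> t" by (simp add: \<beta>_def)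
    ultimately show "((\<lambda>t. \<kappa> * t powr (real m + e) / (real m + e)) has_vector_derivative t ^ (m-1) * \<beta> t) (at t within {z..1})"
      by (simp add: has_real_derivative_iff_has_vector_derivative has_vector_derivative_at_within)
  qed
  hence 1: "((\<lambda>t. t ^ (m-1) * \<beta> t) has_integral \<kappa> * (1 - z powr (real m + e)) / (real m + e)) {z..1}"
    by (simp add: right_diff_distrib diff_divide_distrib)
  have "((\<lambda>t. b * t ^ (m-1)) has_integral b * ((1 ^ Suc (m-1) - z ^ Suc (m-1)) / real (Suc (m-1)))) {z..1}"
    using assms by (intro has_integral_mult_right has_integral_power) auto
  hence 2: "((\<lambda>t. b * t ^ (m-1)) has_integral b * (1 - z ^ m) / real m) {z..1}" using m_ge_1 by simp
  have "((\<lambda>t. t ^ m * t powr (-e) + (t ^ (m-1) * \<beta> t - b * t ^ (m-1)) / K) has_integral (prim 1 - prim z)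
    + (\<kappa> * (1 - z powr (real m + e)) / (real m + e) - b * (1 - z ^ m) / real m) / K) {z..1}"
    by (intro has_integral_add has_integral_divide has_integral_diff has_integral_prim 1 2 assms)
  thus "(level_fun b has_integral (prim 1 - prim z)
    + (\<kappa> * (1 - z powr (real m + e)) / (real m + e) - b * (1 - z ^ m) / real m) / K) {z..1}"
    by (simp add: level_fun_def[abs_def] right_diff_distrib mult.commute)
qed

lemma continuous_beta_prim: "continuous_on {0..1} (\<lambda>z. \<beta> z * (prim 1 - prim z))"
  unfolding continuous_on_eq_continuous_within
proof
  fix z :: real assume z: "z \<in> {0..1}"
  show "continuous (at z within {0..1}) (\<lambda>z. \<beta> z * (prim 1 - prim z))"
  proof (cases "z = 0")
    case False
    hence "0 < z" using z by simp
    hence "isCont \<beta> z" "isCont prim z" using beta_deriv prim_deriv by (auto intro: DERIV_isCont)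
    thus ?thesis by (intro continuous_at_imp_continuous_at_within[of _ _ "{0..1}"] isCont_mult isCont_diff continuous_const)
  next
    case True
    have bd: "norm (\<beta> t * (prim 1 - prim t)) \<le> t * \<kappa>" if "t \<in> {0..1}" for t
    proof (cases "t = 0")
      case True thus ?thesis by (simp add: \<beta>_def)
    next
      case False
      hence t: "0 < t" "t \<le> 1" using that by auto
      have "\<beta> t * (prim 1 - prim t) \<le> \<beta> t * t powr (1 - e)"
        using prim_diff_bounds[OF t] beta_nonneg by (intro mult_left_mono)
      also have "\<dots> = t * \<kappa>" using t by (simp add: \<beta>_def powr_diff)
      finally show ?thesis using prim_diff_bounds[OF t] beta_nonneg[of t] by simp
    qed
    have "((\<lambda>t. t * \<kappa>) \<longlongrightarrow> 0 * \<kappa>) (at 0 within {0..1})" by (intro tendsto_intros)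
    hence lim: "((\<lambda>t. t * \<kappa>) \<longlongrightarrow> 0) (at 0 within {0..1})" by simp
    have "((\<lambda>t. \<beta> t * (prim 1 - prim t)) \<longlongrightarrow> 0) (at 0 within {0..1})"
      by (rule Lim_null_comparison[OF _ lim]) (use bd in \<open>auto simp: eventually_at_filter\<close>)
    thus ?thesis using True by (simp add: continuous_within \<beta>_def)
  qed
qed

text \<open>
  The antiderivative comes from exchanging the two integrations: a type \<open>t\<close> contributes to the levels
  \<open>z \<le> t\<close>, so the mass of \<open>t \<ge> z\<close> enters with bids up to \<open>\<beta> z\<close> and that of \<open>t \<le> z\<close> with bids up to \<open>\<beta> t\<close>.
\<close>

lemma has_integral_level_target:
  "((\<lambda>z. beta' z * integral {z..1} (level_fun (\<beta> z)) + (1 - \<kappa>) * z ^ m) has_integral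
      1 / (real m + 1) + \<kappa>\<^sup>2 / (2 * (real m + 2 * e)) / K) {0..1}"
proof -
  have m0: "0 < real m" using m_ge_1 by simp
  define M where "M = real m + e"
  define R where "R = real m + 2 * e"
  have M: "0 < M" and R: "0 < R" using m0 e_pos by (auto simp: M_def R_def)
  define Y where "Y z = \<beta> z * (prim 1 - prim z)
      + (\<beta> z * (\<kappa> / M * (1 - z powr M)) - (\<beta> z)\<^sup>2 * ((1 - z ^ m) / (2 * real m)) + \<kappa>\<^sup>2 / (2 * R) * z powr R) * (1 / K)
      + z ^ Suc m / real (Suc m)" for z
  have "((\<lambda>z. beta' z * integral {z..1} (level_fun (\<beta> z)) + (1 - \<kappa>) * z ^ m) has_integral (Y 1 - Y 0)) {0..1}"
  proof (rule fundamental_theorem_of_calculus_interior)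
    show "continuous_on {0..1} Y" unfolding Y_def
      using continuous_beta[of 0 1] continuous_powr_nonneg[OF M, of 0 1] continuous_powr_nonneg[OF R, of 0 1] m0
      by (intro continuous_on_add continuous_beta_prim continuous_on_mult continuous_on_diff continuous_on_power
          continuous_on_divide continuous_on_const continuous_on_id) auto
    fix z :: real assume "z \<in> {0<..<1}"
    hence z: "0 < z" "z \<le> 1" by auto
    define a where "a = z powr e"
    define c where "c = z ^ (m-1)"
    have ba: "\<beta> z = \<kappa> * a" by (simp add: \<beta>_def a_def)
    have dM: "((\<lambda>z. z powr M) has_real_derivative M * (a * c)) (at z)"
    proof -
      have "M - 1 = real (m-1) + e" using m_ge_1 by (simp add: M_def of_nat_diff)
      hence "z powr (M - 1) = a * c" using z by (simp only: a_def c_def powr_add powr_realpow mult.commute)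
      thus ?thesis using z by (auto intro!: derivative_eq_intros)
    qed
    have dR: "((\<lambda>z. z powr R) has_real_derivative R * (a * a * c)) (at z)"
    proof -
      have "R - 1 = real (m-1) + (e + e)" using m_ge_1 by (simp add: R_def of_nat_diff)
      hence "z powr (R - 1) = a * a * c" using z by (simp only: a_def c_def powr_add powr_realpow mult.commute)
      thus ?thesis using z by (auto intro!: derivative_eq_intros)
    qed
    have dm: "((\<lambda>z. z ^ m) has_real_derivative real m * c) (at z)"
      unfolding c_def by (auto intro!: derivative_eq_intros)
    have dS: "((\<lambda>z. z ^ Suc m / real (Suc m)) has_real_derivative z ^ m) (at z)"
      by (auto intro!: derivative_eq_intros simp del: power_Suc of_nat_Suc)
    \<comment> \<open>Written in the shape in which the sum, difference and product rules deliver
      the derivative of \<open>Y\<close>, hence the summands \<open>0 - ...\<close>.\<close>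
    define D where "D = beta' z * (prim 1 - prim z) + (0 - z ^ m * z powr (-e)) * \<beta> z
      + (beta' z * (\<kappa> / M * (1 - z powr M)) + \<kappa> / M * (0 - M * (a * c)) * \<beta> z
         - (2 * \<beta> z * beta' z * ((1 - z ^ m) / (2 * real m)) + (0 - real m * c) / (2 * real m) * (\<beta> z)\<^sup>2)
         + \<kappa>\<^sup>2 / (2 * R) * (R * (a * a * c))) * (1 / K)
      + z ^ m"
    have "(Y has_real_derivative D) (at z)"
      unfolding Y_def D_def power2_eq_square
      by (rule DERIV_add DERIV_diff DERIV_mult' DERIV_cdivide DERIV_cmult DERIV_cmult_right beta_deriv[OF z(1)]
          prim_deriv[OF z(1)] dM dR dm dS DERIV_const | rule derivative_eq_intros refl | simp)+
    moreover have "D = beta' z * integral {z..1} (level_fun (\<beta> z)) + (1 - \<kappa>) * z ^ m"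
    proof -
      have 1: "z ^ m * z powr (-e) * \<beta> z = \<kappa> * z ^ m" using z by (simp add: ba a_def powr_minus)
      have 2: "\<kappa> / M * (M * (a * c)) * \<beta> z = \<kappa>\<^sup>2 * (a * a * c)" using M by (simp add: ba power2_eq_square)
      have 3: "real m * c / (2 * real m) * (\<beta> z)\<^sup>2 = \<kappa>\<^sup>2 * (a * a * c) / 2"
        using m0 by (simp add: ba power2_eq_square)
      have 4: "\<kappa>\<^sup>2 / (2 * R) * (R * (a * a * c)) = \<kappa>\<^sup>2 * (a * a * c) / 2" using R by simp
      have 5: "2 * \<beta> z * beta' z * ((1 - z ^ m) / (2 * real m)) = beta' z * (\<beta> z * (1 - z ^ m) / real m)" by simp
      have "D = beta' z * (prim 1 - prim z) - z ^ m * z powr (-e) * \<beta> z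
        + (beta' z * (\<kappa> / M * (1 - z powr M)) - \<kappa> / M * (M * (a * c)) * \<beta> z
         - 2 * \<beta> z * beta' z * ((1 - z ^ m) / (2 * real m)) + real m * c / (2 * real m) * (\<beta> z)\<^sup>2
         + \<kappa>\<^sup>2 / (2 * R) * (R * (a * a * c))) * (1 / K) + z ^ m"
        by (simp add: D_def)
      also have "\<dots> = beta' z * ((prim 1 - prim z)
          + (\<kappa> / M * (1 - z powr M) - \<beta> z * (1 - z ^ m) / real m) * (1 / K)) + (1 - \<kappa>) * z ^ m"
      proof -
        have "b * p - k * q + (b * x - r - b * y + r / 2 + r / 2) * j + q = b * (p + (x - y) * j) + (1 - k) * q"
          for b p k q x r y j :: real by (simp add: algebra_simps)
        thus ?thesis unfolding 1 2 3 4 5 by blast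
      qed
      also have "\<dots> = beta' z * integral {z..1} (level_fun (\<beta> z)) + (1 - \<kappa>) * z ^ m"
        by (simp add: integral_level_fun[OF z] M_def)
      finally show ?thesis .
    qed
    ultimately show "(Y has_vector_derivative beta' z * integral {z..1} (level_fun (\<beta> z)) + (1 - \<kappa>) * z ^ m) (at z)"
      by (simp add: has_real_derivative_iff_has_vector_derivative)
  qed simp
  moreover have "Y 0 = 0" using m0 by (simp add: Y_def \<beta>_def)
  \<comment> \<open>The second summand is the \<beta>-part of the loss, computed in
    \<open>has_integral_beta_sq\<close>, divided by \<open>K\<close>.\<close>
  moreover have "Y 1 = 1 / (real m + 1) + \<kappa>\<^sup>2 / (2 * (real m + 2 * e)) / K"
    by (simp add: Y_def R_def add.commute)
  ultimately show ?thesis by simp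
qed

text \<open>The part of the contribution of \<open>w\<close> to a level that does not depend on
  \<open>b\<close>. The rest is linear in \<open>b\<close>, so integration over the levels up to
  \<open>l w\<close> yields a quadratic in \<open>l w\<close>.\<close>

definition level_gain :: "real \<Rightarrow> real" where "level_gain w = x w * inv_int w + cell_beta w / K"

lemma level_gain_eq:
  "(\<Sum>w\<in>{w\<in>V. b \<le> l w}. x w * inv_int w + (cell_beta w - b * cell_wt w) / K)
     = (\<Sum>w\<in>V. if b \<le> l w then level_gain w - b * (cell_wt w / K) else 0)"
  using finite_V
  by (intro sum.mono_neutral_cong_left) (auto simp: level_gain_def diff_divide_distrib)

text \<open>Integrates \<open>level_min\<close> over the levels from 0 to \<open>\<kappa>\<close>,
  substituting \<open>b = \<beta> z\<close>; this is why the factor \<open>beta' z\<close> is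
  carried along. Type \<open>w\<close> contributes up to level
  \<open>min \<kappa> (l w)\<close>.\<close>

lemma low_levels:
  "1 / (real m + 1) + \<kappa>\<^sup>2 / (2 * (real m + 2 * e)) / K
     \<le> (\<Sum>w\<in>V. level_gain w * min \<kappa> (l w) - cell_wt w / K * (min \<kappa> (l w))\<^sup>2 / 2)
        + (1 - \<kappa>) * integral {0..1} (\<lambda>z. below (\<beta> z) ^ m)"
proof (rule has_integral_le[OF has_integral_level_target])
  have "((\<lambda>z. if \<beta> z \<le> l w then beta' z * (level_gain w - \<beta> z * (cell_wt w / K)) else 0) has_integral
          level_gain w * min \<kappa> (l w) - cell_wt w / K * (min \<kappa> (l w))\<^sup>2 / 2) {0..1}" if w: "w \<in> V" for w
  proof -
    define s where "s = bid_type \<kappa> e (l w)"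
    have s: "0 \<le> s" "s \<le> 1" by (simp_all add: s_def bid_type_bounds)
    have bs: "\<beta> s = min \<kappa> (l w)"
      unfolding s_def \<beta>_def by (rule bid_of_bid_type[OF kappa(1) e_pos l_nonneg[OF w]])
    define G where "G z = level_gain w * \<beta> z - cell_wt w / K / 2 * (\<beta> z)\<^sup>2" for z
    have "((\<lambda>z. beta' z * (level_gain w - \<beta> z * (cell_wt w / K))) has_integral (G s - G 0)) {0..s}"
    proof (rule fundamental_theorem_of_calculus_interior[OF s(1)])
      show "continuous_on {0..s} G" unfolding G_def
        by (intro continuous_on_diff continuous_on_mult continuous_on_const continuous_on_power continuous_beta order_refl)
      fix z assume "z \<in> {0<..<s}"
      hence z: "0 < z" by simp
      have "((\<lambda>z. a * \<beta> z - c * (\<beta> z)\<^sup>2) has_real_derivative a * beta' z - c * (2 * \<beta> z * beta' z)) (at z)" for a c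
        by (auto intro!: derivative_eq_intros beta_deriv[OF z])
      hence "(G has_real_derivative level_gain w * beta' z - cell_wt w / K / 2 * (2 * \<beta> z * beta' z)) (at z)"
        unfolding G_def .
      moreover have "level_gain w * beta' z - cell_wt w / K / 2 * (2 * \<beta> z * beta' z)
          = beta' z * (level_gain w - \<beta> z * (cell_wt w / K))" by (simp add: right_diff_distrib)
      ultimately show "(G has_vector_derivative beta' z * (level_gain w - \<beta> z * (cell_wt w / K))) (at z)"
        by (simp add: has_real_derivative_iff_has_vector_derivative)
    qed
    moreover have "G 0 = 0" by (simp add: G_def \<beta>_def)
    moreover have "G s = level_gain w * min \<kappa> (l w) - cell_wt w / K * (min \<kappa> (l w))\<^sup>2 / 2"
      by (simp add: G_def bs)
    ultimately have "((\<lambda>z. beta' z * (level_gain w - \<beta> z * (cell_wt w / K))) has_integral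
        level_gain w * min \<kappa> (l w) - cell_wt w / K * (min \<kappa> (l w))\<^sup>2 / 2) {0..s}" by simp
    hence "((\<lambda>z. if z \<in> {0..s} then beta' z * (level_gain w - \<beta> z * (cell_wt w / K)) else 0) has_integral
        level_gain w * min \<kappa> (l w) - cell_wt w / K * (min \<kappa> (l w))\<^sup>2 / 2) {0..1}"
      using s by (subst has_integral_restrict) auto
    thus ?thesis
    proof (rule has_integral_eq[rotated])
      fix z :: real assume "z \<in> {0..1}"
      hence "\<beta> z \<le> l w \<longleftrightarrow> z \<in> {0..s}"
        using bid_le_iff[OF kappa(1) e_pos, of z "l w"] l_nonneg[OF w] by (simp add: \<beta>_def s_def)
      thus "(if z \<in> {0..s} then beta' z * (level_gain w - \<beta> z * (cell_wt w / K)) else 0)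
          = (if \<beta> z \<le> l w then beta' z * (level_gain w - \<beta> z * (cell_wt w / K)) else 0)" by simp
    qed
  qed
  thus "((\<lambda>z. (\<Sum>w\<in>V. if \<beta> z \<le> l w then beta' z * (level_gain w - \<beta> z * (cell_wt w / K)) else 0)
           + (1 - \<kappa>) * below (\<beta> z) ^ m) has_integral
       (\<Sum>w\<in>V. level_gain w * min \<kappa> (l w) - cell_wt w / K * (min \<kappa> (l w))\<^sup>2 / 2)
        + (1 - \<kappa>) * integral {0..1} (\<lambda>z. below (\<beta> z) ^ m)) {0..1}"
    by (intro has_integral_add has_integral_sum finite_V has_integral_mult_right integrable_integral
        below_beta_integrable)
  fix z :: real assume z: "z \<in> {0..1}"
  show "beta' z * integral {z..1} (level_fun (\<beta> z)) + (1 - \<kappa>) * z ^ m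
      \<le> (\<Sum>w\<in>V. if \<beta> z \<le> l w then beta' z * (level_gain w - \<beta> z * (cell_wt w / K)) else 0)
           + (1 - \<kappa>) * below (\<beta> z) ^ m"
  proof (cases "z = 0")
    case True
    have "0 \<le> (1 - \<kappa>) * below (\<beta> 0) ^ m"
      using kappa below_nonneg by (intro mult_nonneg_nonneg zero_le_power) auto
    thus ?thesis using True m_ge_1 by (simp add: beta'_0 power_0_left sum.neutral)
  next
    case False
    hence z: "0 < z" "z \<le> 1" using z by auto
    have b: "0 < \<beta> z" using z kappa by (simp add: \<beta>_def)
    have "beta' z * integral {z..1} (level_fun (\<beta> z)) + (1 - \<kappa>) * z ^ m
        \<le> beta' z * integral {below (\<beta> z)..1} (level_fun (\<beta> z)) + (1 - \<kappa>) * below (\<beta> z) ^ m"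
      by (rule level_min[OF z level_sum_ge(2)[OF b] below_le_1])
    also have "\<dots> \<le> beta' z * (\<Sum>w\<in>V. if \<beta> z \<le> l w then level_gain w - \<beta> z * (cell_wt w / K) else 0)
        + (1 - \<kappa>) * below (\<beta> z) ^ m"
      using level_sum_ge(1)[OF b] beta'_nonneg unfolding level_gain_eq by (intro add_right_mono mult_left_mono)
    also have "beta' z * (\<Sum>w\<in>V. if \<beta> z \<le> l w then level_gain w - \<beta> z * (cell_wt w / K) else 0)
        = (\<Sum>w\<in>V. if \<beta> z \<le> l w then beta' z * (level_gain w - \<beta> z * (cell_wt w / K)) else 0)"
      unfolding sum_distrib_left by (intro sum.cong) auto
    finally show ?thesis .
  qed
qed

text \<open>Bids above the highest equilibrium bid \<open>\<kappa>\<close>.\<close>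

lemma high_levels:
  "0 \<le> (\<Sum>w\<in>V. level_gain w * (l w - min \<kappa> (l w)) - cell_wt w / K * ((l w)\<^sup>2 - (min \<kappa> (l w))\<^sup>2) / 2)"
proof (rule has_integral_nonneg)
  have "((\<lambda>b. if b \<le> l w then level_gain w - b * (cell_wt w / K) else 0) has_integral
          level_gain w * (l w - min \<kappa> (l w)) - cell_wt w / K * ((l w)\<^sup>2 - (min \<kappa> (l w))\<^sup>2) / 2) {\<kappa>..Bmax}"
    if w: "w \<in> V" for w
  proof (cases "\<kappa> \<le> l w")
    case True
    define G where "G b = level_gain w * b - cell_wt w / K / 2 * b\<^sup>2" for b
    have "((\<lambda>b. level_gain w - b * (cell_wt w / K)) has_integral (G (l w) - G \<kappa>)) {\<kappa>..l w}"
    proof (rule fundamental_theorem_of_calculus[OF True])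
      fix b
      have "((\<lambda>b. a * b - c * b\<^sup>2) has_real_derivative a - c * (2 * b)) (at b)" for a c
        by (auto intro!: derivative_eq_intros)
      hence "(G has_real_derivative level_gain w - cell_wt w / K / 2 * (2 * b)) (at b)" unfolding G_def .
      thus "(G has_vector_derivative level_gain w - b * (cell_wt w / K)) (at b within {\<kappa>..l w})"
        by (simp add: has_real_derivative_iff_has_vector_derivative has_vector_derivative_at_within mult.commute)
    qed
    hence "((\<lambda>b. if b \<in> {\<kappa>..l w} then level_gain w - b * (cell_wt w / K) else 0) has_integral (G (l w) - G \<kappa>)) {\<kappa>..Bmax}"
      using l_le[OF w] by (subst has_integral_restrict) auto
    hence "((\<lambda>b. if b \<le> l w then level_gain w - b * (cell_wt w / K) else 0) has_integral (G (l w) - G \<kappa>)) {\<kappa>..Bmax}"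
      by (rule has_integral_eq[rotated]) auto
    moreover have "G (l w) - G \<kappa> = level_gain w * (l w - min \<kappa> (l w)) - cell_wt w / K * ((l w)\<^sup>2 - (min \<kappa> (l w))\<^sup>2) / 2"
      using True by (simp add: G_def min_def right_diff_distrib diff_divide_distrib)
    ultimately show ?thesis by simp
  next
    case False
    have "((\<lambda>b. if b \<le> l w then level_gain w - b * (cell_wt w / K) else 0) has_integral 0) {\<kappa>..Bmax}"
      using False by (intro has_integral_is_0) auto
    thus ?thesis using False by (simp add: min_def)
  qed
  thus "((\<lambda>b. \<Sum>w\<in>V. if b \<le> l w then level_gain w - b * (cell_wt w / K) else 0) has_integral
     (\<Sum>w\<in>V. level_gain w * (l w - min \<kappa> (l w)) - cell_wt w / K * ((l w)\<^sup>2 - (min \<kappa> (l w))\<^sup>2) / 2)) {\<kappa>..Bmax}"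
    by (intro has_integral_sum finite_V)
  fix b assume b: "b \<in> {\<kappa>..Bmax}"
  hence b0: "0 < b" using kappa by simp
  have "0 \<le> integral {below b..1} (level_fun b)" using b level_sum_ge(2)[OF b0] by (intro level_nonneg) auto
  also note level_sum_ge(1)[OF b0, unfolded level_gain_eq]
  finally show "0 \<le> (\<Sum>w\<in>V. if b \<le> l w then level_gain w - b * (cell_wt w / K) else 0)" .
qed

lemma has_integral_beta_sq:
  "((\<lambda>\<theta>. \<theta> ^ (m-1) * ((\<beta> \<theta>)\<^sup>2 / 2)) has_integral \<kappa>\<^sup>2 / (2 * (real m + 2 * e))) {0..1}"
proof -
  define R where "R = real m + 2 * e"
  have R: "0 < R" unfolding R_def using m_ge_1 e_pos by (intro add_pos_pos) auto
  have "((\<lambda>\<theta>. \<theta> ^ (m-1) * ((\<beta> \<theta>)\<^sup>2 / 2)) has_integral \<kappa>\<^sup>2 / (2 * R) * 1 powr R - \<kappa>\<^sup>2 / (2 * R) * 0 powr R) {0..1}"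
  proof (rule fundamental_theorem_of_calculus_interior)
    show "continuous_on {0..1} (\<lambda>t. \<kappa>\<^sup>2 / (2 * R) * t powr R)"
      by (intro continuous_on_mult continuous_on_const continuous_powr_nonneg R order_refl)
    fix t :: real assume "t \<in> {0<..<1}"
    hence t: "0 < t" by simp
    have "((\<lambda>t. c * t powr R) has_real_derivative c * (R * t powr (R - 1))) (at t)" for c
      using t by (auto intro!: derivative_eq_intros)
    moreover have "R - 1 = real (m-1) + (e + e)" using m_ge_1 by (simp add: R_def of_nat_diff)
    hence "t powr (R - 1) = t ^ (m-1) * (t powr e * t powr e)" using t by (simp only: powr_add powr_realpow)
    hence "\<kappa>\<^sup>2 / (2 * R) * (R * t powr (R - 1)) = t ^ (m-1) * ((\<beta> t)\<^sup>2 / 2)"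
      using R by (simp add: \<beta>_def power2_eq_square)
    ultimately show "((\<lambda>t. \<kappa>\<^sup>2 / (2 * R) * t powr R) has_vector_derivative t ^ (m-1) * ((\<beta> t)\<^sup>2 / 2)) (at t)"
      by (metis has_real_derivative_iff_has_vector_derivative)
  qed simp
  thus ?thesis by (simp add: R_def)
qed

text \<open>The gain from bidding \<open>\<beta> \<theta>\<close>, divided by the valuation
  \<open>v\<close>; \<open>(v - \<beta> \<theta>) / v\<close> is the constant
  \<open>1 - \<kappa>\<close>.\<close>

definition first_price_rate :: "real \<Rightarrow> real" where
  "first_price_rate \<theta> = (1 - \<kappa>) * below (\<beta> \<theta>) ^ m - x (cell \<theta>) + x (cell \<theta>) * l (cell \<theta>) / valuation \<alpha> \<theta>"

lemma has_integral_first_price_rate: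
  "(first_price_rate has_integral (1 - \<kappa>) * integral {0..1} (\<lambda>z. below (\<beta> z) ^ m)
     - (\<Sum>w\<in>V. mass w * x w) + (\<Sum>w\<in>V. x w * l w * inv_int w)) {0..1}"
  unfolding first_price_rate_def[abs_def]
  using has_integral_ratio[of "\<lambda>w. x w * l w"] l_0
  by (intro has_integral_add has_integral_diff has_integral_mult_right has_integral_cells_const
      integrable_integral below_beta_integrable) auto

text \<open>Expanding the square writes the loss as \<open>S + C\<close>, where \<open>C\<close> is
  free of \<open>l\<close>. Low and high levels together give \<open>L - S / K\<close>; the constant
  \<open>1 / (m + 1)\<close> from the low levels pays for the total winning probability.\<close>

lemma loss_le_first_price_rate:
  assumes x_sum: "(\<Sum>w\<in>V. mass w * x w) \<le> 1 / (real m + 1)"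
  shows "integral {0..1} (\<lambda>\<theta>. \<theta> ^ (m-1) * ((l (cell \<theta>) - \<beta> \<theta>)\<^sup>2 / 2)) \<le> K * integral {0..1} first_price_rate"
proof -
  define C where "C = \<kappa>\<^sup>2 / (2 * (real m + 2 * e))"
  define Q where "Q = integral {0..1} (\<lambda>z. below (\<beta> z) ^ m)"
  define S where "S = (\<Sum>w\<in>V. (l w)\<^sup>2 / 2 * cell_wt w - l w * cell_beta w)"
  define L where "L = (\<Sum>w\<in>V. x w * l w * inv_int w)"
  have "((\<lambda>\<theta>. (l (cell \<theta>))\<^sup>2 / 2 * \<theta> ^ (m-1) - l (cell \<theta>) * (\<theta> ^ (m-1) * \<beta> \<theta>)) has_integral S) {0..1}"
    unfolding S_def
    by (rule has_integral_cells[of "\<lambda>w \<theta>. (l w)\<^sup>2 / 2 * \<theta> ^ (m-1) - l w * (\<theta> ^ (m-1) * \<beta> \<theta>)"])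
      (intro has_integral_diff has_integral_mult_right cell_wt cell_beta)
  hence "((\<lambda>\<theta>. (l (cell \<theta>))\<^sup>2 / 2 * \<theta> ^ (m-1) - l (cell \<theta>) * (\<theta> ^ (m-1) * \<beta> \<theta>)
      + \<theta> ^ (m-1) * ((\<beta> \<theta>)\<^sup>2 / 2)) has_integral S + C) {0..1}"
    unfolding C_def by (intro has_integral_add has_integral_beta_sq)
  moreover have "(l (cell \<theta>))\<^sup>2 / 2 * \<theta> ^ (m-1) - l (cell \<theta>) * (\<theta> ^ (m-1) * \<beta> \<theta>) + \<theta> ^ (m-1) * ((\<beta> \<theta>)\<^sup>2 / 2)
      = \<theta> ^ (m-1) * ((l (cell \<theta>) - \<beta> \<theta>)\<^sup>2 / 2)" for \<theta>
  proof -
    have "a\<^sup>2 / 2 * c - a * (c * b) + c * (b\<^sup>2 / 2) = c * ((a - b)\<^sup>2 / 2)" for a b c :: real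
      by (simp add: power2_eq_square field_simps)
    thus ?thesis by blast
  qed
  ultimately have "((\<lambda>\<theta>. \<theta> ^ (m-1) * ((l (cell \<theta>) - \<beta> \<theta>)\<^sup>2 / 2)) has_integral S + C) {0..1}"
    by (simp only:)
  hence loss: "integral {0..1} (\<lambda>\<theta>. \<theta> ^ (m-1) * ((l (cell \<theta>) - \<beta> \<theta>)\<^sup>2 / 2)) = S + C"
    by (rule integral_unique)
  have "(\<Sum>w\<in>V. level_gain w * min \<kappa> (l w) - cell_wt w / K * (min \<kappa> (l w))\<^sup>2 / 2)
      + (\<Sum>w\<in>V. level_gain w * (l w - min \<kappa> (l w)) - cell_wt w / K * ((l w)\<^sup>2 - (min \<kappa> (l w))\<^sup>2) / 2)
      = L - S / K"
  proof -
    have "(g + P / K) * y - W / K * y\<^sup>2 / 2 + ((g + P / K) * (z - y) - W / K * (z\<^sup>2 - y\<^sup>2) / 2)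
        = g * z - (z\<^sup>2 / 2 * W - z * P) / K" for g P y W z :: real
      using K_pos by (simp add: field_simps)
    hence "level_gain w * min \<kappa> (l w) - cell_wt w / K * (min \<kappa> (l w))\<^sup>2 / 2
        + (level_gain w * (l w - min \<kappa> (l w)) - cell_wt w / K * ((l w)\<^sup>2 - (min \<kappa> (l w))\<^sup>2) / 2)
        = x w * inv_int w * l w - ((l w)\<^sup>2 / 2 * cell_wt w - l w * cell_beta w) / K" for w
      unfolding level_gain_def by blast
    hence "(\<Sum>w\<in>V. level_gain w * min \<kappa> (l w) - cell_wt w / K * (min \<kappa> (l w))\<^sup>2 / 2)
      + (\<Sum>w\<in>V. level_gain w * (l w - min \<kappa> (l w)) - cell_wt w / K * ((l w)\<^sup>2 - (min \<kappa> (l w))\<^sup>2) / 2)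
      = (\<Sum>w\<in>V. x w * inv_int w * l w - ((l w)\<^sup>2 / 2 * cell_wt w - l w * cell_beta w) / K)"
      unfolding sum.distrib[symmetric] by simp
    also have "\<dots> = L - S / K"
      unfolding L_def S_def sum_divide_distrib sum_subtractf[symmetric]
      by (intro sum.cong) (simp_all add: mult.commute mult.left_commute)
    finally show ?thesis .
  qed
  hence "1 / (real m + 1) + C / K \<le> L - S / K + (1 - \<kappa>) * Q"
    using low_levels high_levels unfolding C_def Q_def by linarith
  moreover have "integral {0..1} first_price_rate = (1 - \<kappa>) * Q - (\<Sum>w\<in>V. mass w * x w) + L"
    unfolding Q_def L_def by (rule integral_unique[OF has_integral_first_price_rate])
  ultimately have "(S + C) / K \<le> integral {0..1} first_price_rate"
    using x_sum by (simp add: add_divide_distrib)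
  thus ?thesis unfolding loss using K_pos by (simp add: divide_le_eq mult.commute)
qed

end

section \<open>Winning probabilities and deviations\<close>

lemma highest_bidders_subset: "highest_bidders N b \<subseteq> {..<N}"
  by (auto simp: highest_bidders_def is_arg_max_def)

lemma finite_highest_bidders: "finite (highest_bidders N b)"
  using highest_bidders_subset finite_subset by blast

lemma highest_bidders_nonempty:
  assumes "1 \<le> N" shows "highest_bidders N b \<noteq> {}"
proof -
  have "0 \<in> {..<N}" using assms by simp
  hence fin: "finite (b ` {..<N})" "b ` {..<N} \<noteq> {}" by blast+
  obtain i where "i < N" "b i = Max (b ` {..<N})" using Max_in[OF fin] by auto
  hence "i \<in> highest_bidders N b"
    using fin by (auto simp: highest_bidders_def is_arg_max_def not_less)
  thus ?thesis by blast
qed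

lemma allocation_cong:
  assumes "\<And>j. j < N \<Longrightarrow> b j = b' j" shows "allocation N b i = allocation N b' i"
proof -
  have "highest_bidders N b = highest_bidders N b'"
    using assms by (auto simp: highest_bidders_def is_arg_max_def)
  thus ?thesis by (simp add: allocation_def)
qed

lemma allocation_nonneg: "0 \<le> allocation N b i"
  by (simp add: allocation_def)

lemma allocation_le_1: "allocation N b i \<le> 1"
proof (cases "i \<in> highest_bidders N b")
  case True
  hence "1 \<le> card (highest_bidders N b)"
    using finite_highest_bidders[of N b] by (metis One_nat_def Suc_leI card_gt_0_iff empty_iff)
  thus ?thesis using True by (simp add: allocation_def)
qed (simp add: allocation_def)

lemma sum_allocation_on:
  assumes "1 \<le> N" "highest_bidders N b \<subseteq> S" "S \<subseteq> {..<N}"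
  shows "(\<Sum>i\<in>S. allocation N b i) = 1"
proof -
  have "(\<Sum>i\<in>S. allocation N b i) = (\<Sum>i\<in>highest_bidders N b. 1 / real (card (highest_bidders N b)))"
    using assms finite_subset[OF assms(3)] by (intro sum.mono_neutral_cong_right) (auto simp: allocation_def)
  also have "\<dots> = 1"
    using highest_bidders_nonempty[OF assms(1), of b] finite_highest_bidders[of N b] by simp
  finally show ?thesis .
qed

lemma allocation_eq_1:
  assumes "i < N" "\<And>j. j < N \<Longrightarrow> j \<noteq> i \<Longrightarrow> b j < b i"
  shows "allocation N b i = 1"
proof -
  have "highest_bidders N b = {i}"
    using assms by (auto simp: highest_bidders_def is_arg_max_def) (metis less_irrefl not_less_iff_gr_or_eq)+
  thus ?thesis by (simp add: allocation_def)
qed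

lemma allocation_all_equal:
  assumes "i < N" "\<And>j. j < N \<Longrightarrow> b j = c"
  shows "allocation N b i = 1 / real N"
proof -
  have "highest_bidders N b = {..<N}"
    using assms(2) by (auto simp: highest_bidders_def is_arg_max_def)
  thus ?thesis using assms(1) by (simp add: allocation_def)
qed

lemma expectation_pair_pmf:
  fixes f :: "'a \<times> 'b \<Rightarrow> real"
  assumes "finite (set_pmf p)" "finite (set_pmf q)"
  shows "measure_pmf.expectation (pair_pmf p q) f
           = (\<Sum>a\<in>set_pmf p. pmf p a * measure_pmf.expectation q (\<lambda>b. f (a, b)))"
proof -
  have "measure_pmf.expectation (pair_pmf p q) f = (\<Sum>x\<in>set_pmf p \<times> set_pmf q. f x * pmf (pair_pmf p q) x)"
    using assms by (intro integral_measure_pmf_real) auto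
  also have "\<dots> = (\<Sum>a\<in>set_pmf p. \<Sum>b\<in>set_pmf q. f (a, b) * (pmf p a * pmf q b))"
    by (auto simp: sum.cartesian_product pmf_pair intro!: sum.cong)
  also have "\<dots> = (\<Sum>a\<in>set_pmf p. pmf p a * (\<Sum>b\<in>set_pmf q. f (a, b) * pmf q b))"
    by (simp add: sum_distrib_left mult.left_commute)
  also have "\<dots> = (\<Sum>a\<in>set_pmf p. pmf p a * measure_pmf.expectation q (\<lambda>b. f (a, b)))"
    using assms by (intro sum.cong refl arg_cong2[of _ _ _ _ "(*)"] integral_measure_pmf_real[symmetric]) auto
  finally show ?thesis .
qed

section \<open>Interim winning probabilities under the product prior\<close>

locale auction_grid = type_grid +
  fixes F :: "real pmf" and N :: nat
  assumes F_sub: "set_pmf F \<subseteq> V" and pmf_F: "v \<in> V \<Longrightarrow> pmf F v = mass v" and N_ge_1: "1 \<le> N"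
begin

abbreviation types :: "nat set \<Rightarrow> (nat \<Rightarrow> real) pmf" where
  "types J \<equiv> Pi_pmf J 0 (\<lambda>_. F)"

lemma finite_types: "finite J \<Longrightarrow> finite (set_pmf (types J))"
  using finite_subset[OF F_sub finite_V] by (auto simp: set_Pi_pmf)

lemma types_integrable: "finite J \<Longrightarrow> integrable (measure_pmf (types J)) f" for f :: "_ \<Rightarrow> real"
  by (intro integrable_measure_pmf_finite finite_types)

lemma prob_F: "A \<subseteq> V \<Longrightarrow> measure_pmf.prob F A = sum mass A"
  using finite_subset[OF _ finite_V] pmf_F by (subst measure_measure_pmf_finite) (auto intro!: sum.cong)

lemma prob_types: "finite J \<Longrightarrow> A \<subseteq> V \<Longrightarrow> measure_pmf.prob (types J) (Pi J (\<lambda>_. A)) = sum mass A ^ card J"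
  by (simp add: measure_Pi_pmf_Pi prob_F)

text \<open>The update at \<open>i\<close> overrides the default type that \<open>types\<close>
  assigns to this index.\<close>

definition win :: "(real \<Rightarrow> real) \<Rightarrow> nat \<Rightarrow> real \<Rightarrow> real" where
  "win s i b = measure_pmf.expectation (types ({..<N} - {i})) (\<lambda>v. allocation N ((\<lambda>j. s (v j))(i := b)) i)"

lemma win_nonneg: "0 \<le> win s i b"
  unfolding win_def using allocation_nonneg by (intro integral_nonneg_AE) auto

lemma win_le_1: "win s i b \<le> 1"
proof -
  have "win s i b \<le> measure_pmf.expectation (types ({..<N} - {i})) (\<lambda>_. 1)"
    unfolding win_def using allocation_le_1 by (intro integral_mono types_integrable) auto
  thus ?thesis by simp
qed

lemma expectation_ge_prob:
  fixes c :: real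
  assumes "finite J" "\<And>v. c * indicator A v \<le> f v"
  shows "c * measure_pmf.prob (types J) A \<le> measure_pmf.expectation (types J) f"
proof -
  have "measure_pmf.expectation (types J) (\<lambda>v. c * indicator A v) \<le> measure_pmf.expectation (types J) f"
    using assms by (intro integral_mono types_integrable) auto
  thus ?thesis by simp
qed

text \<open>Counts only the event that all opponents bid strictly less, so ties do not
  interfere.\<close>

lemma win_ge:
  assumes "i < N"
  shows "(\<Sum>w\<in>{w\<in>V. s w < b}. mass w) ^ (N - 1) \<le> win s i b"
proof -
  let ?J = "{..<N} - {i}" and ?A = "{w\<in>V. s w < b}"
  have "1 * measure_pmf.prob (types ?J) (Pi ?J (\<lambda>_. ?A)) \<le> win s i b"
    unfolding win_def
  proof (rule expectation_ge_prob)
    fix v :: "nat \<Rightarrow> real"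
    show "1 * indicator (Pi ?J (\<lambda>_. ?A)) v \<le> allocation N ((\<lambda>j. s (v j))(i := b)) i"
    proof (cases "v \<in> Pi ?J (\<lambda>_. ?A)")
      case True
      hence "allocation N ((\<lambda>j. s (v j))(i := b)) i = 1" using assms by (intro allocation_eq_1) auto
      thus ?thesis using True by simp
    qed (simp add: allocation_nonneg)
  qed simp
  moreover have "card ?J = N - 1" using assms by simp
  ultimately show ?thesis using prob_types[of ?J ?A] by (simp add: Collect_mono)
qed

text \<open>With positive probability all opponents have type \<open>w\<close> as well, and the tie
  gives \<open>1 / N\<close>.\<close>

lemma win_own_pos:
  assumes "i < N" "w \<in> V" shows "0 < win s i (s w)"
proof -
  let ?J = "{..<N} - {i}"
  have "1 / real N * measure_pmf.prob (types ?J) (Pi ?J (\<lambda>_. {w})) \<le> win s i (s w)"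
    unfolding win_def
  proof (rule expectation_ge_prob)
    fix v :: "nat \<Rightarrow> real"
    show "1 / real N * indicator (Pi ?J (\<lambda>_. {w})) v \<le> allocation N ((\<lambda>j. s (v j))(i := s w)) i"
    proof (cases "v \<in> Pi ?J (\<lambda>_. {w})")
      case True
      hence "allocation N ((\<lambda>j. s (v j))(i := s w)) i = 1 / real N"
        using assms by (intro allocation_all_equal[of _ _ _ "s w"]) auto
      thus ?thesis using True by simp
    qed (simp add: allocation_nonneg)
  qed simp
  moreover have "0 < measure_pmf.prob (types ?J) (Pi ?J (\<lambda>_. {w}))"
    using prob_types[of ?J "{w}"] mass_pos[of w] assms by simp
  ultimately show ?thesis using N_ge_1
    by (smt (verit) divide_pos_pos mult_pos_pos of_nat_0_less_iff less_le_trans zero_less_one of_nat_1 of_nat_le_iff)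
qed

text \<open>Averaging over buyers avoids a proof that \<open>win\<close> does not depend on
  \<open>i\<close>. This suffices since gains are affine in the winning probability.\<close>

definition interim :: "(real \<Rightarrow> real) \<Rightarrow> real \<Rightarrow> real" where
  "interim s w = (\<Sum>i<N. win s i (s w)) / real N"

text \<open>The type of \<open>i\<close> is drawn first, independently of the opponents.\<close>

lemma sum_win:
  assumes i: "i < N" and A: "A \<subseteq> V"
  shows "(\<Sum>w\<in>A. mass w * win s i (s w))
    = measure_pmf.expectation (types {..<N}) (\<lambda>v. allocation N (\<lambda>j. s (v j)) i * of_bool (v i \<in> A))"
proof -
  let ?J = "{..<N} - {i}"
  have "insert i ?J = {..<N}" using i by auto
  hence "types {..<N} = map_pmf (\<lambda>(y, f). f(i := y)) (pair_pmf F (types ?J))"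
    using Pi_pmf_insert[of ?J i 0 "\<lambda>_. F"] by simp
  hence "measure_pmf.expectation (types {..<N}) (\<lambda>v. allocation N (\<lambda>j. s (v j)) i * of_bool (v i \<in> A))
      = measure_pmf.expectation (pair_pmf F (types ?J))
          (\<lambda>(y, f). allocation N (\<lambda>j. s ((f(i := y)) j)) i * of_bool (y \<in> A))"
    by (simp add: case_prod_unfold)
  also have "\<dots> = (\<Sum>y\<in>set_pmf F. pmf F y * measure_pmf.expectation (types ?J)
          (\<lambda>f. allocation N (\<lambda>j. s ((f(i := y)) j)) i * of_bool (y \<in> A)))"
    using finite_subset[OF F_sub finite_V] finite_types[of ?J] by (subst expectation_pair_pmf) auto
  also have "\<dots> = (\<Sum>y\<in>set_pmf F. pmf F y * (win s i (s y) * of_bool (y \<in> A)))"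
  proof -
    have "(\<lambda>j. s ((f(i := y)) j)) = (\<lambda>j. s (f j))(i := s y)" for f y by auto
    thus ?thesis by (simp add: win_def)
  qed
  also have "\<dots> = (\<Sum>y\<in>V. pmf F y * (win s i (s y) * of_bool (y \<in> A)))"
    using finite_V F_sub by (intro sum.mono_neutral_left) (auto simp: set_pmf_eq)
  also have "\<dots> = (\<Sum>w\<in>A. mass w * win s i (s w))"
    using finite_V A pmf_F by (intro sum.mono_neutral_cong_right) auto
  finally show ?thesis by simp
qed

lemma sum_interim:
  assumes "A \<subseteq> V"
  shows "(\<Sum>w\<in>A. mass w * interim s w) = measure_pmf.expectation (types {..<N})
           (\<lambda>v. \<Sum>i<N. allocation N (\<lambda>j. s (v j)) i * of_bool (v i \<in> A)) / real N"
proof -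
  have "(\<Sum>w\<in>A. mass w * interim s w) = (\<Sum>w\<in>A. \<Sum>i<N. mass w * win s i (s w)) / real N"
    unfolding interim_def by (simp add: sum_distrib_left sum_divide_distrib)
  also have "(\<Sum>w\<in>A. \<Sum>i<N. mass w * win s i (s w)) = (\<Sum>i<N. \<Sum>w\<in>A. mass w * win s i (s w))"
    by (rule sum.swap)
  also have "\<dots> = (\<Sum>i<N. measure_pmf.expectation (types {..<N})
      (\<lambda>v. allocation N (\<lambda>j. s (v j)) i * of_bool (v i \<in> A)))"
    using sum_win assms by (intro sum.cong) auto
  also have "\<dots> = measure_pmf.expectation (types {..<N})
      (\<lambda>v. \<Sum>i<N. allocation N (\<lambda>j. s (v j)) i * of_bool (v i \<in> A))"
    by (intro Bochner_Integration.integral_sum[symmetric] types_integrable) auto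
  finally show ?thesis .
qed

lemma sum_interim_total: "(\<Sum>w\<in>V. mass w * interim s w) \<le> 1 / real N"
proof -
  have "measure_pmf.expectation (types {..<N})
      (\<lambda>v. \<Sum>i<N. allocation N (\<lambda>j. s (v j)) i * of_bool (v i \<in> V))
    \<le> measure_pmf.expectation (types {..<N}) (\<lambda>_. 1)"
  proof (intro integral_mono types_integrable)
    fix v :: "nat \<Rightarrow> real"
    have "(\<Sum>i<N. allocation N (\<lambda>j. s (v j)) i * of_bool (v i \<in> V)) \<le> (\<Sum>i<N. allocation N (\<lambda>j. s (v j)) i)"
      using allocation_nonneg by (intro sum_mono) simp
    also have "\<dots> = 1" using N_ge_1 highest_bidders_subset by (intro sum_allocation_on) auto
    finally show "(\<Sum>i<N. allocation N (\<lambda>j. s (v j)) i * of_bool (v i \<in> V)) \<le> 1" .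
  qed auto
  thus ?thesis unfolding sum_interim[OF order_refl] by (intro divide_right_mono) auto
qed

text \<open>
  If every type is in \<open>A\<close> or bids below \<open>b\<close>, and not all types bid below \<open>b\<close>, then the winner has
  a type in \<open>A\<close>.
\<close>

lemma interim_prefix:
  assumes A: "A \<subseteq> {w\<in>V. b \<le> s w}"
  defines "h \<equiv> \<Sum>w\<in>{w\<in>V. s w < b}. mass w"
  shows "((h + sum mass A) ^ N - h ^ N) / real N \<le> (\<Sum>w\<in>A. mass w * interim s w)"
proof -
  let ?L = "{w\<in>V. s w < b}"
  have AV: "A \<subseteq> V" using A by auto
  have hA: "h + sum mass A = sum mass (?L \<union> A)"
    unfolding h_def using finite_V finite_subset[OF AV finite_V] A by (subst sum.union_disjoint) force+
  have P: "measure_pmf.prob (types {..<N}) (Pi {..<N} (\<lambda>_. S)) = sum mass S ^ N" if "S \<subseteq> V" for S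
    using prob_types[of "{..<N}" S] that by simp
  have "(h + sum mass A) ^ N - h ^ N
      = measure_pmf.expectation (types {..<N})
          (\<lambda>v. indicator (Pi {..<N} (\<lambda>_. ?L \<union> A)) v - indicator (Pi {..<N} (\<lambda>_. ?L)) v)"
    unfolding hA unfolding h_def using P[of "?L \<union> A"] P[of ?L] AV
    by (subst Bochner_Integration.integral_diff) (auto intro!: types_integrable)
  also have "\<dots> \<le> measure_pmf.expectation (types {..<N})
      (\<lambda>v. \<Sum>i<N. allocation N (\<lambda>j. s (v j)) i * of_bool (v i \<in> A))"
  proof (intro integral_mono types_integrable)
    fix v :: "nat \<Rightarrow> real"
    have nonneg: "0 \<le> (\<Sum>i<N. allocation N (\<lambda>j. s (v j)) i * of_bool (v i \<in> A))"
      using allocation_nonneg by (intro sum_nonneg) simp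
    show "indicator (Pi {..<N} (\<lambda>_. ?L \<union> A)) v - indicator (Pi {..<N} (\<lambda>_. ?L)) v
        \<le> (\<Sum>i<N. allocation N (\<lambda>j. s (v j)) i * of_bool (v i \<in> A))"
    proof (cases "v \<in> Pi {..<N} (\<lambda>_. ?L \<union> A) \<and> v \<notin> Pi {..<N} (\<lambda>_. ?L)")
      case True
      then obtain k where k: "k < N" "v k \<in> A" by auto
      hence bk: "b \<le> s (v k)" using A by auto
      let ?S = "{i\<in>{..<N}. v i \<in> A}"
      have "highest_bidders N (\<lambda>j. s (v j)) \<subseteq> ?S"
      proof
        fix i assume "i \<in> highest_bidders N (\<lambda>j. s (v j))"
        hence i: "i < N" "\<not> s (v i) < s (v k)"
          using k by (auto simp: highest_bidders_def is_arg_max_def)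
        hence "v i \<notin> ?L" using bk by auto
        thus "i \<in> ?S" using True i by auto
      qed
      hence "(\<Sum>i\<in>?S. allocation N (\<lambda>j. s (v j)) i) = 1" using N_ge_1 by (intro sum_allocation_on) auto
      moreover have "(\<Sum>i<N. allocation N (\<lambda>j. s (v j)) i * of_bool (v i \<in> A)) = (\<Sum>i\<in>?S. allocation N (\<lambda>j. s (v j)) i)"
        by (intro sum.mono_neutral_cong_right) auto
      ultimately show ?thesis by (auto simp: indicator_def)
    next
      case False
      hence "indicator (Pi {..<N} (\<lambda>_. ?L \<union> A)) v \<le> (indicator (Pi {..<N} (\<lambda>_. ?L)) v :: real)"
        by (auto simp: indicator_def)
      thus ?thesis using nonneg by linarith
    qed
  qed auto
  finally show ?thesis unfolding sum_interim[OF AV] by (intro divide_right_mono) auto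
qed

section \<open>Interim utilities and the equilibrium condition\<close>

fun exp_utility :: "auction_format \<Rightarrow> (real \<Rightarrow> real) \<Rightarrow> nat \<Rightarrow> real \<Rightarrow> real \<Rightarrow> real" where
  "exp_utility First_Price s i b w = win s i b * (w - b)"
| "exp_utility All_Pay s i b w = win s i b * w - b"

lemma expectation_utility:
  "measure_pmf.expectation (types ({..<N} - {i})) (\<lambda>v. utility fmt N i ((\<lambda>j. s (v j))(i := b)) w)
     = exp_utility fmt s i b w"
  by (cases fmt) (simp_all add: win_def types_integrable Bochner_Integration.integral_diff)

lemma utility_cong:
  assumes "\<And>j. j < N \<Longrightarrow> b j = b' j" "i < N" shows "utility fmt N i b w = utility fmt N i b' w"
  using allocation_cong[of N b b' i, OF assms(1)] assms by (cases fmt) auto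

text \<open>The opponents' types are independent of the profile and can be integrated out for each
  profile; by symmetry \<open>l 0\<close> is everyone's strategy.\<close>

lemma BCCE_no_deviation:
  assumes "BCCE fmt N V B F \<sigma>" and fin: "finite (set_pmf \<sigma>)"
    and sym: "\<And>l i j. l \<in> set_pmf \<sigma> \<Longrightarrow> i < N \<Longrightarrow> j < N \<Longrightarrow> l i = l j"
    and i: "i < N" and w: "w \<in> V" and b: "b \<in> B"
  shows "(\<Sum>l\<in>set_pmf \<sigma>. pmf \<sigma> l * (exp_utility fmt (l 0) i b w - exp_utility fmt (l 0) i (l 0 w) w)) \<le> 0"
proof -
  let ?T = "types ({..<N} - {i})"
  have "measure_pmf.expectation (pair_pmf \<sigma> ?T)
          (\<lambda>(l, vo). let bids = (\<lambda>j. l j ((vo(i := w)) j))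
                     in utility fmt N i (bids(i := b)) w - utility fmt N i bids w) \<le> 0"
    using assms unfolding BCCE_def by blast
  moreover have "measure_pmf.expectation ?T
        (\<lambda>vo. let bids = (\<lambda>j. l j ((vo(i := w)) j))
              in utility fmt N i (bids(i := b)) w - utility fmt N i bids w)
      = exp_utility fmt (l 0) i b w - exp_utility fmt (l 0) i (l 0 w) w" if l: "l \<in> set_pmf \<sigma>" for l
  proof -
    have l0: "l j = l 0" if "j < N" for j using sym[OF l that, of 0] N_ge_1 by simp
    have "utility fmt N i ((\<lambda>j. l j ((vo(i := w)) j))(i := b)) w = utility fmt N i ((\<lambda>j. l 0 (vo j))(i := b)) w" for vo
    proof (rule utility_cong[OF _ i])
      fix j assume "j < N"
      from l0[OF this] show "((\<lambda>j. l j ((vo(i := w)) j))(i := b)) j = ((\<lambda>j. l 0 (vo j))(i := b)) j" by simp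
    qed
    moreover have "utility fmt N i (\<lambda>j. l j ((vo(i := w)) j)) w = utility fmt N i ((\<lambda>j. l 0 (vo j))(i := l 0 w)) w" for vo
    proof (rule utility_cong[OF _ i])
      fix j assume "j < N"
      from l0[OF this] l0[OF i] show "l j ((vo(i := w)) j) = ((\<lambda>j. l 0 (vo j))(i := l 0 w)) j" by simp
    qed
    ultimately show ?thesis unfolding Let_def
      by (simp add: types_integrable Bochner_Integration.integral_diff expectation_utility)
  qed
  ultimately show ?thesis
    using fin finite_types[of "{..<N} - {i}"] by (simp add: expectation_pair_pmf cong: sum.cong)
qed

end

section \<open>From grid deviations to the exact equilibrium bid\<close>

lemma covering_point:
  fixes S :: "real set"
  assumes S: "finite S" "0 \<in> S" and cover: "(SUP w\<in>{0..c}. INF w'\<in>S. \<bar>w - w'\<bar>) \<le> d" and w: "w \<in> {0..c}"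
  obtains w' where "w' \<in> S" "\<bar>w - w'\<bar> \<le> d"
proof -
  have inf: "(INF w'\<in>S. \<bar>u - w'\<bar>) = Min ((\<lambda>w'. \<bar>u - w'\<bar>) ` S)" for u
    using S by (intro cInf_eq_Min) auto
  have "(INF w'\<in>S. \<bar>u - w'\<bar>) \<le> c" if "u \<in> {0..c}" for u
  proof -
    have "(INF w'\<in>S. \<bar>u - w'\<bar>) \<le> \<bar>u - 0\<bar>" unfolding inf using S by (intro Min_le) blast+
    thus ?thesis using that by simp
  qed
  \<comment> \<open>A real supremum bounds its members only if they are bounded above;
    \<open>0 \<in> S\<close> supplies the bound.\<close>
  hence "bdd_above ((\<lambda>w. INF w'\<in>S. \<bar>w - w'\<bar>) ` {0..c})" by (intro bdd_aboveI2[of _ _ c])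
  hence "(INF w'\<in>S. \<bar>w - w'\<bar>) \<le> d" using cSUP_upper[OF w] cover by (meson order_trans)
  moreover have "Min ((\<lambda>w'. \<bar>w - w'\<bar>) ` S) \<in> (\<lambda>w'. \<bar>w - w'\<bar>) ` S"
    using S by (intro Min_in) auto
  ultimately show thesis using that unfolding inf by auto
qed

text \<open>Gain at the exact valuation \<open>v\<close> from the exact bid \<open>b\<close>:
  \<open>q\<close> is the winning probability credited to \<open>b\<close>, while \<open>y\<close>
  and \<open>t\<close> are the current winning probability and bid.\<close>

fun ideal_gain :: "auction_format \<Rightarrow> real \<Rightarrow> real \<Rightarrow> real \<Rightarrow> real \<Rightarrow> real \<Rightarrow> real" where
  "ideal_gain First_Price q b v y t = q * (v - b) - y * (v - t)"
| "ideal_gain All_Pay q b v y t = (q * v - b) - (y * v - t)"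

context auction_grid
begin

text \<open>Passing from \<open>v\<close> to \<open>w\<close> and from \<open>b\<close> to
  \<open>b'\<close> costs at most \<open>2 * d\<close> each, as winning probabilities are at most
  1.\<close>

lemma ideal_gain_le_deviation:
  assumes q: "0 \<le> q" "q \<le> 1" "q \<le> win s i b'" and b: "0 \<le> b" "b \<le> v" "b \<le> b'" "b' \<le> b + 2 * d"
    and w: "0 \<le> w" "w \<le> v" "v \<le> w + 2 * d"
  shows "ideal_gain fmt q b v (win s i (s w)) (s w) \<le> exp_utility fmt s i b' w - exp_utility fmt s i (s w) w + 4 * d"
proof -
  define a y t where "a = win s i b'" and "y = win s i (s w)" and "t = s w"
  have a: "q \<le> a" "a \<le> 1" and y: "0 \<le> y" "y \<le> 1"
    using q win_nonneg win_le_1 by (auto simp: a_def y_def)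
  have d: "0 \<le> d" using w by simp
  have yv: "y * w \<le> y * v" using y w by (intro mult_left_mono)
  show ?thesis
  proof (cases fmt)
    case First_Price
    have "q * (v - b) - 4 * d \<le> a * (w - b')"
    proof (cases "0 \<le> w - b'")
      case True
      have "q * (w - b') \<le> a * (w - b')" using a True by (intro mult_right_mono)
      moreover have "q * (v - b - 4 * d) \<le> q * (w - b')" using q b w by (intro mult_left_mono) auto
      moreover have "q * (4 * d) \<le> 4 * d" using q d by (intro mult_left_le_one_le) auto
      ultimately show ?thesis by (simp add: right_diff_distrib)
    next
      \<comment> \<open>The grid bid exceeds the grid valuation, so winning more often than
        \<open>q\<close> hurts; \<open>a \<le> 1\<close> limits the damage.\<close>
      case False
      have "a * (b' - w) \<le> b' - w" using False a q by (intro mult_left_le_one_le) auto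
      moreover have "q * (v - b) \<le> v - b" using q b by (intro mult_left_le_one_le) auto
      ultimately show ?thesis using b w by (simp add: right_diff_distrib)
    qed
    with yv have "q * (v - b) - y * (v - t) \<le> a * (w - b') - y * (w - t) + 4 * d"
      by (simp add: right_diff_distrib)
    thus ?thesis unfolding First_Price a_def y_def t_def by simp
  next
    case All_Pay
    have "q * w \<le> a * w" using a w by (intro mult_right_mono)
    moreover have "(q - y) * (v - w) \<le> 1 * (v - w)" using q y w by (intro mult_right_mono) auto
    ultimately have "(q * v - b) - (y * v - t) \<le> (a * w - b') - (y * w - t) + 4 * d"
      using b w by (simp add: left_diff_distrib right_diff_distrib)
    thus ?thesis unfolding All_Pay a_def y_def t_def by simp
  qed
qed

text \<open>Bidding 0 never yields negative utility, and the ideal deviation is worth at most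
  \<open>v\<close>. For small \<open>v\<close> this beats the bound \<open>4 * d\<close> and tames
  the weight \<open>1 / v\<close>.\<close>

lemma ideal_gain_le_zero_bid:
  assumes q: "0 \<le> q" "q \<le> 1" and b: "0 \<le> b" "b \<le> v" and w: "0 \<le> w" "w \<le> v"
  shows "ideal_gain fmt q b v (win s i (s w)) (s w) \<le> exp_utility fmt s i 0 w - exp_utility fmt s i (s w) w + v"
proof -
  have 1: "win s i (s w) * w \<le> win s i (s w) * v" and 2: "0 \<le> win s i 0 * w"
    using w win_nonneg by (auto intro: mult_left_mono)
  have 3: "q * (v - b) \<le> v - b" and 4: "q * v \<le> v" using q b by (auto intro!: mult_left_le_one_le)
  show ?thesis
  proof (cases fmt)
    case First_Price
    show ?thesis unfolding First_Price using 1 2 3 b by (simp add: right_diff_distrib)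
  next
    case All_Pay
    show ?thesis unfolding All_Pay using 1 2 4 b by simp
  qed
qed

lemma ideal_gain_average:
  "(\<Sum>i<N. ideal_gain fmt q b v (win s i (s w)) t) = real N * ideal_gain fmt q b v (interim s w) t"
proof -
  have I: "(\<Sum>i<N. win s i (s w)) = real N * interim s w" using N_ge_1 by (simp add: interim_def)
  show ?thesis
  proof (cases fmt)
    case First_Price
    have "(\<Sum>i<N. ideal_gain fmt q b v (win s i (s w)) t) = real N * (q * (v - b)) - (\<Sum>i<N. win s i (s w)) * (v - t)"
      unfolding First_Price by (simp add: sum_subtractf sum_distrib_right)
    thus ?thesis unfolding I First_Price by (simp add: right_diff_distrib)
  next
    case All_Pay
    have "(\<Sum>i<N. ideal_gain fmt q b v (win s i (s w)) t) = real N * (q * v - b) - ((\<Sum>i<N. win s i (s w)) * v - real N * t)"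
      unfolding All_Pay by (simp add: sum_subtractf sum_distrib_right)
    thus ?thesis unfolding I All_Pay by (simp add: right_diff_distrib)
  qed
qed

text \<open>For each buyer the equilibrium condition is used against the bids 0 and
  \<open>b'\<close>; averaging over the buyers replaces \<open>win\<close> by
  \<open>interim\<close>.\<close>

lemma BCCE_ideal_gain:
  assumes eq: "BCCE fmt N V B F \<sigma>" and fin: "finite (set_pmf \<sigma>)"
    and sym: "\<And>l i j. l \<in> set_pmf \<sigma> \<Longrightarrow> i < N \<Longrightarrow> j < N \<Longrightarrow> l i = l j"
    and B: "0 \<in> B" "b' \<in> B"
    and q: "\<And>l. l \<in> set_pmf \<sigma> \<Longrightarrow> q l = (\<Sum>w\<in>{w\<in>V. l 0 w < b}. mass w) ^ (N - 1)"
    and b: "0 \<le> b" "b \<le> v" "b \<le> b'" "b' \<le> b + 2 * d"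
    and w: "w \<in> V" "w \<le> v" "v \<le> w + 2 * d"
  shows "(\<Sum>l\<in>set_pmf \<sigma>. pmf \<sigma> l * ideal_gain fmt (q l) b v (interim (l 0) w) (l 0 w)) \<le> min v (4 * d)"
proof -
  let ?S = "set_pmf \<sigma>"
  have one: "(\<Sum>l\<in>?S. pmf \<sigma> l) = 1" using fin by (rule sum_pmf_eq_1) simp
  have w0: "0 \<le> w" using w V_nonneg by simp
  have q01: "0 \<le> q l" "q l \<le> 1" if "l \<in> ?S" for l
  proof -
    have "0 \<le> (\<Sum>w\<in>{w\<in>V. l 0 w < b}. mass w)" using mass_pos by (intro sum_nonneg) (auto intro: less_imp_le)
    moreover have "(\<Sum>w\<in>{w\<in>V. l 0 w < b}. mass w) \<le> (\<Sum>w\<in>V. mass w)"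
      using mass_pos finite_V by (intro sum_mono2) (auto intro: less_imp_le)
    ultimately show "0 \<le> q l" "q l \<le> 1" unfolding q[OF that] sum_mass by (auto intro: power_le_one)
  qed
  have q_win: "q l \<le> win (l 0) i b'" if "l \<in> ?S" "i < N" for l i
  proof -
    have "(\<Sum>w\<in>{w\<in>V. l 0 w < b}. mass w) \<le> (\<Sum>w\<in>{w\<in>V. l 0 w < b'}. mass w)"
      using mass_pos finite_V b by (intro sum_mono2) (auto intro: less_imp_le)
    hence "q l \<le> (\<Sum>w\<in>{w\<in>V. l 0 w < b'}. mass w) ^ (N - 1)"
      unfolding q[OF that(1)] using mass_pos by (intro power_mono sum_nonneg) (auto intro: less_imp_le)
    also have "\<dots> \<le> win (l 0) i b'" by (rule win_ge[OF that(2)])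
    finally show ?thesis .
  qed
  define G where "G i = (\<Sum>l\<in>?S. pmf \<sigma> l * ideal_gain fmt (q l) b v (win (l 0) i (l 0 w)) (l 0 w))" for i
  have step: "G i \<le> c" if i: "i < N" and bid: "bid \<in> B"
    and le: "\<And>l. l \<in> ?S \<Longrightarrow> ideal_gain fmt (q l) b v (win (l 0) i (l 0 w)) (l 0 w)
        \<le> exp_utility fmt (l 0) i bid w - exp_utility fmt (l 0) i (l 0 w) w + c" for i bid c
  proof -
    have "G i \<le> (\<Sum>l\<in>?S. pmf \<sigma> l * (exp_utility fmt (l 0) i bid w - exp_utility fmt (l 0) i (l 0 w) w + c))"
      unfolding G_def using le by (intro sum_mono mult_left_mono) auto
    also have "\<dots> = (\<Sum>l\<in>?S. pmf \<sigma> l * (exp_utility fmt (l 0) i bid w - exp_utility fmt (l 0) i (l 0 w) w)) + c"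
      using one by (simp add: distrib_left sum.distrib sum_distrib_right[symmetric])
    also have "\<dots> \<le> c" using BCCE_no_deviation[OF eq fin sym i w(1) bid] by simp
    finally show ?thesis .
  qed
  have G: "G i \<le> min v (4 * d)" if "i < N" for i
  proof (rule min.boundedI)
    show "G i \<le> v"
      by (rule step[OF that B(1)]) (intro ideal_gain_le_zero_bid q01 b w w0)
    show "G i \<le> 4 * d"
      by (rule step[OF that B(2)]) (intro ideal_gain_le_deviation q01 q_win that b w w0)
  qed
  have "real N * (\<Sum>l\<in>?S. pmf \<sigma> l * ideal_gain fmt (q l) b v (interim (l 0) w) (l 0 w))
      = (\<Sum>l\<in>?S. pmf \<sigma> l * (\<Sum>i<N. ideal_gain fmt (q l) b v (win (l 0) i (l 0 w)) (l 0 w)))"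
    by (simp add: ideal_gain_average sum_distrib_left mult.left_commute)
  also have "\<dots> = (\<Sum>i<N. G i)"
    unfolding G_def sum_distrib_left by (rule sum.swap)
  also have "\<dots> \<le> real N * min v (4 * d)" using sum_bounded_above[of "{..<N}" G] G by simp
  finally show ?thesis using N_ge_1 by (simp add: mult_le_cancel_left)
qed

text \<open>Replacing the bid by 0 gains a positive multiple of it, in every profile. As these gains
  have a nonpositive average, all of them vanish. For \<open>w = 0\<close> this makes
  \<open>l / v\<close> integrable; for \<open>N = 1\<close> it settles the whole bound.\<close>

lemma BCCE_zero_type:
  assumes eq: "BCCE fmt N V B F \<sigma>" and fin: "finite (set_pmf \<sigma>)"
    and sym: "\<And>l i j. l \<in> set_pmf \<sigma> \<Longrightarrow> i < N \<Longrightarrow> j < N \<Longrightarrow> l i = l j"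
    and B: "0 \<in> B" and w: "w \<in> V" "w = 0 \<or> N = 1"
    and nonneg: "\<And>l. l \<in> set_pmf \<sigma> \<Longrightarrow> 0 \<le> l 0 w" and l: "l \<in> set_pmf \<sigma>"
  shows "l 0 w = 0"
proof -
  have N0: "0 < N" using N_ge_1 by simp
  have sole: "win s 0 b = 1" if "N = 1" for s b
    using win_ge[OF N0, of s b] win_le_1[of s 0 b] that by simp
  have pos: "0 < win (l 0) 0 (l 0 w)" for l :: "nat \<Rightarrow> real \<Rightarrow> real" by (rule win_own_pos[OF N0 w(1)])
  define g where "g l = exp_utility fmt (l 0) 0 0 w - exp_utility fmt (l 0) 0 (l 0 w) w" for l :: "nat \<Rightarrow> real \<Rightarrow> real"
  have g: "\<exists>c>0. g l = c * l 0 w" for l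
  proof (cases fmt)
    case First_Price
    thus ?thesis using w(2) pos[of l] sole
      by (intro exI[of _ "win (l 0) 0 (l 0 w)"]) (auto simp: g_def algebra_simps)
  next
    case All_Pay
    thus ?thesis using w(2) sole by (intro exI[of _ 1]) (auto simp: g_def)
  qed
  have g_nonneg: "0 \<le> pmf \<sigma> l * g l" if "l \<in> set_pmf \<sigma>" for l
    using g[of l] nonneg[OF that] by auto
  have "(\<Sum>l\<in>set_pmf \<sigma>. pmf \<sigma> l * g l) \<le> 0"
    using BCCE_no_deviation[OF eq fin sym N0 w(1) B] by (simp add: g_def)
  hence "(\<Sum>l\<in>set_pmf \<sigma>. pmf \<sigma> l * g l) = 0" using g_nonneg by (intro antisym sum_nonneg)
  hence "pmf \<sigma> l * g l = 0" using sum_nonneg_eq_0_iff[OF fin g_nonneg] l by simp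
  moreover have "pmf \<sigma> l \<noteq> 0" using l by (simp add: set_pmf_iff)
  ultimately show ?thesis using g[of l] by auto
qed

end

section \<open>The bound\<close>

lemma K_const_facts:
  assumes "2 \<le> N" "0 < \<alpha>" "fmt = First_Price \<longrightarrow> \<alpha> < 1" "1 \<le> Bmax"
  shows "Bmax \<le> K_const fmt \<alpha> N Bmax"
    and "fmt = All_Pay \<Longrightarrow> real (N - 1) \<le> K_const fmt \<alpha> N Bmax * (1/\<alpha>)"
    and "fmt = First_Price \<Longrightarrow> real (N - 1) \<le> K_const fmt \<alpha> N Bmax * (1/\<alpha> - 1)"
proof -
  have N: "real (N - 1) = real N - 1" using assms by (simp add: of_nat_diff)
  show "Bmax \<le> K_const fmt \<alpha> N Bmax" by (cases fmt) (auto intro: Max_ge)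
  show "real (N - 1) \<le> K_const fmt \<alpha> N Bmax * (1/\<alpha>)" if "fmt = All_Pay"
  proof -
    \<comment> \<open>\<open>N - 1 \<le> 2 * N - 3\<close> because \<open>N \<ge> 2\<close>.\<close>
    have "\<alpha> * real (N - 1) \<le> \<alpha> * (2 * real N - 3)" unfolding N using assms by (intro mult_left_mono) auto
    also have "\<dots> \<le> K_const fmt \<alpha> N Bmax" using that by (auto intro: Max_ge)
    finally show ?thesis using assms by (simp add: field_simps)
  qed
  show "real (N - 1) \<le> K_const fmt \<alpha> N Bmax * (1/\<alpha> - 1)" if "fmt = First_Price"
  proof -
    have a: "\<alpha> < 1" using assms that by simp
    have "real (N - 1) = \<alpha> * (real N - 1) / (1 - \<alpha>) * (1/\<alpha> - 1)"
      unfolding N using assms(2) a by (simp add: field_simps)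
    also have "\<dots> \<le> K_const fmt \<alpha> N Bmax * (1/\<alpha> - 1)"
      using that a assms(2) by (intro mult_right_mono) (auto intro: Max_ge)
    finally show ?thesis .
  qed
qed

context auction_grid
begin

definition win_prob_below :: "(real \<Rightarrow> real) \<Rightarrow> real \<Rightarrow> real" where
  "win_prob_below s b = (\<Sum>w\<in>{w\<in>V. s w < b}. mass w) ^ (N - 1)"

text \<open>Common interface of the two formats: \<open>R\<close> is the respective rate, tied to
  \<open>ideal_gain\<close> away from \<theta> = 0, where one may divide by the valuation.\<close>

lemma loss_le_ideal_gain:
  assumes N: "2 \<le> N" and fp: "fmt = First_Price \<longrightarrow> \<alpha> < 1" and Bmax: "1 \<le> Bmax"
    and s: "\<And>w. w \<in> V \<Longrightarrow> 0 \<le> s w" "\<And>w. w \<in> V \<Longrightarrow> s w \<le> Bmax" "s 0 = 0"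
  obtains R where "R integrable_on {0..1}"
    and "\<And>\<theta>. 0 < \<theta> \<Longrightarrow> \<theta> \<le> 1 \<Longrightarrow> R \<theta> = ideal_gain fmt (win_prob_below s (canonical_eq fmt N \<alpha> \<theta>))
            (canonical_eq fmt N \<alpha> \<theta>) (valuation \<alpha> \<theta>) (interim s (cell \<theta>)) (s (cell \<theta>)) / valuation \<alpha> \<theta>"
    and "integral {0..1} (\<lambda>\<theta>. \<theta> powi (int N - 2) * ((induced \<alpha> V s \<theta> - canonical_eq fmt N \<alpha> \<theta>)\<^sup>2 / 2))
            \<le> K_const fmt \<alpha> N Bmax * integral {0..1} R"
proof -
  define m where "m = N - 1"
  have Nm: "N = Suc m" "N - 2 = m - 1" "int N - 2 = int (m - 1)" "1 \<le> m" using N by (auto simp: m_def)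
  define e where "e = bid_exp fmt N \<alpha>"
  define K where "K = K_const fmt \<alpha> N Bmax"
  note Kf = K_const_facts[OF N alpha_pos fp Bmax, folded K_def m_def]
  have e0: "0 < e"
    using alpha_pos Nm by (cases fmt) (auto simp: e_def bid_exp_def intro: add_pos_pos)
  interpret G: bid_grid V \<alpha> s m Bmax K e
    using s Nm Bmax Kf(1) e0 by unfold_locales auto
  have beta: "G.\<beta> \<theta> = canonical_eq fmt N \<alpha> \<theta>" if "0 \<le> \<theta>" for \<theta>
    unfolding canonical_eq_powr[OF N alpha_pos that, of fmt, folded e_def m_def] G.\<beta>_def G.\<kappa>_def ..
  have below: "G.below b ^ m = win_prob_below s b" for b
    by (simp add: G.below_def win_prob_below_def m_def)
  have sumx: "(\<Sum>w\<in>V. mass w * interim s w) \<le> 1 / (real m + 1)"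
    using sum_interim_total[of s] by (simp add: Nm(1) add.commute)
  have loss: "integral {0..1} (\<lambda>\<theta>. \<theta> powi (int N - 2) * ((induced \<alpha> V s \<theta> - canonical_eq fmt N \<alpha> \<theta>)\<^sup>2 / 2))
      = integral {0..1} (\<lambda>\<theta>. \<theta> ^ (m-1) * ((s (cell \<theta>) - G.\<beta> \<theta>)\<^sup>2 / 2))"
    unfolding Nm(3) by (intro integral_cong) (simp add: beta induced_def cell_def)
  have v: "0 < valuation \<alpha> \<theta>" if "0 < \<theta>" for \<theta> using that by (simp add: valuation_def)
  show thesis
  proof (cases fmt)
    case All_Pay
    interpret A: allpay_grid V \<alpha> s m Bmax K e
      using Kf(2) All_Pay by unfold_locales (auto simp: e_def bid_exp_def m_def)
    show thesis
    proof (rule that[of "A.allpay_rate (interim s)"])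
      show "A.allpay_rate (interim s) integrable_on {0..1}" by (rule A.allpay_rate_integrable)
      show "integral {0..1} (\<lambda>\<theta>. \<theta> powi (int N - 2) * ((induced \<alpha> V s \<theta> - canonical_eq fmt N \<alpha> \<theta>)\<^sup>2 / 2))
            \<le> K_const fmt \<alpha> N Bmax * integral {0..1} (A.allpay_rate (interim s))"
        unfolding loss K_def[symmetric] by (rule A.loss_le_allpay_rate[OF sumx])
      fix \<theta> :: real assume t: "0 < \<theta>" "\<theta> \<le> 1"
      show "A.allpay_rate (interim s) \<theta> = ideal_gain fmt (win_prob_below s (canonical_eq fmt N \<alpha> \<theta>))
            (canonical_eq fmt N \<alpha> \<theta>) (valuation \<alpha> \<theta>) (interim s (cell \<theta>)) (s (cell \<theta>)) / valuation \<alpha> \<theta>"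
        using t v[OF t(1)] beta[of \<theta>] unfolding A.allpay_rate_def below
        by (simp add: All_Pay diff_divide_distrib del: canonical_eq.simps)
    qed
  next
    case First_Price
    interpret A: first_price_grid V \<alpha> s m Bmax K e "interim s"
    proof unfold_locales
      show "((G.below b + (\<Sum>w'\<in>{w'\<in>V. b \<le> s w' \<and> w' \<le> w}. mass w')) ^ Suc m - G.below b ^ Suc m) / real (Suc m)
          \<le> (\<Sum>w'\<in>{w'\<in>V. b \<le> s w' \<and> w' \<le> w}. mass w' * interim s w')" for b w
        using interim_prefix[of "{w'\<in>V. b \<le> s w' \<and> w' \<le> w}" b s] unfolding Nm(1) G.below_def by auto
    qed (use First_Price fp Kf(3) in \<open>auto simp: e_def bid_exp_def\<close>)
    show thesis
    proof (rule that[of A.first_price_rate])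
      show "A.first_price_rate integrable_on {0..1}"
        using A.has_integral_first_price_rate by (rule has_integral_integrable)
      show "integral {0..1} (\<lambda>\<theta>. \<theta> powi (int N - 2) * ((induced \<alpha> V s \<theta> - canonical_eq fmt N \<alpha> \<theta>)\<^sup>2 / 2))
            \<le> K_const fmt \<alpha> N Bmax * integral {0..1} A.first_price_rate"
        unfolding loss K_def[symmetric] by (rule A.loss_le_first_price_rate[OF sumx])
      fix \<theta> :: real assume t: "0 < \<theta>" "\<theta> \<le> 1"
      have "canonical_eq fmt N \<alpha> \<theta> = G.\<beta> \<theta>" using beta t by simp
      also have "\<dots> = G.\<kappa> * valuation \<alpha> \<theta>"
        unfolding G.\<beta>_def by (simp add: valuation_def e_def bid_exp_def First_Price)
      finally have "canonical_eq fmt N \<alpha> \<theta> = G.\<kappa> * valuation \<alpha> \<theta>" .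
      moreover have "(q * (v - k * v) - y * (v - z)) / v = (1 - k) * q - y + y * z / v"
        if "0 < v" for q v k y z :: real using that by (simp add: field_simps)
      ultimately show "A.first_price_rate \<theta> = ideal_gain fmt (win_prob_below s (canonical_eq fmt N \<alpha> \<theta>))
            (canonical_eq fmt N \<alpha> \<theta>) (valuation \<alpha> \<theta>) (interim s (cell \<theta>)) (s (cell \<theta>)) / valuation \<alpha> \<theta>"
        using t v[OF t(1)] beta[of \<theta>] unfolding A.first_price_rate_def below
        by (simp add: First_Price del: canonical_eq.simps)
    qed
  qed
qed

end

theorem proposition5p8:
  fixes fmt :: auction_format and N n :: nat and \<alpha> Bmax :: real
    and \<delta> :: "nat \<Rightarrow> real" and V B :: "nat \<Rightarrow> real set" and F :: "nat \<Rightarrow> real pmf"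
    and \<sigma> :: "(nat \<Rightarrow> real \<Rightarrow> real) pmf"
  assumes "1 \<le> N"
    and "0 < \<alpha>"
    and "fmt = First_Price \<Longrightarrow> \<alpha> < 1"
    and "{0..1} \<subseteq> {0..Bmax}"
    and "delta_fine \<alpha> Bmax \<delta> V B F"
    and "4 * \<delta> n \<le> 1"
    and "BCCE fmt N (V n) (B n) (F n) \<sigma>"
    and "\<And>l i j. pmf \<sigma> l > 0 \<Longrightarrow> i < N \<Longrightarrow> j < N \<Longrightarrow> l i = l j"
  shows "(\<Sum>l\<in>symmetric_profiles N (V n) (B n). pmf \<sigma> l *
            (\<Sum>i<N. integral {0..1}
               (\<lambda>\<theta>. \<theta> powi (int N - 2) *
                    ((induced \<alpha> (V n) (l i) \<theta> - canonical_eq fmt N \<alpha> \<theta>)\<^sup>2 / 2))))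
         \<le> K_const fmt \<alpha> N Bmax * real N *
            (if \<alpha> = 1 then 4 * \<delta> n * (1 - ln (4 * \<delta> n))
             else 4 * \<delta> n * (\<alpha> / (\<alpha> - 1)) - (4 * \<delta> n) powr \<alpha> / (\<alpha> - 1))"
proof -
  define d where "d = \<delta> n"
  define W where "W = V n"
  define C where "C = B n"
  define P where "P = F n"
  define budget where "budget = (if \<alpha> = 1 then 4 * d * (1 - ln (4 * d))
             else 4 * d * (\<alpha> / (\<alpha> - 1)) - (4 * d) powr \<alpha> / (\<alpha> - 1))"
  define loss where "loss s = integral {0..1} (\<lambda>\<theta>. \<theta> powi (int N - 2) *
                    ((induced \<alpha> W s \<theta> - canonical_eq fmt N \<alpha> \<theta>)\<^sup>2 / 2))" for s
  define K where "K = K_const fmt \<alpha> N Bmax"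
  let ?S = "set_pmf \<sigma>"
  have fine: "finite W" "W \<subseteq> {0..<1}" "0 \<in> W" "finite C" "C \<subseteq> {0..Bmax}" "0 \<in> C" "Bmax \<in> C" "set_pmf P \<subseteq> W"
      "\<And>v. v \<in> W \<Longrightarrow> pmf P v = power_cdf \<alpha> (succ_val W v) - power_cdf \<alpha> v"
      "(SUP w\<in>{0..1}. INF w'\<in>W. \<bar>w - w'\<bar>) \<le> d" "(SUP b\<in>{0..Bmax}. INF b'\<in>C. \<bar>b - b'\<bar>) \<le> d"
    using assms(5) unfolding delta_fine_def W_def C_def P_def d_def by auto
  have eq: "BCCE fmt N W C P \<sigma>" using assms(7) by (simp add: W_def C_def P_def)
  have fp: "fmt = First_Price \<longrightarrow> \<alpha> < 1" using assms(3) by blast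
  have Bmax: "1 \<le> Bmax" using assms(4) by (simp add: subset_eq)
  interpret type_grid W \<alpha> using fine assms(2) by unfold_locales auto
  interpret auction_grid W \<alpha> P N
  proof
    show "pmf P v = mass v" if "v \<in> W" for v
      using fine(9)[OF that] V_nonneg[OF that] succ_gt[OF that] succ_le_1[of v]
      by (simp add: power_cdf_def mass_def lo_def hi_def min_def max_def)
  qed (use fine assms(1) in auto)
  have sub: "?S \<subseteq> symmetric_profiles N W C"
  proof
    fix l assume l: "l \<in> ?S"
    hence "l \<in> pure_profiles N W C" using eq by (auto simp: BCCE_def)
    moreover have "\<forall>i<N. \<forall>j<N. l i = l j" using assms(8)[OF pmf_positive[OF l]] by blast
    ultimately show "l \<in> symmetric_profiles N W C" unfolding symmetric_profiles_def by blast
  qed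
  have finS: "finite (symmetric_profiles N W C)"
  proof -
    have "finite (pure_profiles N W C)" unfolding pure_profiles_def using fine by (intro finite_PiE) auto
    thus ?thesis by (rule finite_subset[rotated]) (auto simp: symmetric_profiles_def)
  qed
  have fin: "finite ?S" using sub finS by (rule finite_subset)
  have sym: "l i = l j" if "l \<in> ?S" "i < N" "j < N" for l i j
    using assms(8)[OF pmf_positive[OF that(1)] that(2,3)] .
  have bids: "l 0 w \<in> {0..Bmax}" if "l \<in> ?S" "w \<in> W" for l w
  proof -
    have "l \<in> pure_profiles N W C" using eq that by (auto simp: BCCE_def)
    hence "l 0 \<in> W \<rightarrow>\<^sub>E C" using assms(1) by (auto simp: pure_profiles_def dest: PiE_mem)
    thus ?thesis using fine(5) that(2) by (auto dest: PiE_mem)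
  qed
  \<comment> \<open>The quantile 1 has valuation 1, which must be covered although all grid
    valuations lie below 1.\<close>
  have d0: "0 < d"
  proof -
    obtain w where w: "w \<in> W" "\<bar>1 - w\<bar> \<le> d" using covering_point[OF fine(1,3,10), of 1] by auto
    thus ?thesis using fine(2) by force
  qed
  have total: "(\<Sum>l\<in>symmetric_profiles N W C. pmf \<sigma> l * (\<Sum>i<N. loss (l i)))
      = real N * (\<Sum>l\<in>?S. pmf \<sigma> l * loss (l 0))"
  proof -
    have "(\<Sum>l\<in>symmetric_profiles N W C. pmf \<sigma> l * (\<Sum>i<N. loss (l i))) = (\<Sum>l\<in>?S. pmf \<sigma> l * (\<Sum>i<N. loss (l i)))"
      using finS sub by (intro sum.mono_neutral_right) (auto simp: set_pmf_iff)
    also have "\<dots> = (\<Sum>l\<in>?S. pmf \<sigma> l * (real N * loss (l 0)))"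
    proof (intro sum.cong refl arg_cong2[of _ _ _ _ "(*)"])
      fix l assume l: "l \<in> ?S"
      have "(\<Sum>i<N. loss (l i)) = (\<Sum>i<N. loss (l 0))"
      proof (rule sum.cong[OF refl])
        fix i assume "i \<in> {..<N}"
        thus "loss (l i) = loss (l 0)" using sym[OF l, of i 0] assms(1) by simp
      qed
      thus "(\<Sum>i<N. loss (l i)) = real N * loss (l 0)" by simp
    qed
    finally show ?thesis by (simp add: sum_distrib_left mult.left_commute)
  qed
  have budget: "((\<lambda>\<theta>. min 1 (4 * d / valuation \<alpha> \<theta>)) has_integral budget) {0..1}"
    unfolding budget_def using d0 assms(2,6) by (intro has_integral_budget) (auto simp: d_def)
  have budget0: "0 \<le> budget"
    using d0 by (intro has_integral_nonneg[OF budget]) (auto simp: valuation_def)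
  have K0: "0 \<le> K"
  proof -
    have "Bmax \<le> K" unfolding K_def by (cases fmt) (auto intro: Max_ge)
    thus ?thesis using Bmax by simp
  qed
  have "(\<Sum>l\<in>?S. pmf \<sigma> l * loss (l 0)) \<le> K * budget"
  proof (cases "N = 1")
    \<comment> \<open>The weight \<open>\<theta> powi (-1)\<close> is not integrable, but \<beta>
      and all bids in the support are 0, so the integrand vanishes.\<close>
    case True
    have "loss (l 0) = 0" if l: "l \<in> ?S" for l
    proof -
      have z: "l 0 w = 0" if "w \<in> W" for w
        using BCCE_zero_type[OF eq fin sym fine(6) that _ _ l] True bids that by auto
      have "canonical_eq fmt N \<alpha> \<theta> = 0" for \<theta> using True by (cases fmt) auto
      moreover have "induced \<alpha> W (l 0) \<theta> = 0" if "\<theta> \<in> {0..1}" for \<theta>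
        using z cell_in[of \<theta>] that by (simp add: induced_def cell_def)
      ultimately have "loss (l 0) = integral {0..1} (\<lambda>\<theta>::real. 0::real)"
        unfolding loss_def by (intro integral_cong) simp
      thus ?thesis by simp
    qed
    hence "(\<Sum>l\<in>?S. pmf \<sigma> l * loss (l 0)) = 0" by simp
    thus ?thesis using K0 budget0 by simp
  next
    case False
    hence N: "2 \<le> N" using assms(1) by simp
    have "\<exists>R. R integrable_on {0..1} \<and> (\<forall>\<theta>. 0 < \<theta> \<longrightarrow> \<theta> \<le> 1 \<longrightarrow> R \<theta> =
              ideal_gain fmt (win_prob_below (l 0) (canonical_eq fmt N \<alpha> \<theta>))
              (canonical_eq fmt N \<alpha> \<theta>) (valuation \<alpha> \<theta>) (interim (l 0) (cell \<theta>)) (l 0 (cell \<theta>)) / valuation \<alpha> \<theta>)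
          \<and> loss (l 0) \<le> K * integral {0..1} R" if l: "l \<in> ?S" for l
    proof -
      have r: "\<And>w. w \<in> W \<Longrightarrow> 0 \<le> l 0 w" "\<And>w. w \<in> W \<Longrightarrow> l 0 w \<le> Bmax" using bids[OF l] by auto
      have z: "l 0 0 = 0" using BCCE_zero_type[OF eq fin sym fine(6,3) _ _ l] bids fine(3) by auto
      show ?thesis by (rule loss_le_ideal_gain[where s = "l 0", OF N fp Bmax r z]) (unfold loss_def K_def, blast+)
    qed
    then obtain R where R: "\<And>l. l \<in> ?S \<Longrightarrow> R l integrable_on {0..1}"
        "\<And>l \<theta>. l \<in> ?S \<Longrightarrow> 0 < \<theta> \<Longrightarrow> \<theta> \<le> 1 \<Longrightarrow> R l \<theta> =
              ideal_gain fmt (win_prob_below (l 0) (canonical_eq fmt N \<alpha> \<theta>))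
              (canonical_eq fmt N \<alpha> \<theta>) (valuation \<alpha> \<theta>) (interim (l 0) (cell \<theta>)) (l 0 (cell \<theta>)) / valuation \<alpha> \<theta>"
        "\<And>l. l \<in> ?S \<Longrightarrow> loss (l 0) \<le> K * integral {0..1} (R l)" by metis
    have "(\<Sum>l\<in>?S. pmf \<sigma> l * integral {0..1} (R l)) \<le> budget"
    proof (rule has_integral_le[OF has_integral_spike_finite[of "{0}"] budget])
      show "((\<lambda>\<theta>. \<Sum>l\<in>?S. pmf \<sigma> l * R l \<theta>) has_integral (\<Sum>l\<in>?S. pmf \<sigma> l * integral {0..1} (R l))) {0..1}"
        by (intro has_integral_sum fin has_integral_mult_right integrable_integral R)
      fix \<theta> :: real assume t: "\<theta> \<in> {0..1}"
      show "(if \<theta> = 0 then 0 else \<Sum>l\<in>?S. pmf \<sigma> l * R l \<theta>) \<le> min 1 (4 * d / valuation \<alpha> \<theta>)"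
      proof (cases "\<theta> = 0")
        case True
        thus ?thesis by (simp add: valuation_def)
      next
        case False
        hence t: "0 < \<theta>" "\<theta> \<le> 1" using t by auto
        define v where "v = valuation \<alpha> \<theta>"
        define w where "w = cell \<theta>"
        define b where "b = canonical_eq fmt N \<alpha> \<theta>"
        have v: "0 < v" "v \<le> 1" using t assms(2) by (auto simp: v_def valuation_def powr_le1)
        have w: "w \<in> W" "w \<le> v" using cell_in cell_le t by (auto simp: w_def v_def)
        \<comment> \<open>Otherwise a grid point within \<open>d\<close> of the midpoint of
          \<open>w\<close> and \<open>v\<close> would lie strictly between them, against the
          maximality of \<open>cell \<theta>\<close>.\<close>
        have vw: "v \<le> w + 2 * d"
        proof (rule ccontr)
          assume far: "\<not> v \<le> w + 2 * d"
          define u where "u = (v + w) / 2"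
          have u: "2 * u = v + w" by (simp add: u_def)
          have "u \<in> {0..1}" using v w u V_nonneg[OF w(1)] by auto
          then obtain w' where w': "w' \<in> W" "\<bar>u - w'\<bar> \<le> d" using covering_point[OF fine(1,3,10)] by blast
          hence "w < w'" "w' \<le> v" using far u by linarith+
          thus False using cell_ge[of \<theta> w'] w'(1) t by (simp add: w_def v_def)
        qed
        have b: "0 \<le> b" "b \<le> v"
        proof -
          define k where "k = real (N-1) / (real (N-1) + 1/\<alpha>)"
          have "0 < 1/\<alpha>" using assms(2) by simp
          hence c: "0 < real (N-1) + 1/\<alpha>" "real (N-1) \<le> real (N-1) + 1/\<alpha>" by linarith+
          have k: "0 \<le> k" "k \<le> 1"
            unfolding k_def using c by (simp_all only: divide_nonneg_pos of_nat_0_le_iff divide_le_eq_1_pos)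
          have b_eq: "b = k * \<theta> powr bid_exp fmt N \<alpha>"
            unfolding b_def k_def using t by (intro canonical_eq_powr N assms(2)) simp
          show "0 \<le> b" unfolding b_eq using k by simp
          have "b \<le> \<theta> powr bid_exp fmt N \<alpha>" unfolding b_eq using k by (intro mult_left_le_one_le) auto
          also have "\<dots> \<le> v"
            unfolding v_def valuation_def using t by (intro powr_mono') (cases fmt, auto simp: bid_exp_def)
          finally show "b \<le> v" .
        qed
        \<comment> \<open>A grid bid within \<open>d\<close> of \<open>b + d\<close> is at least
          \<open>b\<close>. Where \<open>b + d\<close> might leave the bid interval,
          \<open>Bmax\<close> itself is close enough.\<close>
        obtain b' where b': "b' \<in> C" "b \<le> b'" "b' \<le> b + 2 * d"
        proof (cases "Bmax \<le> b + 2 * d")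
          case True
          thus thesis using that[of Bmax] fine(7) b v Bmax by linarith
        next
          case False
          obtain b' where "b' \<in> C" "\<bar>(b + d) - b'\<bar> \<le> d"
            using covering_point[OF fine(4,6,11), of "b + d"] b d0 False by auto
          thus thesis by (intro that[of b']) auto
        qed
        have "(\<Sum>l\<in>?S. pmf \<sigma> l * ideal_gain fmt (win_prob_below (l 0) b) b v (interim (l 0) w) (l 0 w)) \<le> min v (4 * d)"
          by (rule BCCE_ideal_gain[OF eq fin sym fine(6) b'(1) _ b b'(2,3) w vw]) (simp_all add: win_prob_below_def)
        hence "(\<Sum>l\<in>?S. pmf \<sigma> l * ideal_gain fmt (win_prob_below (l 0) b) b v (interim (l 0) w) (l 0 w)) / v
            \<le> min v (4 * d) / v" using v by (intro divide_right_mono) auto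
        moreover have "(\<Sum>l\<in>?S. pmf \<sigma> l * ideal_gain fmt (win_prob_below (l 0) b) b v (interim (l 0) w) (l 0 w)) / v
            = (\<Sum>l\<in>?S. pmf \<sigma> l * R l \<theta>)"
          unfolding sum_divide_distrib using R(2) t by (intro sum.cong) (simp_all add: b_def v_def w_def)
        moreover have "min v (4 * d) / v = min 1 (4 * d / v)" using v by (simp add: min_def divide_le_eq)
        ultimately show ?thesis using False by (simp add: v_def)
      qed
    qed auto
    have "(\<Sum>l\<in>?S. pmf \<sigma> l * loss (l 0)) \<le> (\<Sum>l\<in>?S. pmf \<sigma> l * (K * integral {0..1} (R l)))"
      using R(3) by (intro sum_mono mult_left_mono) auto
    also have "\<dots> = K * (\<Sum>l\<in>?S. pmf \<sigma> l * integral {0..1} (R l))"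
      by (simp add: sum_distrib_left mult.left_commute)
    also have "\<dots> \<le> K * budget" by (rule mult_left_mono) fact+
    finally show ?thesis .
  qed
  hence "real N * (\<Sum>l\<in>?S. pmf \<sigma> l * loss (l 0)) \<le> real N * (K * budget)" by (intro mult_left_mono) auto
  hence "(\<Sum>l\<in>symmetric_profiles N W C. pmf \<sigma> l * (\<Sum>i<N. loss (l i))) \<le> K * real N * budget"
    unfolding total by (simp add: mult.left_commute mult.commute)
  thus ?thesis unfolding loss_def K_def budget_def W_def C_def d_def .
qed

end
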